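(* Let $\varphi\in L^\infty(\mathbb{T})$ and let $\Theta$ be an inner function. (1) If $A^\Theta_\varphi$ is bounded below, then there exists $\delta>0$ such that $$\widehat{|\varphi|}(\lambda)+|\Theta(\lambda)|\ge\delta\quad\text{for all }\lambda\in\mathbb{D}.$$ (2) If $\varphi\ge 0$, the following assertions are equivalent: (a) the operator $A^\Theta_\varphi$ is invertible; (b) there exists $\delta>0$ such that $\widehat{|\varphi|}(\lambda)+|\Theta(\lambda)|\ge\delta$ for all $\lambda\in\mathbb{D}$.
   Context: $\mathbb{D}$ is the open unit disc and $\mathbb{T}$ the unit circle with normalized Lebesgue measure $m$. $H^2$ is the Hardy space, viewed as a subspace of $L^2=L^2(\mathbb{T},m)$. An inner function is $\Theta\in H^\infty$ with $|\Theta|=1$ $m$-a.e. on $\mathbb{T}$. The model space is $K_\Theta=H^2\ominus\Theta H^2$; $P_\Theta$ is the orthogonal projection of $L^2$ onto $K_\Theta$. For $\varphi\in L^\infty(\mathbb{T})$ the truncated Toeplitz operator $A^\Theta_\varphi:K_\Theta\to K_\Theta$ is the bounded operator $A^\Theta_\varphi f=P_\Theta(\varphi f)$. For $f\in L^1(\mathbb{T})$, $\hat f$ denotes its Poisson transform $\hat f(z)=\int_{\mathbb{T}}f(\xi)\frac{1-|z|^2}{|1-\xi\bar z|^2}\,dm(\xi)$, $z\in\mathbb{D}$; in particular $\widehat{|\varphi|}$ is the Poisson transform of $|\varphi|$. A bounded operator $T$ on a Hilbert space is bounded below if there is $c>0$ with $\|Tf\|\ge c\|f\|$ for all $f$. 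*)

theory Defs
  imports "HOL-Analysis.Analysis"
begin

text \<open>
  Elements of the Lebesgue spaces of the circle are represented by functions on the complex plane,
  of which only the values on the unit circle matter. Functions are not identified when they agree
  almost everywhere, so equality of elements of these spaces is written as an AE statement.
\<close>

definition circle_measure :: "complex measure" where
  "circle_measure =
     distr (uniform_measure lborel {0..2 * pi}) (restrict_space borel (sphere 0 1)) cis"

definition circle_L2 :: "(complex \<Rightarrow> complex) set" where
  "circle_L2 = {f \<in> borel_measurable circle_measure.
     integrable circle_measure (\<lambda>\<xi>. (norm (f \<xi>))\<^sup>2)}"

definition circle_Linf :: "(complex \<Rightarrow> complex) set" where
  "circle_Linf = {f \<in> borel_measurable circle_measure.
     \<exists>C. AE \<xi> in circle_measure. norm (f \<xi>) \<le> C}"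

definition L2_inner :: "(complex \<Rightarrow> complex) \<Rightarrow> (complex \<Rightarrow> complex) \<Rightarrow> complex" where
  "L2_inner f g = (LINT \<xi>|circle_measure. f \<xi> * cnj (g \<xi>))"

definition L2_norm :: "(complex \<Rightarrow> complex) \<Rightarrow> real" where
  "L2_norm f = sqrt (LINT \<xi>|circle_measure. (norm (f \<xi>))\<^sup>2)"

text \<open>
  The Hardy space as a subspace of the square-integrable functions on the circle: the Fourier
  coefficients of negative index vanish. On the circle \<open>\<xi> ^ n\<close> is the conjugate of the
  character of index \<open>- n\<close>.
\<close>

definition hardy_H2 :: "(complex \<Rightarrow> complex) set" where
  "hardy_H2 = {f \<in> circle_L2. \<forall>n\<ge>1. (LINT \<xi>|circle_measure. f \<xi> * \<xi> ^ n) = 0}"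

definition poisson_transform ::
    "(complex \<Rightarrow> 'a::{banach, second_countable_topology}) \<Rightarrow> complex \<Rightarrow> 'a" where
  "poisson_transform f z =
     (LINT \<xi>|circle_measure. ((1 - (norm z)\<^sup>2) / (norm (1 - \<xi> * cnj z))\<^sup>2) *\<^sub>R f \<xi>)"

text \<open>
  An inner function is given as a function on the open unit disc; its values on the circle are its
  radial limits. The values of the function itself outside the disc are irrelevant.
\<close>

definition radial_limit :: "(complex \<Rightarrow> complex) \<Rightarrow> complex \<Rightarrow> complex" where
  "radial_limit \<Theta> \<xi> = Lim (at_left 1) (\<lambda>r::real. \<Theta> (of_real r * \<xi>))"

definition inner_function :: "(complex \<Rightarrow> complex) \<Rightarrow> bool" where
  "inner_function \<Theta> \<longleftrightarrow>
     \<Theta> holomorphic_on ball 0 1 \<and> bounded (\<Theta> ` ball 0 1) \<and>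
     (AE \<xi> in circle_measure.
        ((\<lambda>r::real. \<Theta> (of_real r * \<xi>)) \<longlongrightarrow> radial_limit \<Theta> \<xi>) (at_left 1) \<and>
        norm (radial_limit \<Theta> \<xi>) = 1)"

definition model_space :: "(complex \<Rightarrow> complex) \<Rightarrow> (complex \<Rightarrow> complex) set" where
  "model_space \<Theta> =
     {f \<in> hardy_H2. \<forall>g\<in>hardy_H2. L2_inner f (\<lambda>\<xi>. radial_limit \<Theta> \<xi> * g \<xi>) = 0}"

text \<open>
  For a closed subspace the orthogonal projection exists and is unique up to equality almost
  everywhere; the choice operator only picks a representative.
\<close>

definition L2_proj ::
    "(complex \<Rightarrow> complex) set \<Rightarrow> (complex \<Rightarrow> complex) \<Rightarrow> complex \<Rightarrow> complex" where
  "L2_proj K g = (SOME h. h \<in> K \<and> (\<forall>k\<in>K. L2_inner (\<lambda>\<xi>. g \<xi> - h \<xi>) k = 0))"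

definition truncated_toeplitz ::
    "(complex \<Rightarrow> complex) \<Rightarrow> (complex \<Rightarrow> complex) \<Rightarrow> (complex \<Rightarrow> complex) \<Rightarrow> complex \<Rightarrow> complex" where
  "truncated_toeplitz \<Theta> \<phi> f = L2_proj (model_space \<Theta>) (\<lambda>\<xi>. \<phi> \<xi> * f \<xi>)"

text \<open>
  Bounded linear operators on a subspace; compatibility with equality almost everywhere follows
  from linearity and boundedness.
\<close>

definition bounded_operator_on ::
    "(complex \<Rightarrow> complex) set \<Rightarrow> ((complex \<Rightarrow> complex) \<Rightarrow> (complex \<Rightarrow> complex)) \<Rightarrow> bool" where
  "bounded_operator_on K T \<longleftrightarrow>
     (\<forall>f\<in>K. T f \<in> K) \<and>
     (\<forall>f\<in>K. \<forall>g\<in>K. AE \<xi> in circle_measure. T (\<lambda>x. f x + g x) \<xi> = T f \<xi> + T g \<xi>) \<and>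
     (\<forall>c. \<forall>f\<in>K. AE \<xi> in circle_measure. T (\<lambda>x. c * f x) \<xi> = c * T f \<xi>) \<and>
     (\<exists>C. \<forall>f\<in>K. L2_norm (T f) \<le> C * L2_norm f)"

definition bounded_below_on ::
    "(complex \<Rightarrow> complex) set \<Rightarrow> ((complex \<Rightarrow> complex) \<Rightarrow> (complex \<Rightarrow> complex)) \<Rightarrow> bool" where
  "bounded_below_on K T \<longleftrightarrow> (\<exists>c>0. \<forall>f\<in>K. L2_norm (T f) \<ge> c * L2_norm f)"

definition invertible_on ::
    "(complex \<Rightarrow> complex) set \<Rightarrow> ((complex \<Rightarrow> complex) \<Rightarrow> (complex \<Rightarrow> complex)) \<Rightarrow> bool" where
  "invertible_on K T \<longleftrightarrow>
     bounded_operator_on K T \<and>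
     (\<exists>S. bounded_operator_on K S \<and>
        (\<forall>f\<in>K. AE \<xi> in circle_measure. S (T f) \<xi> = f \<xi>) \<and>
        (\<forall>f\<in>K. AE \<xi> in circle_measure. T (S f) \<xi> = f \<xi>))"

end

theory Submission
  imports Defs "HOL-Probability.Probability_Measure" "HOL-Complex_Analysis.Complex_Analysis"
    "HOL-Real_Asymp.Real_Asymp"
begin

text \<open>
  The necessity of the lower bound follows by testing on the reproducing kernels
  \<open>k\<^sub>\<lambda>\<close> of the model space, since \<open>\<bar>k\<^sub>\<lambda>\<bar>\<^sup>2\<close> is at most a multiple of the Poisson kernel.

  For the sufficiency scale \<open>\<phi>\<close> to \<open>0 \<le> \<phi> \<le> 1\<close>. It is enough that
  \<open>\<integral> \<phi> \<bar>f\<bar>\<^sup>2 \<ge> c \<parallel>f\<parallel>\<^sup>2\<close> on the model space, because then the operator with symbol \<open>1 - \<phi>\<close> is a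
  strict contraction. Let \<open>u\<close> be the Poisson transform of \<open>\<phi>\<close>, let \<open>k\<close> be \<open>\<Theta>\<close> times the conjugate
  of \<open>f\<close>, which lies in the Hardy space, vanishes at \<open>0\<close>, and satisfies
  \<open>f k / \<Theta> = \<bar>f\<bar>\<^sup>2\<close> on the circle, and let \<open>\<psi> w = (1 - (1 - \<bar>w\<bar>\<^sup>2) ^ (m + 2)) / w\<close>. The function
  \<open>3 \<tau> (exp (2 m u + u\<^sup>2 + \<bar>\<Theta>\<bar>\<^sup>2) \<bar>f\<bar>\<^sup>2 + exp (\<bar>\<Theta>\<bar>\<^sup>2) \<bar>k\<bar>\<^sup>2) - Re (\<psi> \<Theta> f k)\<close>
  is subharmonic for large \<open>m\<close>: the Laplacian of the last term carries the factor
  \<open>m\<^sup>2 (1 - \<bar>\<Theta>\<bar>\<^sup>2) ^ m\<close>, which \<open>u + \<bar>\<Theta>\<bar> \<ge> \<delta>\<close> makes small against \<open>exp (m u)\<close>. Since it is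
  nonnegative at \<open>0\<close>, so are its circular means, and in the limit
  \<open>\<parallel>f\<parallel>\<^sup>2 \<le> 3 \<tau> (\<integral> exp (2 m \<phi> + \<phi>\<^sup>2 + 1) \<bar>f\<bar>\<^sup>2 + e \<parallel>f\<parallel>\<^sup>2)\<close>. The exponential is at most
  \<open>e + C \<phi>\<close>, and \<open>\<tau>\<close> was arbitrary.
\<close>

section \<open>The Hilbert space of the circle\<close>

text \<open>If \<open>\<Theta>\<close> were bounded away from 0, then \<open>f k / \<Theta>\<close>
  would be holomorphic and vanish at 0, so the mean of \<open>\<bar>f\<bar>\<^sup>2\<close> over the
  circle would be 0. The obstacle is thus the region where \<open>\<Theta>\<close> is small, and
  there \<open>u\<close> is bounded below. The function \<open>\<psi>\<close> is
  \<open>1 / w\<close> times a factor that removes the pole; the price is a defect of holomorphy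
  carrying \<open>(1 - \<bar>\<Theta>\<bar>\<^sup>2) ^ m\<close>, which is exponentially small in
  \<open>m\<close> unless \<open>\<Theta>\<close> is small. This defect is multiplied by terms of
  order \<open>\<bar>f\<bar> \<bar>k\<bar>\<close>. The weights \<open>exp (2 m u)\<close> on
  \<open>\<bar>f\<bar>\<^sup>2\<close> and 1 on \<open>\<bar>k\<bar>\<^sup>2\<close> have geometric
  mean \<open>exp (m u)\<close>, so this is the power that has to win. Since \<open>u\<close> is
  harmonic, the exponent \<open>2 m u\<close> alone produces only a completed square. The bounded
  summands \<open>u\<^sup>2\<close> and \<open>\<bar>\<Theta>\<bar>\<^sup>2\<close> are there for
  their Laplacians, multiples of the squared gradients of \<open>u\<close> and
  \<open>\<Theta>\<close>, which absorb the derivatives of the weights and of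
  \<open>\<psi> \<Theta>\<close>.\<close>

abbreviation (input) circ :: "complex measure" where "circ \<equiv> circle_measure"

lemma mult_cnj_norm: "z * cnj z = of_real ((norm z)\<^sup>2)"
  by (simp add: complex_norm_square del: of_real_power)

section \<open>Normalized arc length measure on the circle\<close>

lemma measurable_cis_circle [measurable]:
  "cis \<in> measurable lborel (restrict_space borel (sphere 0 1))"
proof -
  have "continuous_on UNIV cis" by (intro continuous_intros)
  then have "cis \<in> borel_measurable borel" by (rule borel_measurable_continuous_onI)
  then show ?thesis
    by (auto intro!: measurable_restrict_space2)
qed

lemma emeasure_circle_interval: "emeasure lborel {0..2 * pi} = ennreal (2 * pi)"
  by simp

lemma prob_space_circle: "prob_space circ"
  unfolding circle_measure_def
  by (intro prob_space.prob_space_distr prob_space_uniform_measure)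
    (auto simp: emeasure_circle_interval)

interpretation circle: prob_space circ by (rule prob_space_circle)

lemma space_circle [simp]: "space circ = sphere 0 1"
  by (simp add: circle_measure_def space_restrict_space)

lemma sets_circle [measurable_cong]: "sets circ = sets (restrict_space borel (sphere 0 1))"
  by (simp add: circle_measure_def)

lemma AE_circle_norm: "AE \<xi> in circ. norm \<xi> = 1"
  using AE_space[of circ] by simp

lemma borel_measurable_circle_continuous:
  fixes g :: "complex \<Rightarrow> 'a::topological_space"
  assumes "continuous_on (sphere 0 1) g"
  shows "g \<in> borel_measurable circ"
  using borel_measurable_continuous_on_restrict[OF assms]
  by (simp cong: measurable_cong_sets add: sets_circle)

lemma borel_measurable_circle_id [measurable]: "(\<lambda>\<xi>. \<xi>) \<in> borel_measurable circ"
  by (intro borel_measurable_circle_continuous continuous_intros)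

text \<open>The bridge to integrals over \<open>{0..2 * pi}\<close>, where the fundamental theorem
  of calculus and the Leibniz rule apply. It yields the moments of the circle here and the
  monotonicity of circular means later.\<close>

lemma circle_integral_continuous:
  fixes g :: "complex \<Rightarrow> 'a::euclidean_space"
  assumes g: "continuous_on (sphere 0 1) g"
  shows "(LINT \<xi>|circ. g \<xi>) = (1 / (2 * pi)) *\<^sub>R integral {0..2 * pi} (\<lambda>t. g (cis t))"
proof -
  have gm: "g \<in> borel_measurable (restrict_space borel (sphere 0 1))"
    by (rule borel_measurable_continuous_on_restrict[OF g])
  have m2: "(\<lambda>t. g (cis t)) \<in> borel_measurable lborel"
    using measurable_compose[OF measurable_cis_circle gm] .
  have c: "continuous_on {0..2*pi} (\<lambda>t. g (cis t))"
    by (intro continuous_on_compose2[OF g] continuous_intros) auto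
  have "(LINT \<xi>|circ. g \<xi>) = (LINT t|uniform_measure lborel {0..2 * pi}. g (cis t))"
    unfolding circle_measure_def
    by (rule integral_distr) (use gm in \<open>auto\<close>)
  also have "\<dots> = (LINT t|density lborel (\<lambda>t. ennreal (indicator {0..2 * pi} t / (2 * pi))). g (cis
      t))"
    unfolding uniform_measure_def
    by (intro arg_cong2[where f=lebesgue_integral] refl density_cong)
       (auto simp: emeasure_circle_interval divide_ennreal split: split_indicator
             simp flip: ennreal_1 simp del: ennreal_1)
  also have "\<dots> = (LINT t|lborel. (indicator {0..2 * pi} t / (2 * pi)) *\<^sub>R g (cis t))"
    by (rule integral_density) (use m2 in auto)
  also have "\<dots> = (LINT t|lborel. (1 / (2 * pi)) *\<^sub>R (indicator {0..2 * pi} t *\<^sub>R g (cis t)))"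
    by (simp add: field_simps)
  also have "\<dots> = (1 / (2 * pi)) *\<^sub>R (LINT t:{0..2*pi}|lborel. g (cis t))"
    unfolding set_lebesgue_integral_def by (rule integral_scaleR_right) 
  also have "(LINT t:{0..2*pi}|lborel. g (cis t)) = integral {0..2 * pi} (\<lambda>t. g (cis t))"
    by (rule set_borel_integral_eq_integral) (rule borel_integrable_atLeastAtMost'[OF c])
  finally show ?thesis .
qed

lemma circle_integral_power: 
  assumes "n \<ge> 1" shows "(LINT \<xi>|circ. \<xi> ^ n) = 0"
proof -
  have "((\<lambda>t. cis t ^ n) has_integral (cis (2*pi) ^ n / (\<i> * of_nat n) - cis 0 ^ n / (\<i> * of_nat
      n))) {0..2*pi}"
  proof (rule fundamental_theorem_of_calculus)
    fix t :: real
    have "((\<lambda>t. exp (\<i> * of_nat n * complex_of_real t) / (\<i> * of_nat n)) has_vector_derivative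
       exp (\<i> * of_nat n * complex_of_real t)) (at t within {0..2*pi})"
      using assms
      by (auto intro!: derivative_eq_intros has_vector_derivative_real_field simp: field_simps)
    moreover have "exp (\<i> * of_nat n * complex_of_real t) = cis t ^ n" for t
      unfolding cis_conv_exp by (simp add: exp_of_nat_mult[symmetric] mult_ac)
    ultimately show "((\<lambda>t. cis t ^ n / (\<i> * of_nat n)) has_vector_derivative cis t ^ n) (at t
        within {0..2*pi})"
      by simp
  qed simp
  then have "integral {0..2*pi} (\<lambda>t. cis t ^ n) = 0"
    by (simp add: integral_unique)
  then show ?thesis
    by (subst circle_integral_continuous) (auto intro!: continuous_intros)
qed

section \<open>Square-integrable functions, their inner product and norm\<close>

lemma circle_L2_measurable [measurable_dest]: "f \<in> circle_L2 \<Longrightarrow> f \<in> borel_measurable circ"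
  by (simp add: circle_L2_def)

lemma circle_L2_integrable: "f \<in> circle_L2 \<Longrightarrow> integrable circ (\<lambda>\<xi>. (norm (f \<xi>))\<^sup>2)"
  by (simp add: circle_L2_def)

lemma circle_L2I_bound:
  assumes "f \<in> borel_measurable circ" "integrable circ g" "AE \<xi> in circ. (norm (f \<xi>))\<^sup>2 \<le> g \<xi>"
  shows "f \<in> circle_L2"
proof -
  have "integrable circ (\<lambda>\<xi>. (norm (f \<xi>))\<^sup>2)"
    by (rule Bochner_Integration.integrable_bound[OF assms(2)]) (use assms in auto)
  then show ?thesis using assms by (simp add: circle_L2_def)
qed

lemma circle_L2_bounded:
  assumes "f \<in> borel_measurable circ" "AE \<xi> in circ. norm (f \<xi>) \<le> C"
  shows "f \<in> circle_L2"
  by (rule circle_L2I_bound[where g="\<lambda>_. C^2"]) (use assms in \<open>auto elim!: eventually_mono intro: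
      power_mono\<close>)

lemma circle_L2_mult_bounded:
  assumes b: "b \<in> borel_measurable circ" "AE \<xi> in circ. norm (b \<xi>) \<le> C" and f: "f \<in> circle_L2"
  shows "(\<lambda>\<xi>. b \<xi> * f \<xi>) \<in> circle_L2"
proof (rule circle_L2I_bound[where g="\<lambda>\<xi>. C^2 * (norm (f \<xi>))\<^sup>2"])
  show "(\<lambda>\<xi>. b \<xi> * f \<xi>) \<in> borel_measurable circ" using b f by measurable
  show "integrable circ (\<lambda>\<xi>. C^2 * (norm (f \<xi>))\<^sup>2)" using circle_L2_integrable[OF f] by simp
  show "AE \<xi> in circ. (norm (b \<xi> * f \<xi>))\<^sup>2 \<le> C\<^sup>2 * (norm (f \<xi>))\<^sup>2"
    using b(2) by eventually_elim (simp add: norm_mult power_mult_distrib mult_right_mono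
        power_mono)
qed

lemma circle_L2_add:
  assumes f: "f \<in> circle_L2" and g: "g \<in> circle_L2"
  shows "(\<lambda>\<xi>. f \<xi> + g \<xi>) \<in> circle_L2"
proof (rule circle_L2I_bound[where g="\<lambda>\<xi>. 2 * (norm (f \<xi>))\<^sup>2 + 2 * (norm (g \<xi>))\<^sup>2"])
  show "(\<lambda>\<xi>. f \<xi> + g \<xi>) \<in> borel_measurable circ" using f g by measurable
  show "integrable circ (\<lambda>\<xi>. 2 * (norm (f \<xi>))\<^sup>2 + 2 * (norm (g \<xi>))\<^sup>2)"
    using circle_L2_integrable[OF f] circle_L2_integrable[OF g] by simp
  have "(norm (x + y))\<^sup>2 \<le> 2 * (norm x)\<^sup>2 + 2 * (norm y)\<^sup>2" for x y :: complex
  proof -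
    have "(norm (x + y))\<^sup>2 \<le> (norm x + norm y)\<^sup>2" by (simp add: power_mono norm_triangle_ineq)
    also have "\<dots> \<le> 2 * (norm x)\<^sup>2 + 2 * (norm y)\<^sup>2"
      using sum_squares_bound[of "norm x" "norm y"] by (simp add: power2_sum)
    finally show ?thesis .
  qed
  then show "AE \<xi> in circ. (norm (f \<xi> + g \<xi>))\<^sup>2 \<le> 2 * (norm (f \<xi>))\<^sup>2 + 2 * (norm (g \<xi>))\<^sup>2" by simp
qed

lemma circle_L2_cmult: "f \<in> circle_L2 \<Longrightarrow> (\<lambda>\<xi>. c * f \<xi>) \<in> circle_L2"
  by (rule circle_L2_mult_bounded[where C="norm c"]) auto

lemma circle_L2_diff: "f \<in> circle_L2 \<Longrightarrow> g \<in> circle_L2 \<Longrightarrow> (\<lambda>\<xi>. f \<xi> - g \<xi>) \<in> circle_L2"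
  using circle_L2_add[of f "\<lambda>\<xi>. (-1) * g \<xi>"] circle_L2_cmult[of g "-1"] by simp

lemma borel_measurable_cnj [measurable (raw)]:
  "f \<in> borel_measurable M \<Longrightarrow> (\<lambda>x. cnj (f x)) \<in> borel_measurable M"
  by (rule measurable_compose[of f M borel]) (auto intro!: borel_measurable_continuous_onI
      continuous_intros)

lemma circle_L2_cnj: "f \<in> circle_L2 \<Longrightarrow> (\<lambda>\<xi>. cnj (f \<xi>)) \<in> circle_L2"
  by (rule circle_L2I_bound[where g="\<lambda>\<xi>. (norm (f \<xi>))\<^sup>2"]) (auto simp: circle_L2_integrable)

lemma circle_L2_const: "(\<lambda>\<xi>. c) \<in> circle_L2"
  by (rule circle_L2_bounded[where C="norm c"]) auto

lemma circle_L2_power: "(\<lambda>\<xi>. \<xi> ^ n) \<in> circle_L2"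
  by (rule circle_L2_bounded[where C=1]) (use AE_circle_norm in \<open>auto elim!: eventually_mono simp:
      norm_power\<close>)

lemma circle_L2_integrable_mult:
  assumes f: "f \<in> circle_L2" and g: "g \<in> circle_L2"
  shows "integrable circ (\<lambda>\<xi>. f \<xi> * g \<xi>)"
proof (rule Bochner_Integration.integrable_bound[where f="\<lambda>\<xi>. (norm (f \<xi>))\<^sup>2 + (norm (g \<xi>))\<^sup>2"])
  show "integrable circ (\<lambda>\<xi>. (norm (f \<xi>))\<^sup>2 + (norm (g \<xi>))\<^sup>2)"
    using circle_L2_integrable[OF f] circle_L2_integrable[OF g] by simp
  show "(\<lambda>\<xi>. f \<xi> * g \<xi>) \<in> borel_measurable circ" using f g by measurable
  have "x * y \<le> x\<^sup>2 + y\<^sup>2" for x y :: real by sos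
  then show "AE x in circ. norm (f x * g x) \<le> norm ((cmod (f x))\<^sup>2 + (cmod (g x))\<^sup>2)"
    by (simp add: norm_mult)
qed

lemma circle_L2_integrable_inner:
  "f \<in> circle_L2 \<Longrightarrow> g \<in> circle_L2 \<Longrightarrow> integrable circ (\<lambda>\<xi>. f \<xi> * cnj (g \<xi>))"
  by (intro circle_L2_integrable_mult circle_L2_cnj)

lemma circle_L2_imp_integrable: "f \<in> circle_L2 \<Longrightarrow> integrable circ f"
  using circle_L2_integrable_mult[OF _ circle_L2_const[of 1]] by simp

lemma L2_norm_nonneg [simp]: "L2_norm f \<ge> 0"
  by (simp add: L2_norm_def)

lemma L2_norm_power2: "(L2_norm f)\<^sup>2 = (LINT \<xi>|circ. (norm (f \<xi>))\<^sup>2)"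
  by (simp add: L2_norm_def)

lemma L2_inner_self: "L2_inner f f = of_real ((L2_norm f)\<^sup>2)"
  unfolding L2_inner_def L2_norm_power2 complex_norm_square[symmetric] by (simp flip: of_real_power)

lemma L2_inner_commute: "L2_inner g f = cnj (L2_inner f g)"
  by (simp add: L2_inner_def mult.commute flip: Bochner_Integration.integral_cnj)

lemma L2_inner_add_left:
  "f \<in> circle_L2 \<Longrightarrow> g \<in> circle_L2 \<Longrightarrow> h \<in> circle_L2 \<Longrightarrow>
     L2_inner (\<lambda>\<xi>. f \<xi> + g \<xi>) h = L2_inner f h + L2_inner g h"
  by (simp add: L2_inner_def ring_distribs circle_L2_integrable_inner)

lemma L2_inner_diff_left:
  "f \<in> circle_L2 \<Longrightarrow> g \<in> circle_L2 \<Longrightarrow> h \<in> circle_L2 \<Longrightarrow>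
     L2_inner (\<lambda>\<xi>. f \<xi> - g \<xi>) h = L2_inner f h - L2_inner g h"
  by (simp add: L2_inner_def ring_distribs circle_L2_integrable_inner)

lemma L2_inner_cmult_left: "L2_inner (\<lambda>\<xi>. c * f \<xi>) h = c * L2_inner f h"
  by (simp add: L2_inner_def mult.assoc)

lemma L2_inner_add_right:
  "f \<in> circle_L2 \<Longrightarrow> g \<in> circle_L2 \<Longrightarrow> h \<in> circle_L2 \<Longrightarrow>
     L2_inner h (\<lambda>\<xi>. f \<xi> + g \<xi>) = L2_inner h f + L2_inner h g"
  by (simp add: L2_inner_def ring_distribs circle_L2_integrable_inner)

lemma L2_inner_cmult_right: "L2_inner h (\<lambda>\<xi>. c * f \<xi>) = cnj c * L2_inner h f"
  by (simp add: L2_inner_def mult.left_commute)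

lemma L2_norm_zero_iff:
  assumes "f \<in> circle_L2" shows "L2_norm f = 0 \<longleftrightarrow> (AE \<xi> in circ. f \<xi> = 0)"
  unfolding L2_norm_def using circle_L2_integrable[OF assms]
  by (simp add: integral_nonneg_eq_0_iff_AE)

lemma L2_norm_cong_AE:
  assumes "AE \<xi> in circ. norm (f \<xi>) = norm (g \<xi>)"
    "f \<in> borel_measurable circ" "g \<in> borel_measurable circ"
  shows "L2_norm f = L2_norm g"
proof -
  have "(LINT \<xi>|circ. (norm (f \<xi>))\<^sup>2) = (LINT \<xi>|circ. (norm (g \<xi>))\<^sup>2)"
    by (rule integral_cong_AE) (use assms in auto)
  then show ?thesis by (simp add: L2_norm_def)
qed

lemma L2_norm_mono:
  assumes "AE \<xi> in circ. norm (f \<xi>) \<le> norm (g \<xi>)"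
    "f \<in> borel_measurable circ" "g \<in> circle_L2"
  shows "L2_norm f \<le> L2_norm g"
  unfolding L2_norm_def
proof (intro real_sqrt_le_mono integral_mono_AE circle_L2_integrable assms)
  show le: "AE x in circ. (cmod (f x))\<^sup>2 \<le> (cmod (g x))\<^sup>2"
    using assms(1) by (auto elim!: eventually_mono)
  show "f \<in> circle_L2"
    by (rule circle_L2I_bound[OF assms(2) circle_L2_integrable[OF assms(3)] le])
qed

lemma L2_norm_cmult: "L2_norm (\<lambda>\<xi>. c * f \<xi>) = norm c * L2_norm f"
  by (simp add: L2_norm_def norm_mult power_mult_distrib real_sqrt_mult)

text \<open>Working with the product of the norms covers both the bilinear pairing
  \<open>f * g\<close> and the sesquilinear \<open>L2_inner\<close>.\<close>

lemma L2_Cauchy_Schwarz_norm: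
  assumes f: "f \<in> circle_L2" and g: "g \<in> circle_L2"
  shows "(LINT \<xi>|circ. norm (f \<xi>) * norm (g \<xi>)) \<le> L2_norm f * L2_norm g"
proof (cases "L2_norm g = 0")
  case True
  then have "AE \<xi> in circ. g \<xi> = 0" using L2_norm_zero_iff[OF g] by simp
  then have "(LINT \<xi>|circ. norm (f \<xi>) * norm (g \<xi>)) = 0"
    by (intro integral_eq_zero_AE) (auto elim!: eventually_mono)
  then show ?thesis by simp
next
  case False
  define B where "B = (LINT \<xi>|circ. norm (f \<xi>) * norm (g \<xi>))"
  have G: "(L2_norm g)\<^sup>2 > 0" using False by simp
  have i: "integrable circ (\<lambda>\<xi>. norm (f \<xi>) * norm (g \<xi>))"
    using integrable_norm[OF circle_L2_integrable_mult[OF f g]] by (simp add: norm_mult)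
  \<comment> \<open>\<open>s\<close> minimizes the integral of
    \<open>(norm (f \<xi>) - s * norm (g \<xi>))\<^sup>2\<close>; nonnegativity of the minimum is
    the inequality.\<close>
  define s where "s = B / (L2_norm g)\<^sup>2"
  have "0 \<le> (LINT \<xi>|circ. (norm (f \<xi>) - s * norm (g \<xi>))\<^sup>2)" by simp
  also have "\<dots> = (LINT \<xi>|circ. (norm (f \<xi>))\<^sup>2 - 2 * s * (norm (f \<xi>) * norm (g \<xi>)) + s\<^sup>2 * (norm (g
      \<xi>))\<^sup>2)"
    by (simp add: power2_eq_square algebra_simps)
  also have "\<dots> = (L2_norm f)\<^sup>2 - 2 * s * B + s\<^sup>2 * (L2_norm g)\<^sup>2"
    using i circle_L2_integrable[OF f] circle_L2_integrable[OF g]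
    by (simp add: L2_norm_power2 B_def)
  finally have "2 * s * B - s\<^sup>2 * (L2_norm g)\<^sup>2 \<le> (L2_norm f)\<^sup>2" by simp
  moreover have "2 * s * B - s\<^sup>2 * (L2_norm g)\<^sup>2 = B\<^sup>2 / (L2_norm g)\<^sup>2"
    using False unfolding s_def by (simp add: power2_eq_square divide_simps)
  ultimately have "B\<^sup>2 / (L2_norm g)\<^sup>2 \<le> (L2_norm f)\<^sup>2"
    by simp
  then have "B\<^sup>2 \<le> (L2_norm f * L2_norm g)\<^sup>2"
    using G by (simp add: divide_le_eq power_mult_distrib)
  then have "B \<le> L2_norm f * L2_norm g" by (rule power2_le_imp_le) simp
  then show ?thesis by (simp add: B_def)
qed

lemma L2_Cauchy_Schwarz_mult:
  assumes f: "f \<in> circle_L2" and g: "g \<in> circle_L2"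
  shows "norm (LINT \<xi>|circ. f \<xi> * g \<xi>) \<le> L2_norm f * L2_norm g"
proof -
  have "norm (LINT \<xi>|circ. f \<xi> * g \<xi>) \<le> (LINT \<xi>|circ. norm (f \<xi> * g \<xi>))"
    by (rule integral_norm_bound)
  also have "\<dots> \<le> L2_norm f * L2_norm g"
    using L2_Cauchy_Schwarz_norm[OF assms] by (simp add: norm_mult)
  finally show ?thesis .
qed

lemma L2_Cauchy_Schwarz:
  assumes f: "f \<in> circle_L2" and g: "g \<in> circle_L2"
  shows "norm (L2_inner f g) \<le> L2_norm f * L2_norm g"
  using L2_Cauchy_Schwarz_mult[OF f circle_L2_cnj[OF g]]
  by (simp add: L2_inner_def L2_norm_def)

lemma L2_norm_add_power2:
  assumes f: "f \<in> circle_L2" and g: "g \<in> circle_L2"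
  shows "(L2_norm (\<lambda>\<xi>. f \<xi> + g \<xi>))\<^sup>2 = (L2_norm f)\<^sup>2 + 2 * Re (L2_inner f g) + (L2_norm g)\<^sup>2"
proof -
  have "of_real ((L2_norm (\<lambda>\<xi>. f \<xi> + g \<xi>))\<^sup>2) = L2_inner (\<lambda>\<xi>. f \<xi> + g \<xi>) (\<lambda>\<xi>. f \<xi> + g \<xi>)"
    by (simp add: L2_inner_self)
  also have "\<dots> = L2_inner f f + L2_inner f g + (cnj (L2_inner f g) + L2_inner g g)"
    by (simp add: L2_inner_add_left L2_inner_add_right f g circle_L2_add L2_inner_commute[of g f])
  finally have "Re (of_real ((L2_norm (\<lambda>\<xi>. f \<xi> + g \<xi>))\<^sup>2)) = Re (L2_inner f f + L2_inner f g +
      (cnj (L2_inner f g) + L2_inner g g))"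
    by (rule arg_cong)
  then show ?thesis by (simp add: L2_inner_self)
qed

lemma L2_norm_triangle:
  assumes f: "f \<in> circle_L2" and g: "g \<in> circle_L2"
  shows "L2_norm (\<lambda>\<xi>. f \<xi> + g \<xi>) \<le> L2_norm f + L2_norm g"
proof (rule power2_le_imp_le)
  have "Re (L2_inner f g) \<le> L2_norm f * L2_norm g"
    using L2_Cauchy_Schwarz[OF f g] complex_Re_le_cmod order_trans by blast
  then show "(L2_norm (\<lambda>\<xi>. f \<xi> + g \<xi>))\<^sup>2 \<le> (L2_norm f + L2_norm g)\<^sup>2"
    unfolding L2_norm_add_power2[OF f g] by (simp add: power2_eq_square algebra_simps)
qed simp

lemma L2_norm_diff_commute: "L2_norm (\<lambda>\<xi>. f \<xi> - g \<xi>) = L2_norm (\<lambda>\<xi>. g \<xi> - f \<xi>)"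
  by (simp add: L2_norm_def norm_minus_commute)

lemma L2_norm_diff_triangle:
  assumes "f \<in> circle_L2" "g \<in> circle_L2" "h \<in> circle_L2"
  shows "L2_norm (\<lambda>\<xi>. f \<xi> - h \<xi>) \<le> L2_norm (\<lambda>\<xi>. f \<xi> - g \<xi>) + L2_norm (\<lambda>\<xi>. g \<xi> - h \<xi>)"
  using L2_norm_triangle[of "\<lambda>\<xi>. f \<xi> - g \<xi>" "\<lambda>\<xi>. g \<xi> - h \<xi>"] assms by (simp add: circle_L2_diff)

lemma L2_norm_le_diff:
  assumes "f \<in> circle_L2" "g \<in> circle_L2"
  shows "L2_norm f \<le> L2_norm g + L2_norm (\<lambda>\<xi>. f \<xi> - g \<xi>)"
  using L2_norm_triangle[of g "\<lambda>\<xi>. f \<xi> - g \<xi>"] assms by (simp add: circle_L2_diff)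

lemma L1_le_L2_norm:
  assumes "f \<in> circle_L2" shows "(LINT \<xi>|circ. norm (f \<xi>)) \<le> L2_norm f"
  using L2_Cauchy_Schwarz_norm[OF assms circle_L2_const[of 1]] circle.prob_space by (simp add:
      L2_norm_def)

text \<open>Fatou's lemma for the squared norms. An eventual bound is asked for because a Cauchy
  condition controls the distance between two members of a sequence only for large indices.\<close>

lemma L2_Fatou:
  assumes h: "\<And>k. h k \<in> circle_L2" and g: "g \<in> borel_measurable circ"
    and lim: "AE \<xi> in circ. (\<lambda>k. h k \<xi>) \<longlonglongrightarrow> g \<xi>"
    and C: "\<forall>\<^sub>F k in sequentially. L2_norm (h k) \<le> C"
  shows "g \<in> circle_L2" "L2_norm g \<le> C"
proof -
  have C0: "C \<ge> 0"
    using eventually_happens[OF C] L2_norm_nonneg order_trans by (metis sequentially_bot)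
  have hm: "h k \<in> borel_measurable circ" for k using h by measurable
  have "(\<integral>\<^sup>+\<xi>. ennreal ((norm (g \<xi>))\<^sup>2) \<partial>circ) = (\<integral>\<^sup>+\<xi>. liminf (\<lambda>k. ennreal ((norm (h k \<xi>))\<^sup>2))
      \<partial>circ)"
  proof (rule nn_integral_cong_AE)
    show "AE \<xi> in circ. ennreal ((norm (g \<xi>))\<^sup>2) = liminf (\<lambda>k. ennreal ((norm (h k \<xi>))\<^sup>2))"
      using lim
    proof eventually_elim
      case (elim \<xi>)
      then have "(\<lambda>k. ennreal ((norm (h k \<xi>))\<^sup>2)) \<longlonglongrightarrow> ennreal ((norm (g \<xi>))\<^sup>2)"
        by (intro tendsto_intros tendsto_ennrealI)
      then show ?case by (rule lim_imp_Liminf[OF sequentially_bot, symmetric])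
    qed
  qed
  also have "\<dots> \<le> liminf (\<lambda>k. \<integral>\<^sup>+\<xi>. ennreal ((norm (h k \<xi>))\<^sup>2) \<partial>circ)"
    by (rule nn_integral_liminf) (use hm in measurable)
  also have "(\<lambda>k. \<integral>\<^sup>+\<xi>. ennreal ((norm (h k \<xi>))\<^sup>2) \<partial>circ) = (\<lambda>k. ennreal ((L2_norm (h k))\<^sup>2))"
    using circle_L2_integrable[OF h] by (simp add: L2_norm_power2 nn_integral_eq_integral)
  also have "liminf (\<lambda>k. ennreal ((L2_norm (h k))\<^sup>2)) \<le> ennreal (C\<^sup>2)"
  proof -
    have "liminf (\<lambda>k. ennreal ((L2_norm (h k))\<^sup>2)) \<le> limsup (\<lambda>k. ennreal ((L2_norm (h k))\<^sup>2))"
      by (rule Liminf_le_Limsup) simp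
    also have "\<dots> \<le> ennreal (C\<^sup>2)"
      by (rule Limsup_bounded) (use C in \<open>auto elim!: eventually_mono intro!: ennreal_leI
          power_mono\<close>)
    finally show ?thesis .
  qed
  finally have le: "(\<integral>\<^sup>+\<xi>. ennreal ((norm (g \<xi>))\<^sup>2) \<partial>circ) \<le> ennreal (C\<^sup>2)" .
  have int: "integrable circ (\<lambda>\<xi>. (norm (g \<xi>))\<^sup>2)"
    by (rule integrableI_bounded) (use g le in \<open>auto intro: le_less_trans[OF le]\<close>)
  then show "g \<in> circle_L2" using g by (simp add: circle_L2_def)
  have "ennreal ((L2_norm g)\<^sup>2) \<le> ennreal (C\<^sup>2)"
    using le int by (simp add: L2_norm_power2 nn_integral_eq_integral)
  then have "(L2_norm g)\<^sup>2 \<le> C\<^sup>2" using C0 by (subst (asm) ennreal_le_iff) auto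
  then show "L2_norm g \<le> C" using C0 by (rule power2_le_imp_le)
qed

text \<open>The Riesz-Fischer argument: along a fast subsequence the differences have summable mean
  moduli, so the subsequence converges almost everywhere; Fatou's lemma turns this into norm
  convergence of the whole sequence.\<close>

lemma L2_complete:
  assumes f: "\<And>n. f n \<in> circle_L2"
    and Cau: "\<And>e. e > 0 \<Longrightarrow> \<exists>N. \<forall>m\<ge>N. \<forall>n\<ge>N. L2_norm (\<lambda>\<xi>. f m \<xi> - f n \<xi>) \<le> e"
  shows "\<exists>g\<in>circle_L2. (\<lambda>n. L2_norm (\<lambda>\<xi>. f n \<xi> - g \<xi>)) \<longlonglongrightarrow> 0"
proof -
  have "\<exists>N. \<forall>k. \<forall>m\<ge>N k. \<forall>n\<ge>N k. L2_norm (\<lambda>\<xi>. f m \<xi> - f n \<xi>) \<le> (1/2)^k"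
    by (rule choice) (use Cau in auto)
  then obtain N where N: "\<And>k m n. m \<ge> N k \<Longrightarrow> n \<ge> N k \<Longrightarrow> L2_norm (\<lambda>\<xi>. f m \<xi> - f n \<xi>) \<le> (1/2)^k"
    by auto
  \<comment> \<open>Adding all thresholds up to \<open>k\<close> gives an index beyond
    \<open>N k\<close> that is monotone in \<open>k\<close>; the summand \<open>k\<close> makes it
    tend to infinity.\<close>
  define s where "s k = k + (\<Sum>j\<le>k. N j)" for k
  have sN: "s k \<ge> N k" "s (Suc k) \<ge> N k" "s k \<ge> k" for k
    using member_le_sum[of k "{..k}" N] by (auto simp: s_def)
  define d where "d k \<xi> = f (s (Suc k)) \<xi> - f (s k) \<xi>" for k \<xi>
  have dL: "d k \<in> circle_L2" for k unfolding d_def by (intro circle_L2_diff f)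
  have d1: "(LINT \<xi>|circ. norm (d k \<xi>)) \<le> (1/2)^k" for k
    using L1_le_L2_norm[OF dL] N[OF sN(2,1)] unfolding d_def by (rule order_trans)
  have dm: "d k \<in> borel_measurable circ" for k using dL by measurable
  have fm: "f k \<in> borel_measurable circ" for k using f by measurable
  have "(\<integral>\<^sup>+\<xi>. (\<Sum>k. ennreal (norm (d k \<xi>))) \<partial>circ) = (\<Sum>k. \<integral>\<^sup>+\<xi>. ennreal (norm (d k \<xi>)) \<partial>circ)"
    by (rule nn_integral_suminf) (use dm in measurable)
  also have "\<dots> = (\<Sum>k. ennreal (LINT \<xi>|circ. norm (d k \<xi>)))"
    using circle_L2_imp_integrable[OF dL] by (subst nn_integral_eq_integral) auto
  also have "\<dots> \<le> (\<Sum>k. ennreal ((1/2)^k))"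
    by (intro suminf_le ennreal_leI d1) auto
  also have "\<dots> < \<infinity>"
    by (subst suminf_ennreal2) (auto intro: summable_geometric)
  finally have "AE \<xi> in circ. (\<Sum>k. ennreal (norm (d k \<xi>))) \<noteq> \<infinity>"
    by (intro nn_integral_PInf_AE) (use dm in auto)
  then have conv: "AE \<xi> in circ. convergent (\<lambda>k. f (s k) \<xi>)"
  proof eventually_elim
    case (elim \<xi>)
    then have "summable (\<lambda>k. norm (d k \<xi>))" by (intro summable_suminf_not_top) auto
    then have "summable (\<lambda>k. d k \<xi>)" by (rule summable_norm_cancel)
    then have "convergent (\<lambda>k. f (s 0) \<xi> + (\<Sum>i<k. d i \<xi>))"
      by (intro convergent_add convergent_const) (simp add: summable_iff_convergent)
    moreover have "f (s 0) \<xi> + (\<Sum>i<k. d i \<xi>) = f (s k) \<xi>" for k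
      by (induction k) (simp_all add: d_def add.assoc[symmetric])
    ultimately show ?case by simp
  qed
  define g where "g \<xi> = lim (\<lambda>k. f (s k) \<xi>)" for \<xi>
  have gm: "g \<in> borel_measurable circ"
    unfolding g_def by (rule borel_measurable_lim_metric) (use fm in auto)
  have lim: "AE \<xi> in circ. (\<lambda>k. f (s k) \<xi>) \<longlonglongrightarrow> g \<xi>"
    using conv by eventually_elim (simp add: g_def convergent_LIMSEQ_iff)
  \<comment> \<open>Letting \<open>k\<close> tend to infinity in \<open>f n - f (s k)\<close>
    transfers the Cauchy bound to \<open>f n - g\<close>. Membership is included because it is what
    puts \<open>g\<close> itself into \<open>circle_L2\<close>.\<close>
  have key: "(\<lambda>\<xi>. f n \<xi> - g \<xi>) \<in> circle_L2 \<and> L2_norm (\<lambda>\<xi>. f n \<xi> - g \<xi>) \<le> e"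
    if M: "\<And>m. m \<ge> M \<Longrightarrow> L2_norm (\<lambda>\<xi>. f n \<xi> - f m \<xi>) \<le> e" for n M e
  proof -
    have 1: "(\<lambda>\<xi>. f n \<xi> - f (s k) \<xi>) \<in> circle_L2" for k by (intro circle_L2_diff f)
    have 2: "(\<lambda>\<xi>. f n \<xi> - g \<xi>) \<in> borel_measurable circ" using fm gm by simp
    have 3: "AE \<xi> in circ. (\<lambda>k. f n \<xi> - f (s k) \<xi>) \<longlonglongrightarrow> f n \<xi> - g \<xi>"
      using lim by eventually_elim (intro tendsto_intros)
    have 4: "\<forall>\<^sub>F k in sequentially. L2_norm (\<lambda>\<xi>. f n \<xi> - f (s k) \<xi>) \<le> e"
      using eventually_ge_at_top[of M] by eventually_elim (use M sN(3) order_trans in blast)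
    show ?thesis using L2_Fatou[OF 1 2 3 4] by auto
  qed
  have gL: "g \<in> circle_L2"
  proof -
    obtain M where "\<forall>m\<ge>M. \<forall>n\<ge>M. L2_norm (\<lambda>\<xi>. f m \<xi> - f n \<xi>) \<le> 1" using Cau[of 1] by auto
    then have "(\<lambda>\<xi>. f M \<xi> - g \<xi>) \<in> circle_L2" using key[of M M 1] by auto
    from circle_L2_diff[OF f[of M] this] show ?thesis by simp
  qed
  moreover have "(\<lambda>n. L2_norm (\<lambda>\<xi>. f n \<xi> - g \<xi>)) \<longlonglongrightarrow> 0"
  proof (rule LIMSEQ_I)
    fix r :: real assume "r > 0"
    then obtain M where M: "\<forall>m\<ge>M. \<forall>n\<ge>M. L2_norm (\<lambda>\<xi>. f m \<xi> - f n \<xi>) \<le> r/2"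
      using Cau[of "r/2"] by auto
    show "\<exists>no. \<forall>n\<ge>no. norm (L2_norm (\<lambda>\<xi>. f n \<xi> - g \<xi>) - 0) < r"
    proof (intro exI allI impI)
      fix n assume "n \<ge> M"
      then have "L2_norm (\<lambda>\<xi>. f n \<xi> - g \<xi>) \<le> r/2" using key[of M n "r/2"] M by auto
      then show "norm (L2_norm (\<lambda>\<xi>. f n \<xi> - g \<xi>) - 0) < r" using \<open>r > 0\<close> by simp
    qed
  qed
  ultimately show ?thesis by blast
qed

lemma L2_norm_tendsto_bounded:
  assumes "\<And>n. f n \<in> circle_L2" "g \<in> circle_L2"
    and "((\<lambda>n. L2_norm (\<lambda>\<xi>. f n \<xi> - g \<xi>)) \<longlongrightarrow> 0) F"
  shows "((\<lambda>n. L2_norm (f n)) \<longlongrightarrow> L2_norm g) F"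
proof -
  have "\<bar>L2_norm (f n) - L2_norm g\<bar> \<le> L2_norm (\<lambda>\<xi>. f n \<xi> - g \<xi>)" for n
    using L2_norm_le_diff[OF assms(1)[of n] assms(2)] L2_norm_le_diff[OF assms(2) assms(1)[of n]]
      L2_norm_diff_commute[of g "f n"] by linarith
  then have "((\<lambda>n. L2_norm (f n) - L2_norm g) \<longlongrightarrow> 0) F"
    by (intro Lim_null_comparison[OF _ assms(3)]) auto
  then show ?thesis by (simp add: LIM_zero_iff)
qed

text \<open>With \<open>f'\<close> and \<open>g'\<close> frozen the weight is handled by dominated
  convergence; replacing \<open>f n\<close>, \<open>g n\<close> by \<open>f'\<close>,
  \<open>g'\<close> costs two Cauchy-Schwarz terms. Every term of the circular means has this shape:
  two factors converging in norm and a bounded weight converging almost everywhere.\<close>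

lemma L2_integral_tendsto:
  assumes f: "\<And>n. f n \<in> circle_L2" "f' \<in> circle_L2"
      "(\<lambda>n. L2_norm (\<lambda>\<xi>. f n \<xi> - f' \<xi>)) \<longlonglongrightarrow> 0"
    and g: "\<And>n. g n \<in> circle_L2" "g' \<in> circle_L2"
      "(\<lambda>n. L2_norm (\<lambda>\<xi>. g n \<xi> - g' \<xi>)) \<longlonglongrightarrow> 0"
    and b: "\<And>n. b n \<in> borel_measurable circ" "b' \<in> borel_measurable circ"
      "\<And>n. AE \<xi> in circ. norm (b n \<xi>) \<le> C" "AE \<xi> in circ. (\<lambda>n. b n \<xi>) \<longlonglongrightarrow> b' \<xi>"
  shows "(\<lambda>n. LINT \<xi>|circ. b n \<xi> * (f n \<xi> * g n \<xi>)) \<longlonglongrightarrow> (LINT \<xi>|circ. b' \<xi> * (f' \<xi> * g' \<xi>))"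
proof -
  have i: "integrable circ (\<lambda>\<xi>. b n \<xi> * (h \<xi> * k \<xi>))" if "h \<in> circle_L2" "k \<in> circle_L2" for n h k
    using circle_L2_integrable_mult[OF circle_L2_mult_bounded[OF b(1,3) that(1)] that(2), of n]
    by (simp add: mult_ac)
  have bd: "norm (LINT \<xi>|circ. b n \<xi> * (h \<xi> * k \<xi>)) \<le> C * (L2_norm h * L2_norm k)"
    if "h \<in> circle_L2" "k \<in> circle_L2" for n h k
  proof -
    have ihk: "integrable circ (\<lambda>\<xi>. norm (h \<xi>) * norm (k \<xi>))"
      using integrable_norm[OF circle_L2_integrable_mult[OF that]] by (simp add: norm_mult)
    have "norm (LINT \<xi>|circ. b n \<xi> * (h \<xi> * k \<xi>)) \<le> (LINT \<xi>|circ. norm (b n \<xi> * (h \<xi> * k \<xi>)))"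
      by (rule integral_norm_bound)
    also have "\<dots> \<le> (LINT \<xi>|circ. C * (norm (h \<xi>) * norm (k \<xi>)))"
    proof (rule integral_mono_AE)
      show "integrable circ (\<lambda>\<xi>. norm (b n \<xi> * (h \<xi> * k \<xi>)))" using i[OF that] by simp
      show "integrable circ (\<lambda>\<xi>. C * (norm (h \<xi>) * norm (k \<xi>)))" using ihk by simp
      show "AE \<xi> in circ. norm (b n \<xi> * (h \<xi> * k \<xi>)) \<le> C * (norm (h \<xi>) * norm (k \<xi>))"
        using b(3)[of n] by eventually_elim (simp add: norm_mult mult_right_mono)
    qed
    also have "\<dots> = C * (LINT \<xi>|circ. norm (h \<xi>) * norm (k \<xi>))" by simp
    also have "\<dots> \<le> C * (L2_norm h * L2_norm k)"
    proof (rule mult_left_mono[OF L2_Cauchy_Schwarz_norm[OF that]])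
      \<comment> \<open>An inequality between constants that holds almost everywhere holds, since
        the circle has positive measure.\<close>
      have "AE \<xi> in circ. C \<ge> 0" using b(3)[of 0] by eventually_elim (meson norm_ge_zero
          order_trans)
      then show "C \<ge> 0" by simp
    qed
    finally show ?thesis .
  qed
  have "(\<lambda>n. LINT \<xi>|circ. b n \<xi> * (f' \<xi> * g' \<xi>)) \<longlonglongrightarrow> (LINT \<xi>|circ. b' \<xi> * (f' \<xi> * g' \<xi>))"
  proof (rule integral_dominated_convergence[where w="\<lambda>\<xi>. C * norm (f' \<xi> * g' \<xi>)"])
    show "(\<lambda>\<xi>. b' \<xi> * (f' \<xi> * g' \<xi>)) \<in> borel_measurable circ" using b(2) f(2) g(2) by measurable
    show "(\<lambda>\<xi>. b n \<xi> * (f' \<xi> * g' \<xi>)) \<in> borel_measurable circ" for n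
      using i[OF f(2) g(2), of n] by simp
    show "integrable circ (\<lambda>\<xi>. C * norm (f' \<xi> * g' \<xi>))" using circle_L2_integrable_mult[OF f(2)
        g(2)] by simp
    show "AE \<xi> in circ. (\<lambda>n. b n \<xi> * (f' \<xi> * g' \<xi>)) \<longlonglongrightarrow> b' \<xi> * (f' \<xi> * g' \<xi>)"
      using b(4) by eventually_elim (intro tendsto_intros)
    show "AE \<xi> in circ. norm (b n \<xi> * (f' \<xi> * g' \<xi>)) \<le> C * norm (f' \<xi> * g' \<xi>)" for n
      using b(3)[of n] by eventually_elim (simp add: norm_mult mult_right_mono)
  qed
  moreover have "(\<lambda>n. (LINT \<xi>|circ. b n \<xi> * (f n \<xi> * g n \<xi>)) - (LINT \<xi>|circ. b n \<xi> * (f' \<xi> * g'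
      \<xi>))) \<longlonglongrightarrow> 0"
  proof (rule Lim_null_comparison)
    show "\<forall>\<^sub>F n in sequentially. norm ((LINT \<xi>|circ. b n \<xi> * (f n \<xi> * g n \<xi>)) - (LINT \<xi>|circ. b n
        \<xi> * (f' \<xi> * g' \<xi>)))
       \<le> C * (L2_norm (\<lambda>\<xi>. f n \<xi> - f' \<xi>) * L2_norm (g n)) + C * (L2_norm f' * L2_norm (\<lambda>\<xi>. g n \<xi> -
           g' \<xi>))"
    proof (rule always_eventually, rule allI)
      fix n
      have "(LINT \<xi>|circ. b n \<xi> * (f n \<xi> * g n \<xi>)) - (LINT \<xi>|circ. b n \<xi> * (f' \<xi> * g' \<xi>))
         = (LINT \<xi>|circ. b n \<xi> * (f n \<xi> * g n \<xi>) - b n \<xi> * (f' \<xi> * g' \<xi>))"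
        by (rule Bochner_Integration.integral_diff[symmetric]) (intro i f g)+
      also have "\<dots> = (LINT \<xi>|circ. b n \<xi> * ((f n \<xi> - f' \<xi>) * g n \<xi>) + b n \<xi> * (f' \<xi> * (g n \<xi> - g'
          \<xi>)))"
        by (simp add: algebra_simps)
      also have "\<dots> = (LINT \<xi>|circ. b n \<xi> * ((f n \<xi> - f' \<xi>) * g n \<xi>)) + (LINT \<xi>|circ. b n \<xi> * (f' \<xi>
          * (g n \<xi> - g' \<xi>)))"
        by (rule Bochner_Integration.integral_add) (intro i f g circle_L2_diff)+
      finally show "norm ((LINT \<xi>|circ. b n \<xi> * (f n \<xi> * g n \<xi>)) - (LINT \<xi>|circ. b n \<xi> * (f' \<xi> *
          g' \<xi>)))
       \<le> C * (L2_norm (\<lambda>\<xi>. f n \<xi> - f' \<xi>) * L2_norm (g n)) + C * (L2_norm f' * L2_norm (\<lambda>\<xi>. g n \<xi> -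
           g' \<xi>))"
        using bd[of "\<lambda>\<xi>. f n \<xi> - f' \<xi>" "g n" n] bd[of "f'" "\<lambda>\<xi>. g n \<xi> - g' \<xi>" n] f g
        by (auto simp: circle_L2_diff intro!: order_trans[OF norm_triangle_ineq])
    qed
    have "(\<lambda>n. C * (L2_norm (\<lambda>\<xi>. f n \<xi> - f' \<xi>) * L2_norm (g n)) + C * (L2_norm f' * L2_norm (\<lambda>\<xi>. g
        n \<xi> - g' \<xi>)))
        \<longlonglongrightarrow> C * (0 * L2_norm g') + C * (L2_norm f' * 0)"
      by (intro tendsto_intros f g L2_norm_tendsto_bounded)
    then show "(\<lambda>n. C * (L2_norm (\<lambda>\<xi>. f n \<xi> - f' \<xi>) * L2_norm (g n)) + C * (L2_norm f' * L2_norm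
        (\<lambda>\<xi>. g n \<xi> - g' \<xi>)))
        \<longlonglongrightarrow> 0" by simp
  qed
  ultimately show ?thesis using tendsto_add by fastforce
qed

lemma L2_integral_mult_tendsto:
  assumes "\<And>n. f n \<in> circle_L2" "f' \<in> circle_L2"
      "(\<lambda>n. L2_norm (\<lambda>\<xi>. f n \<xi> - f' \<xi>)) \<longlonglongrightarrow> 0"
    and "g \<in> circle_L2"
  shows "(\<lambda>n. LINT \<xi>|circ. f n \<xi> * g \<xi>) \<longlonglongrightarrow> (LINT \<xi>|circ. f' \<xi> * g \<xi>)"
  using L2_integral_tendsto[where f=f and g="\<lambda>_. g" and b="\<lambda>_ _. 1" and C=1 and b'="\<lambda>_. 1", OF
      assms(1-3) assms(4,4)]
  by (simp add: L2_norm_def)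

text \<open>Closedness is sequential in \<open>L2_norm\<close>. Any representative \<open>g\<close>
  of the limit qualifies, so constant sequences show that such a set is also stable under changes on
  null sets.\<close>

definition L2_closed_subspace :: "(complex \<Rightarrow> complex) set \<Rightarrow> bool" where
  "L2_closed_subspace K \<longleftrightarrow> K \<subseteq> circle_L2 \<and> (\<lambda>_. 0) \<in> K \<and>
     (\<forall>f\<in>K. \<forall>g\<in>K. (\<lambda>\<xi>. f \<xi> + g \<xi>) \<in> K) \<and> (\<forall>c. \<forall>f\<in>K. (\<lambda>\<xi>. c * f \<xi>) \<in> K) \<and>
     (\<forall>f g. (\<forall>n. f n \<in> K) \<longrightarrow> g \<in> circle_L2 \<longrightarrow> (\<lambda>n. L2_norm (\<lambda>\<xi>. f n \<xi> - g \<xi>)) \<longlonglongrightarrow> 0 \<longrightarrow> g \<in> K)"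

lemma
  assumes "L2_closed_subspace K"
  shows L2_closed_subspace_L2: "f \<in> K \<Longrightarrow> f \<in> circle_L2"
    and L2_closed_subspace_zero: "(\<lambda>_. 0) \<in> K"
    and L2_closed_subspace_add: "f \<in> K \<Longrightarrow> g \<in> K \<Longrightarrow> (\<lambda>\<xi>. f \<xi> + g \<xi>) \<in> K"
    and L2_closed_subspace_cmult: "f \<in> K \<Longrightarrow> (\<lambda>\<xi>. c * f \<xi>) \<in> K"
    and L2_closed_subspace_limit: "(\<And>n. F n \<in> K) \<Longrightarrow> g \<in> circle_L2 \<Longrightarrow>
          (\<lambda>n. L2_norm (\<lambda>\<xi>. F n \<xi> - g \<xi>)) \<longlonglongrightarrow> 0 \<Longrightarrow> g \<in> K"
  using assms unfolding L2_closed_subspace_def by (blast+)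

lemma L2_closed_subspace_diff:
  assumes "L2_closed_subspace K" "f \<in> K" "g \<in> K" shows "(\<lambda>\<xi>. f \<xi> - g \<xi>) \<in> K"
  using L2_closed_subspace_add[OF assms(1,2) L2_closed_subspace_cmult[OF assms(1,3), of "-1"]] by
      simp

text \<open>A minimizing sequence for the distance to \<open>K\<close> is Cauchy by the
  parallelogram law; its limit realizes the distance, and the first variation there gives
  orthogonality.\<close>

lemma L2_projection_exists:
  assumes K: "L2_closed_subspace K" and g: "g \<in> circle_L2"
  shows "\<exists>h\<in>K. \<forall>k\<in>K. L2_inner (\<lambda>\<xi>. g \<xi> - h \<xi>) k = 0"
proof -
  note [simp] = L2_closed_subspace_L2[OF K]
  define d where "d = (INF h\<in>K. (L2_norm (\<lambda>\<xi>. g \<xi> - h \<xi>))\<^sup>2)"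
  have bdd: "bdd_below ((\<lambda>h. (L2_norm (\<lambda>\<xi>. g \<xi> - h \<xi>))\<^sup>2) ` K)" by (rule bdd_belowI[of _ 0]) auto
  have ne: "K \<noteq> {}" using L2_closed_subspace_zero[OF K] by auto
  have dle: "d \<le> (L2_norm (\<lambda>\<xi>. g \<xi> - h \<xi>))\<^sup>2" if "h \<in> K" for h
    unfolding d_def by (rule cINF_lower[OF bdd that])
  have "\<exists>h\<in>K. (L2_norm (\<lambda>\<xi>. g \<xi> - h \<xi>))\<^sup>2 < d + e" if "e > 0" for e
    using cINF_less_iff[OF ne bdd, of "d + e"] that by (simp add: d_def)
  from this[of "inverse (real (Suc n))" for n]
  have "\<forall>n. \<exists>h. h \<in> K \<and> (L2_norm (\<lambda>\<xi>. g \<xi> - h \<xi>))\<^sup>2 < d + inverse (real (Suc n))"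
    by (simp add: Bex_def)
  from choice[OF this]
  obtain h where h: "\<And>n. h n \<in> K" and hd: "\<And>n. (L2_norm (\<lambda>\<xi>. g \<xi> - h n \<xi>))\<^sup>2 < d + inverse (Suc n)"
    by auto
  have par: "(L2_norm (\<lambda>\<xi>. h m \<xi> - h n \<xi>))\<^sup>2 \<le> 2 * inverse (Suc m) + 2 * inverse (Suc n)" for m n
  proof -
    let ?a = "\<lambda>\<xi>. g \<xi> - h n \<xi>" and ?b = "\<lambda>\<xi>. g \<xi> - h m \<xi>"
    have ab: "?a \<in> circle_L2" "?b \<in> circle_L2" "(\<lambda>\<xi>. (-1) * ?b \<xi>) \<in> circle_L2"
      using g h by (intro circle_L2_diff circle_L2_cmult; simp)+
    have 1: "(L2_norm (\<lambda>\<xi>. ?a \<xi> + ?b \<xi>))\<^sup>2 = (L2_norm ?a)\<^sup>2 + 2 * Re (L2_inner ?a ?b) + (L2_norm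
        ?b)\<^sup>2"
      by (rule L2_norm_add_power2[OF ab(1,2)])
    have "(L2_norm (\<lambda>\<xi>. ?a \<xi> + (-1) * ?b \<xi>))\<^sup>2 =
        (L2_norm ?a)\<^sup>2 + 2 * Re (L2_inner ?a (\<lambda>\<xi>. (-1) * ?b \<xi>)) + (L2_norm (\<lambda>\<xi>. (-1) * ?b \<xi>))\<^sup>2"
      by (rule L2_norm_add_power2[OF ab(1,3)])
    then have 2: "(L2_norm (\<lambda>\<xi>. h m \<xi> - h n \<xi>))\<^sup>2 = (L2_norm ?a)\<^sup>2 - 2 * Re (L2_inner ?a ?b) +
        (L2_norm ?b)\<^sup>2"
      unfolding L2_inner_cmult_right L2_norm_cmult by simp
    \<comment> \<open>The midpoint of \<open>h n\<close> and \<open>h m\<close> competes in the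
      infimum, so the mean of the two error functions has squared norm at least
      \<open>d\<close>.\<close>
    have "(\<lambda>\<xi>. (1/2) * (h n \<xi> + h m \<xi>)) \<in> K"
      by (intro L2_closed_subspace_cmult[OF K] L2_closed_subspace_add[OF K] h)
    from dle[OF this] have "d \<le> (L2_norm (\<lambda>\<xi>. (1/2) * (?a \<xi> + ?b \<xi>)))\<^sup>2"
      by (simp add: algebra_simps)
    also have "\<dots> = (L2_norm (\<lambda>\<xi>. ?a \<xi> + ?b \<xi>))\<^sup>2 / 4"
      unfolding L2_norm_cmult by (simp add: power_mult_distrib power_divide)
    finally have "4 * d \<le> (L2_norm (\<lambda>\<xi>. ?a \<xi> + ?b \<xi>))\<^sup>2" by simp
    then show ?thesis using 1 2 hd[of m] hd[of n] by linarith
  qed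
  have Cau: "\<exists>N. \<forall>m\<ge>N. \<forall>n\<ge>N. L2_norm (\<lambda>\<xi>. h m \<xi> - h n \<xi>) \<le> e" if "e > 0" for e
  proof -
    have "e\<^sup>2/4 > 0" using that by simp
    then obtain N where N: "inverse (real (Suc N)) < e\<^sup>2/4" using reals_Archimedean by blast
    show ?thesis
    proof (intro exI allI impI)
      fix m n assume "m \<ge> N" "n \<ge> N"
      then have "inverse (real (Suc m)) \<le> inverse (real (Suc N))" "inverse (real (Suc n)) \<le>
          inverse (real (Suc N))"
        by (auto intro!: le_imp_inverse_le)
      with par[of m n] N have "(L2_norm (\<lambda>\<xi>. h m \<xi> - h n \<xi>))\<^sup>2 \<le> e\<^sup>2" by linarith
      then show "L2_norm (\<lambda>\<xi>. h m \<xi> - h n \<xi>) \<le> e" using that by (rule power2_le_imp_le[OF _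
          less_imp_le])
    qed
  qed
  have hL: "h n \<in> circle_L2" for n using h by simp
  from L2_complete[OF hL Cau]
  obtain p where p: "p \<in> circle_L2" "(\<lambda>n. L2_norm (\<lambda>\<xi>. h n \<xi> - p \<xi>)) \<longlonglongrightarrow> 0"
    by blast
  have pK: "p \<in> K" by (rule L2_closed_subspace_limit[OF K h p])
  have "(\<lambda>n. (L2_norm (\<lambda>\<xi>. g \<xi> - h n \<xi>))\<^sup>2) \<longlonglongrightarrow> (L2_norm (\<lambda>\<xi>. g \<xi> - p \<xi>))\<^sup>2"
  proof (intro tendsto_intros L2_norm_tendsto_bounded)
    show "(\<lambda>n. L2_norm (\<lambda>\<xi>. (g \<xi> - h n \<xi>) - (g \<xi> - p \<xi>))) \<longlonglongrightarrow> 0"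
      using p(2) by (subst L2_norm_diff_commute) simp
  qed (use g h p in \<open>auto intro!: circle_L2_diff\<close>)
  moreover have "(\<lambda>n. d + inverse (real (Suc n))) \<longlonglongrightarrow> d + 0"
    by (intro tendsto_intros LIMSEQ_inverse_real_of_nat)
  ultimately have min: "(L2_norm (\<lambda>\<xi>. g \<xi> - p \<xi>))\<^sup>2 \<le> d"
    using hd by (intro LIMSEQ_le[of _ _ _ d]) (auto intro!: exI[of _ 0] less_imp_le)
  have "L2_inner (\<lambda>\<xi>. g \<xi> - p \<xi>) k = 0" if k: "k \<in> K" for k
  proof (rule ccontr)
    define a where "a = L2_inner (\<lambda>\<xi>. g \<xi> - p \<xi>) k"
    assume "L2_inner (\<lambda>\<xi>. g \<xi> - p \<xi>) k \<noteq> 0"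
    then have a: "norm a > 0" by (simp add: a_def)
    \<comment> \<open>The summand 1 keeps the denominator positive when \<open>k\<close> is null,
      and \<open>t * (L2_norm k)\<^sup>2 \<le> 1\<close> makes the linear gain
      \<open>2 t \<bar>a\<bar>\<^sup>2\<close> exceed the quadratic loss.\<close>
    define t where "t = 1 / ((L2_norm k)\<^sup>2 + 1)"
    have t: "t > 0" "t * (L2_norm k)\<^sup>2 \<le> 1" by (auto simp: t_def divide_simps add_pos_nonneg
        add_nonneg_pos)
    define c where "c = - of_real t * a"
    have "(\<lambda>\<xi>. p \<xi> - c * k \<xi>) \<in> K"
      by (intro L2_closed_subspace_diff[OF K] L2_closed_subspace_cmult[OF K] pK k)
    from dle[OF this] have "d \<le> (L2_norm (\<lambda>\<xi>. (g \<xi> - p \<xi>) + c * k \<xi>))\<^sup>2"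
      by (simp add: algebra_simps)
    also have "\<dots> = (L2_norm (\<lambda>\<xi>. g \<xi> - p \<xi>))\<^sup>2 + 2 * Re (cnj c * a) + (norm c * L2_norm k)\<^sup>2"
      unfolding a_def by (subst L2_norm_add_power2)
        (use g pK k in \<open>auto intro!: circle_L2_diff circle_L2_cmult simp: L2_norm_cmult
            L2_inner_cmult_right\<close>)
    also have "Re (cnj c * a) = - t * (norm a)\<^sup>2"
      by (simp add: c_def cmod_power2[unfolded power2_eq_square] algebra_simps power2_eq_square)
    also have "norm c = t * norm a" using t by (simp add: c_def norm_mult)
    finally have "0 \<le> t * (norm a)\<^sup>2 * (t * (L2_norm k)\<^sup>2 - 2)"
      using min by (simp add: power_mult_distrib algebra_simps power2_eq_square)
    moreover have "t * (norm a)\<^sup>2 * (t * (L2_norm k)\<^sup>2 - 2) < 0"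
      using t a by (intro mult_pos_neg) auto
    ultimately show False by linarith
  qed
  then show ?thesis using pK by auto
qed

lemma
  assumes "L2_closed_subspace K" "g \<in> circle_L2"
  shows L2_proj_in: "L2_proj K g \<in> K"
    and L2_proj_orthogonal: "k \<in> K \<Longrightarrow> L2_inner (\<lambda>\<xi>. g \<xi> - L2_proj K g \<xi>) k = 0"
proof -
  have "L2_proj K g \<in> K \<and> (\<forall>k\<in>K. L2_inner (\<lambda>\<xi>. g \<xi> - L2_proj K g \<xi>) k = 0)"
    unfolding L2_proj_def
    by (rule someI_ex[of "\<lambda>h. h \<in> K \<and> (\<forall>k\<in>K. L2_inner (\<lambda>\<xi>. g \<xi> - h \<xi>) k = 0)"])
      (use L2_projection_exists[OF assms] in \<open>simp add: Bex_def\<close>)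
  then show "L2_proj K g \<in> K" "k \<in> K \<Longrightarrow> L2_inner (\<lambda>\<xi>. g \<xi> - L2_proj K g \<xi>) k = 0" by auto
qed

lemma L2_inner_proj:
  assumes "L2_closed_subspace K" "g \<in> circle_L2" "k \<in> K"
  shows "L2_inner (L2_proj K g) k = L2_inner g k"
  using L2_proj_orthogonal[OF assms] L2_proj_in[OF assms(1,2)] assms L2_closed_subspace_L2
  by (subst (asm) L2_inner_diff_left) auto

text \<open>Test with \<open>k = h\<close> and apply Cauchy-Schwarz. The weak form of the hypothesis
  lets it bound differences of projections as well as single ones.\<close>

lemma L2_norm_le_of_inner:
  assumes K: "L2_closed_subspace K" and h: "h \<in> K" and g: "g \<in> circle_L2"
    and eq: "\<And>k. k \<in> K \<Longrightarrow> L2_inner h k = L2_inner g k"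
  shows "L2_norm h \<le> L2_norm g"
proof -
  have hL: "h \<in> circle_L2" by (rule L2_closed_subspace_L2[OF K h])
  have "(L2_norm h)\<^sup>2 = norm (L2_inner h h)" by (simp add: L2_inner_self norm_power)
  also have "\<dots> = norm (L2_inner g h)" by (simp add: eq h)
  also have "\<dots> \<le> L2_norm g * L2_norm h" by (rule L2_Cauchy_Schwarz[OF g hL])
  finally show ?thesis
    using L2_norm_nonneg[of h] L2_norm_nonneg[of g] unfolding power2_eq_square
    by (metis less_eq_real_def mult_right_le_imp_le)
qed

lemma L2_norm_proj_le:
  assumes K: "L2_closed_subspace K" and g: "g \<in> circle_L2"
  shows "L2_norm (L2_proj K g) \<le> L2_norm g"
  by (rule L2_norm_le_of_inner[OF K L2_proj_in[OF K g] g L2_inner_proj[OF K g]])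

text \<open>The difference of \<open>h\<close> and \<open>g\<close> has the same inner products with
  \<open>K\<close> as 0, so its norm is at most 0. Identities between operators on \<open>K\<close>
  are verified in this weak form.\<close>

lemma AE_eq_of_inner:
  assumes K: "L2_closed_subspace K" and "h \<in> K" "g \<in> K"
    and eq: "\<And>k. k \<in> K \<Longrightarrow> L2_inner h k = L2_inner g k"
  shows "AE \<xi> in circ. h \<xi> = g \<xi>"
proof -
  have L: "h \<in> circle_L2" "g \<in> circle_L2" using assms L2_closed_subspace_L2 by auto
  have "L2_norm (\<lambda>\<xi>. h \<xi> - g \<xi>) \<le> L2_norm (\<lambda>_. 0)"
  proof (rule L2_norm_le_of_inner[OF K L2_closed_subspace_diff[OF K assms(2,3)] circle_L2_const])
    fix k assume "k \<in> K"
    then show "L2_inner (\<lambda>\<xi>. h \<xi> - g \<xi>) k = L2_inner (\<lambda>_. 0) k"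
      using L L2_closed_subspace_L2[OF K] eq by (simp add: L2_inner_diff_left) (simp add:
          L2_inner_def)
  qed
  then have "L2_norm (\<lambda>\<xi>. h \<xi> - g \<xi>) = 0" 
    using L2_norm_nonneg[of "\<lambda>\<xi>. h \<xi> - g \<xi>"] L2_norm_zero_iff[OF circle_L2_const[of 0]]
    by (intro antisym) auto
  then show ?thesis using L2_norm_zero_iff[OF circle_L2_diff[OF L]] by simp
qed

section \<open>The Hardy space and measurability of radial limits\<close>

lemma hardy_H2_closed_subspace: "L2_closed_subspace hardy_H2"
  unfolding L2_closed_subspace_def
proof (intro conjI ballI allI impI)
  show "hardy_H2 \<subseteq> circle_L2" by (auto simp: hardy_H2_def)
  show "(\<lambda>_. 0) \<in> hardy_H2" by (auto simp: hardy_H2_def circle_L2_const)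
  fix f g assume fg: "f \<in> hardy_H2" "g \<in> hardy_H2"
  then show "(\<lambda>\<xi>. f \<xi> + g \<xi>) \<in> hardy_H2"
    by (auto simp: hardy_H2_def circle_L2_add ring_distribs circle_L2_integrable_mult
        circle_L2_power)
next
  fix c f assume "f \<in> hardy_H2"
  then show "(\<lambda>\<xi>. c * f \<xi>) \<in> hardy_H2"
    by (auto simp: hardy_H2_def circle_L2_cmult mult.assoc)
next
  fix f g assume f: "\<forall>n. f n \<in> hardy_H2" and g: "g \<in> circle_L2"
    and lim: "(\<lambda>n. L2_norm (\<lambda>\<xi>. f n \<xi> - g \<xi>)) \<longlonglongrightarrow> 0"
  have "(LINT \<xi>|circ. g \<xi> * \<xi> ^ n) = 0" if "n \<ge> 1" for n
  proof -
    have "(\<lambda>k. LINT \<xi>|circ. f k \<xi> * \<xi> ^ n) \<longlonglongrightarrow> (LINT \<xi>|circ. g \<xi> * \<xi> ^ n)"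
      by (rule L2_integral_mult_tendsto[OF _ g lim circle_L2_power]) (use f in \<open>auto simp:
          hardy_H2_def\<close>)
    moreover have "(LINT \<xi>|circ. f k \<xi> * \<xi> ^ n) = 0" for k using f that by (auto simp: hardy_H2_def)
    ultimately show ?thesis by (simp add: LIMSEQ_const_iff)
  qed
  then show "g \<in> hardy_H2" using g by (auto simp: hardy_H2_def)
qed

lemma hardy_H2_L2: "f \<in> hardy_H2 \<Longrightarrow> f \<in> circle_L2"
  by (simp add: hardy_H2_def)

lemma hardy_H2_power: "(\<lambda>\<xi>. \<xi> ^ n) \<in> hardy_H2"
  by (auto simp: hardy_H2_def circle_L2_power circle_integral_power simp flip: power_add)

text \<open>Where the limit exists it is the limit of a sequence of continuous functions; elsewhere
  \<open>radial_limit\<close> is one unspecified constant. It remains to see that the set of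
  convergence is Borel, and the Cauchy criterion builds it from closed sets by countable
  operations.\<close>

lemma radial_limit_measurable:
  assumes cont: "continuous_on (ball 0 1) \<Theta>"
  shows "radial_limit \<Theta> \<in> borel_measurable circ"
proof -
  define S where "S = (sphere 0 1 :: complex set)"
  \<comment> \<open>The Cauchy condition with tolerance \<open>inverse (Suc n)\<close> on radii
    within \<open>inverse (Suc m)\<close> of 1. The nonstrict inequality makes it an intersection of
    closed conditions, one for each pair of radii.\<close>
  define D where "D n m = {\<xi> \<in> S. \<forall>r s. 1 - inverse (Suc m) < r \<and> r < 1 \<and> 1 - inverse (Suc m) < s
      \<and> s < 1 \<longrightarrow>
      dist (\<Theta> (of_real r * \<xi>)) (\<Theta> (of_real s * \<xi>)) \<le> inverse (Suc n)}" for n m :: nat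
  have pos: "0 < r" if "1 - inverse (real (Suc m)) < r" for r and m :: nat
  proof -
    have "inverse (real (Suc m)) \<le> 1" by (simp add: divide_simps)
    with that show ?thesis by linarith
  qed
  have cr: "continuous_on S (\<lambda>\<xi>. \<Theta> (of_real r * \<xi>))" if "0 < r" "r < 1" for r :: real
    by (intro continuous_on_compose2[OF cont] continuous_intros) (use that in \<open>auto simp: S_def
        norm_mult\<close>)
  have clo: "closed (D n m)" for n m
  proof -
    have "D n m = S \<inter> (\<Inter>(r, s)\<in>{(r, s). 1 - inverse (Suc m) < r \<and> r < 1 \<and> 1 - inverse (Suc m) < s
        \<and> s < 1}.
       {\<xi> \<in> S. dist (\<Theta> (of_real r * \<xi>)) (\<Theta> (of_real s * \<xi>)) \<le> inverse (Suc n)})"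
      by (auto simp: D_def)
    moreover have "closed \<dots>"
    proof (intro closed_Int closed_INT ballI)
      show "closed S" by (simp add: S_def)
      fix x assume x: "x \<in> {(r, s). 1 - inverse (real (Suc m)) < r \<and> r < 1 \<and> 1 - inverse (real
          (Suc m)) < s \<and> s < 1}"
      obtain r s where [simp]: "x = (r, s)" by force
      have "0 < r" "r < 1" "0 < s" "s < 1" using x pos by auto
      then have "closed {\<xi> \<in> S. dist (\<Theta> (of_real r * \<xi>)) (\<Theta> (of_real s * \<xi>)) \<le> inverse (Suc n)}"
        by (intro continuous_on_closed_Collect_le continuous_intros cr) (auto simp: S_def)
      then show "closed (case x of (r, s) \<Rightarrow> {\<xi> \<in> S. dist (\<Theta> (of_real r * \<xi>)) (\<Theta> (of_real s * \<xi>)) \<le>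
          inverse (Suc n)})"
        by simp
    qed
    ultimately show ?thesis by simp
  qed
  define E where "E = (\<Inter>n. \<Union>m. D n m)"
  have Eb: "E \<in> sets borel" unfolding E_def using clo by (auto intro!: sets.countable_INT
      sets.countable_UN borel_closed)
  have ES: "E \<subseteq> S" by (auto simp: E_def D_def)
  have conv_iff: "(\<exists>l. ((\<lambda>r::real. \<Theta> (of_real r * \<xi>)) \<longlongrightarrow> l) (at_left 1)) \<longleftrightarrow> \<xi> \<in> E" if "\<xi> \<in> S" for \<xi>
  proof
    assume "\<exists>l. ((\<lambda>r::real. \<Theta> (of_real r * \<xi>)) \<longlongrightarrow> l) (at_left 1)"
    then obtain l where l: "((\<lambda>r::real. \<Theta> (of_real r * \<xi>)) \<longlongrightarrow> l) (at_left 1)" by auto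
    have "\<exists>m. \<xi> \<in> D n m" for n
    proof -
      have "\<forall>\<^sub>F r::real in at_left 1. dist (\<Theta> (of_real r * \<xi>)) l < inverse (Suc n) / 2"
        by (rule tendstoD[OF l]) simp
      then obtain b where b: "b < 1" "\<And>r. b < r \<Longrightarrow> r < 1 \<Longrightarrow> dist (\<Theta> (of_real r * \<xi>)) l < inverse
          (Suc n) / 2"
        by (auto simp: eventually_at_left[of 0 1])
      obtain m where m: "inverse (real (Suc m)) < 1 - b" using reals_Archimedean[of "1 - b"] b(1)
          by auto
      have "\<xi> \<in> D n m" unfolding D_def
      proof (safe intro!: that)
        fix r s assume "1 - inverse (real (Suc m)) < r" "r < 1" "1 - inverse (real (Suc m)) < s"
            "s < 1"
        then have "dist (\<Theta> (of_real r * \<xi>)) l < inverse (Suc n) / 2" "dist (\<Theta> (of_real s * \<xi>)) l <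
            inverse (Suc n) / 2"
          using b m by auto
        then show "dist (\<Theta> (of_real r * \<xi>)) (\<Theta> (of_real s * \<xi>)) \<le> inverse (Suc n)"
          using dist_triangle3[of "\<Theta> (of_real r * \<xi>)" "\<Theta> (of_real s * \<xi>)" l] by (simp add:
              dist_commute)
      qed
      then show ?thesis ..
    qed
    then show "\<xi> \<in> E" by (auto simp: E_def)
  next
    assume E: "\<xi> \<in> E"
    have "\<exists>L. ((\<lambda>r::real. \<Theta> (of_real r * \<xi>)) \<longlongrightarrow> L) (at_left 1)"
    proof -
      have "cauchy_filter (filtermap (\<lambda>r::real. \<Theta> (of_real r * \<xi>)) (at_left 1))"
        unfolding cauchy_filter_metric_filtermap
      proof (intro allI impI)
        fix e :: real assume "e > 0"
        then obtain n where n: "inverse (real (Suc n)) < e" using reals_Archimedean by blast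
        obtain m where m: "\<xi> \<in> D n m" using E by (auto simp: E_def)
        define P where "P r \<longleftrightarrow> 1 - inverse (real (Suc m)) < r \<and> r < 1" for r
        have "eventually P (at_left 1)"
          unfolding P_def by (rule eventually_at_leftI[of "1 - inverse (real (Suc m))"]) auto
        moreover have "\<forall>x y. P x \<and> P y \<longrightarrow> dist (\<Theta> (of_real x * \<xi>)) (\<Theta> (of_real y * \<xi>)) < e"
          using m n unfolding P_def D_def by (auto intro: le_less_trans)
        ultimately show "\<exists>P. eventually P (at_left 1) \<and>
            (\<forall>x y. P x \<and> P y \<longrightarrow> dist (\<Theta> (of_real x * \<xi>)) (\<Theta> (of_real y * \<xi>)) < e)" by blast
      qed
      from cauchy_filter_complete_converges[OF this complete_UNIV] show ?thesis
        by (auto simp: filterlim_def filtermap_bot_iff)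
    qed
    then show "\<exists>l. ((\<lambda>r::real. \<Theta> (of_real r * \<xi>)) \<longlongrightarrow> l) (at_left 1)" .
  qed
  define q where "q n \<xi> = \<Theta> (of_real (1 - inverse (Suc (Suc n))) * \<xi>)" for n \<xi>
  have q01: "0 < 1 - inverse (real (Suc (Suc n)))" "1 - inverse (real (Suc (Suc n))) < 1" for n
    by (auto simp: field_simps)
  have qm: "q n \<in> borel_measurable circ" for n
    unfolding q_def using cr[OF q01] by (intro borel_measurable_circle_continuous) (simp add: S_def)
  have tl: "filterlim (\<lambda>n. 1 - inverse (real (Suc (Suc n)))) (at_left 1) sequentially"
    by (rule tendsto_imp_filterlim_at_left) (real_asymp, simp)
  \<comment> \<open>Without a limit the description in \<open>Lim\<close> has no witness, so its
    value is \<open>THE x. False\<close>, the same for all such points.\<close>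
  have "radial_limit \<Theta> \<xi> = (if \<xi> \<in> E then lim (\<lambda>n. q n \<xi>) else (THE x. False))" if "\<xi> \<in> S" for \<xi>
  proof (cases "\<xi> \<in> E")
    case True
    then obtain l where l: "((\<lambda>r::real. \<Theta> (of_real r * \<xi>)) \<longlongrightarrow> l) (at_left 1)"
      using conv_iff[of \<xi>] \<open>\<xi> \<in> S\<close> by auto
    have "radial_limit \<Theta> \<xi> = l" unfolding radial_limit_def by (rule tendsto_Lim[OF _ l]) simp
    moreover have "(\<lambda>n. q n \<xi>) \<longlonglongrightarrow> l" unfolding q_def using filterlim_compose[OF l tl] .
    ultimately show ?thesis using True by (simp add: limI)
  next
    case False
    then show ?thesis using conv_iff[OF that] by (simp add: radial_limit_def
        Topological_Spaces.Lim_def)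
  qed
  moreover have "(\<lambda>\<xi>. if \<xi> \<in> E then lim (\<lambda>n. q n \<xi>) else (THE x. False)) \<in> borel_measurable circ"
  proof (rule measurable_If_set)
    show "(\<lambda>\<xi>. lim (\<lambda>n. q n \<xi>)) \<in> borel_measurable circ" by (rule borel_measurable_lim_metric)
        (rule qm)
    show "E \<inter> space circ \<in> sets circ" using Eb by (auto simp: sets_circle sets_restrict_space
        Int_commute)
  qed simp
  ultimately show ?thesis
    by (subst measurable_cong[where g="\<lambda>\<xi>. if \<xi> \<in> E then lim (\<lambda>n. q n \<xi>) else (THE x. False)"])
        (auto simp: S_def)
qed

section \<open>Fourier series\<close>

text \<open>Orthogonality to monomials passes to polynomials, by Stone-Weierstrass to continuous
  functions, by cutoffs to closed sets, and by a Dynkin argument to Borel sets. A function with zero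
  integral over every measurable set is null.\<close>

lemma circle_uniqueness:
  assumes f: "integrable circ f"
    and z1: "\<And>n. (LINT \<xi>|circ. f \<xi> * \<xi> ^ n) = 0"
    and z2: "\<And>n. (LINT \<xi>|circ. f \<xi> * cnj \<xi> ^ n) = 0"
  shows "AE \<xi> in circ. f \<xi> = 0"
proof -
  \<comment> \<open>This class is closed under multiplication by \<open>\<xi>\<close> and by its
    conjugate, hence by real polynomials in the plane; the moment of index 0 then says that such a
    product has integral 0.\<close>
  define H where "H = {g. integrable circ g \<and> (\<forall>n. (LINT \<xi>|circ. g \<xi> * \<xi> ^ n) = 0) \<and> (\<forall>n. (LINT
      \<xi>|circ. g \<xi> * cnj \<xi> ^ n) = 0)}"
  have int_mult: "integrable circ (\<lambda>\<xi>. g \<xi> * p \<xi>)"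
    if "integrable circ g" "p \<in> borel_measurable circ" "\<And>\<xi>. norm \<xi> = 1 \<Longrightarrow> norm (p \<xi>) \<le> C" for g p
        :: "complex \<Rightarrow> complex" and C
  proof (rule Bochner_Integration.integrable_bound[where f="\<lambda>\<xi>. C * norm (g \<xi>)"])
    show "(\<lambda>\<xi>. g \<xi> * p \<xi>) \<in> borel_measurable circ" using that(1,2) by measurable
    show "AE x in circ. norm (g x * p x) \<le> norm (C * norm (g x))"
      using AE_circle_norm
    proof eventually_elim
      case (elim x)
      have "norm (p x) \<le> \<bar>C\<bar>" using that(3)[OF elim] by simp
      then have "norm (g x) * norm (p x) \<le> norm (g x) * \<bar>C\<bar>" by (rule mult_left_mono) simp
      then show ?case by (simp add: norm_mult abs_mult mult.commute)
    qed
  qed (use that in auto)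
  have mono: "integrable circ (\<lambda>\<xi>. g \<xi> * (\<xi> ^ a * cnj \<xi> ^ b))" if "integrable circ g" for g ::
      "complex \<Rightarrow> complex" and a b
    by (rule int_mult[OF that, of _ 1]) (auto simp: norm_mult norm_power)
  have mono1: "integrable circ (\<lambda>\<xi>. g \<xi> * \<xi> ^ a)" "integrable circ (\<lambda>\<xi>. g \<xi> * cnj \<xi> ^ a)" if
      "integrable circ g" for g :: "complex \<Rightarrow> complex" and a
    using mono[OF that, of a 0] mono[OF that, of 0 a] by auto
  have H_scale: "(\<lambda>\<xi>. c * g \<xi>) \<in> H" if "g \<in> H" for g c
    using that by (auto simp: H_def mult.assoc)
  have H_add: "(\<lambda>\<xi>. g \<xi> + h \<xi>) \<in> H" if "g \<in> H" "h \<in> H" for g h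
    using that by (auto simp: H_def ring_distribs mono1)
  have H_shift: "(\<lambda>\<xi>. \<xi> * g \<xi>) \<in> H" if "g \<in> H" for g
  proof -
    have g: "integrable circ g" using that by (simp add: H_def)
    have "integrable circ (\<lambda>\<xi>. \<xi> * g \<xi>)" using mono1(1)[OF g, of 1] by (simp add: mult.commute)
    moreover have "(LINT \<xi>|circ. \<xi> * g \<xi> * \<xi> ^ n) = 0" for n
    proof -
      have "(LINT \<xi>|circ. \<xi> * g \<xi> * \<xi> ^ n) = (LINT \<xi>|circ. g \<xi> * \<xi> ^ Suc n)" by (simp add: mult_ac)
      then show ?thesis using that by (simp add: H_def del: power_Suc)
    qed
    moreover have "(LINT \<xi>|circ. \<xi> * g \<xi> * cnj \<xi> ^ n) = 0" for n
    proof (cases n)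
      case 0 then show ?thesis using that spec[of "\<lambda>n. (LINT \<xi>|circ. g \<xi> * \<xi> ^ n) = 0" 1] by (simp
          add: H_def mult.commute)
    next
      case (Suc k)
      have "(LINT \<xi>|circ. \<xi> * g \<xi> * cnj \<xi> ^ n) = (LINT \<xi>|circ. g \<xi> * cnj \<xi> ^ k)"
      proof (rule Bochner_Integration.integral_cong[OF refl])
        fix \<xi> assume "\<xi> \<in> space circ"
        then have "\<xi> * cnj \<xi> = 1" by (simp add: complex_norm_square[symmetric])
        moreover have "\<xi> * g \<xi> * cnj \<xi> ^ n = (\<xi> * cnj \<xi>) * (g \<xi> * cnj \<xi> ^ k)" by (simp add: Suc)
        ultimately show "\<xi> * g \<xi> * cnj \<xi> ^ n = g \<xi> * cnj \<xi> ^ k" by simp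
      qed
      then show ?thesis using that by (simp add: H_def)
    qed
    ultimately show ?thesis by (simp add: H_def)
  qed
  have H_cnj: "(\<lambda>\<xi>. cnj (g \<xi>)) \<in> H" if "g \<in> H" for g
  proof -
    have "(LINT \<xi>|circ. cnj (g \<xi>) * \<xi> ^ n) = cnj (LINT \<xi>|circ. g \<xi> * cnj \<xi> ^ n)"
      "(LINT \<xi>|circ. cnj (g \<xi>) * cnj \<xi> ^ n) = cnj (LINT \<xi>|circ. g \<xi> * \<xi> ^ n)" for n
      by (simp_all flip: Bochner_Integration.integral_cnj)
    then show ?thesis using that by (simp add: H_def)
  qed
  have H_shift': "(\<lambda>\<xi>. cnj \<xi> * g \<xi>) \<in> H" if "g \<in> H" for g
    using H_cnj[OF H_shift[OF H_cnj[OF that]]] by simp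
  have H_poly: "(\<lambda>\<xi>. of_real (p \<xi>) * g \<xi>) \<in> H" if "real_polynomial_function p" "g \<in> H" for p g
    using that
  proof (induction p arbitrary: g rule: real_polynomial_function.induct)
    case lin: (linear p)
    interpret bounded_linear p by (rule lin.hyps)
    \<comment> \<open>A real-linear functional on the plane is a combination of \<open>\<xi>\<close>
      and \<open>cnj \<xi>\<close> with these coefficients.\<close>
    define \<alpha> \<beta> where "\<alpha> = (of_real (p 1) - \<i> * of_real (p \<i>)) / 2" and "\<beta> = (of_real (p 1) + \<i> *
        of_real (p \<i>)) / 2"
    have p_eq: "p \<xi> = Re \<xi> * p 1 + Im \<xi> * p \<i>" for \<xi>
    proof -
      have "p (Re \<xi> *\<^sub>R 1 + Im \<xi> *\<^sub>R \<i>) = Re \<xi> * p 1 + Im \<xi> * p \<i>" by (simp only: add scaleR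
          real_scaleR_def)
      moreover have "Re \<xi> *\<^sub>R 1 + Im \<xi> *\<^sub>R \<i> = \<xi>" by (simp add: complex_eq_iff)
      ultimately show ?thesis by simp
    qed
    have "of_real (p \<xi>) = \<alpha> * \<xi> + \<beta> * cnj \<xi>" for \<xi>
      by (subst p_eq) (simp add: \<alpha>_def \<beta>_def complex_eq_iff algebra_simps add_divide_distrib
          diff_divide_distrib)
    then have "(\<lambda>\<xi>. of_real (p \<xi>) * g \<xi>) = (\<lambda>\<xi>. \<alpha> * (\<xi> * g \<xi>) + \<beta> * (cnj \<xi> * g \<xi>))"
      by (simp add: fun_eq_iff algebra_simps)
    then show ?case using H_add[OF H_scale[OF H_shift[OF lin.prems]] H_scale[OF H_shift'[OF
        lin.prems]]] by simp
  next
    case (const c)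
    then show ?case by (auto intro: H_scale)
  next
    case (add p q)
    then show ?case using H_add[OF add.IH(1)[OF add.prems] add.IH(2)[OF add.prems]] by (simp add:
        algebra_simps)
  next
    case (mult p q)
    show ?case using mult.IH(1)[OF mult.IH(2)[OF mult.prems]] by (simp add: algebra_simps)
  qed
  have fH: "f \<in> H" using assms by (simp add: H_def)
  have cont0: "(LINT \<xi>|circ. of_real (c \<xi>) * f \<xi>) = 0" if c: "continuous_on (sphere 0 1) c" for c
      :: "complex \<Rightarrow> real"
  proof -
    define B where "B = (LINT \<xi>|circ. norm (f \<xi>))"
    have "norm (LINT \<xi>|circ. of_real (c \<xi>) * f \<xi>) \<le> e * B" if e: "e > 0" for e
    proof -
      obtain p where p: "real_polynomial_function p" "\<And>x. x \<in> sphere 0 1 \<Longrightarrow> \<bar>c x - p x\<bar> < e"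
        using Stone_Weierstrass_real_polynomial_function[OF compact_sphere c e] by blast
      have pi: "integrable circ (\<lambda>\<xi>. of_real (p \<xi>) * f \<xi>)" and p0: "(LINT \<xi>|circ. of_real (p \<xi>) *
          f \<xi>) = 0"
        using H_poly[OF p(1) fH] unfolding H_def by (auto dest: spec[of _ 0])
      have cm: "c \<in> borel_measurable circ" by (rule borel_measurable_circle_continuous[OF c])
      obtain C where "\<forall>y\<in>c ` sphere 0 1. norm y \<le> C"
        using compact_imp_bounded[OF compact_continuous_image[OF c compact_sphere]] unfolding
            bounded_iff by blast
      then have C: "\<And>x. x \<in> sphere 0 1 \<Longrightarrow> \<bar>c x\<bar> \<le> C" by simp
      have ci: "integrable circ (\<lambda>\<xi>. of_real (c \<xi>) * f \<xi>)"
        using int_mult[OF f, of "\<lambda>\<xi>. of_real (c \<xi>)" C] cm C by (auto simp: mult.commute)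
      have "(LINT \<xi>|circ. of_real (c \<xi>) * f \<xi>) = (LINT \<xi>|circ. of_real (c \<xi>) * f \<xi> - of_real (p \<xi>)
          * f \<xi>)"
        using ci pi p0 by simp
      also have "norm \<dots> \<le> (LINT \<xi>|circ. norm (of_real (c \<xi>) * f \<xi> - of_real (p \<xi>) * f \<xi>))"
        by (rule integral_norm_bound)
      also have "\<dots> \<le> (LINT \<xi>|circ. e * norm (f \<xi>))"
      proof (rule integral_mono)
        fix \<xi> assume "\<xi> \<in> space circ"
        then have "\<bar>c \<xi> - p \<xi>\<bar> \<le> e" using p(2)[of \<xi>] by simp
        then show "norm (of_real (c \<xi>) * f \<xi> - of_real (p \<xi>) * f \<xi>) \<le> e * norm (f \<xi>)"
          by (simp add: norm_mult mult_right_mono flip: left_diff_distrib of_real_diff)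
      qed (use ci pi f in auto)
      finally show ?thesis by (simp add: B_def)
    qed
    moreover have "B \<ge> 0" by (simp add: B_def)
    ultimately have "norm (LINT \<xi>|circ. of_real (c \<xi>) * f \<xi>) \<le> 0 + e" if "e > 0" for e
    proof -
      \<comment> \<open>Dividing by \<open>B + 1\<close> instead of \<open>B\<close> covers the case
        of a null \<open>f\<close>.\<close>
      have "norm (LINT \<xi>|circ. of_real (c \<xi>) * f \<xi>) \<le> (e / (B + 1)) * B"
        using \<open>B \<ge> 0\<close> that by (intro \<open>\<And>e. e > 0 \<Longrightarrow> norm (LINT \<xi>|circ. of_real (c \<xi>) * f \<xi>) \<le> e *
            B\<close>) auto
      also have "\<dots> \<le> e" using \<open>B \<ge> 0\<close> that by (simp add: divide_simps)
      finally show ?thesis by simp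
    qed
    from field_le_epsilon[OF this] show ?thesis by simp
  qed
  have borel0: "(LINT \<xi>:(A \<inter> sphere 0 1)|circ. f \<xi>) = 0" if "A \<in> sigma_sets UNIV {C. closed C}"
      for A
  proof (rule sigma_sets_induct_disjoint[OF _ _ that])
    show "Int_stable {C :: complex set. closed C}" by (auto simp: Int_stable_def)
    fix C :: "complex set" assume "C \<in> {C. closed C}"
    then have C: "closed C" by simp
    show "(LINT \<xi>:(C \<inter> sphere 0 1)|circ. f \<xi>) = 0"
    proof (cases "C = {}")
      case False
      \<comment> \<open>Piecewise linear cutoffs that decrease to the indicator of \<open>C\<close>.
        The empty set is split off because \<open>infdist\<close> to it is 0, which would make every
        cutoff equal to 1.\<close>
      define c where "c n \<xi> = max 0 (1 - real n * infdist \<xi> C)" for n \<xi>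
      have cc: "continuous_on (sphere 0 1) (c n)" for n unfolding c_def by (intro continuous_intros)
      have cm: "c n \<in> borel_measurable circ" for n by (rule borel_measurable_circle_continuous[OF
          cc])
      have c1: "\<bar>c n \<xi>\<bar> \<le> 1" for n \<xi> by (auto simp: c_def infdist_nonneg)
      have "(\<lambda>n. LINT \<xi>|circ. of_real (c n \<xi>) * f \<xi>) \<longlonglongrightarrow> (LINT \<xi>|circ. indicator (C \<inter> sphere 0 1) \<xi>
          *\<^sub>R f \<xi>)"
      proof (rule integral_dominated_convergence[where w="\<lambda>\<xi>. norm (f \<xi>)"])
        have "C \<inter> sphere 0 1 \<in> sets circ" using C by (auto simp: sets_circle sets_restrict_space)
        then show "(\<lambda>\<xi>. indicator (C \<inter> sphere 0 1) \<xi> *\<^sub>R f \<xi>) \<in> borel_measurable circ" using f by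
            measurable
        show "(\<lambda>\<xi>. of_real (c n \<xi>) * f \<xi>) \<in> borel_measurable circ" for n using f cm by measurable
        show "integrable circ (\<lambda>\<xi>. norm (f \<xi>))" using f by simp
        show "AE \<xi> in circ. norm (of_real (c n \<xi>) * f \<xi>) \<le> norm (f \<xi>)" for n
          using c1 by (intro AE_I2) (simp add: norm_mult mult_left_le_one_le)
        show "AE \<xi> in circ. (\<lambda>n. of_real (c n \<xi>) * f \<xi>) \<longlonglongrightarrow> indicator (C \<inter> sphere 0 1) \<xi> *\<^sub>R f \<xi>"
          using AE_circle_norm
        proof eventually_elim
          case (elim \<xi>)
          have "(\<lambda>n. c n \<xi>) \<longlonglongrightarrow> indicator (C \<inter> sphere 0 1) \<xi>"
          proof (cases "\<xi> \<in> C")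
            case True
            then show ?thesis using elim by (simp add: c_def)
          next
            case False
            then have d: "infdist \<xi> C > 0"
              using \<open>C \<noteq> {}\<close> C in_closed_iff_infdist_zero[of C \<xi>] infdist_nonneg[of \<xi> C] by (simp
                  add: less_le)
            obtain n0 where n0: "1 < real n0 * infdist \<xi> C" using reals_Archimedean3[OF d] by blast
            have "\<forall>\<^sub>F n in sequentially. c n \<xi> = 0"
              using eventually_ge_at_top[of n0]
            proof eventually_elim
              case (elim n)
              then have "real n0 * infdist \<xi> C \<le> real n * infdist \<xi> C" using d by (intro
                  mult_right_mono) auto
              then show ?case using n0 by (simp add: c_def)
            qed
            then show ?thesis using False by (simp add: tendsto_eventually)
          qed
          then show ?case unfolding scaleR_conv_of_real by (intro tendsto_intros)
        qed
      qed
      then show ?thesis using cont0[OF cc] by (simp add: set_lebesgue_integral_def LIMSEQ_const_iff)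
    qed (simp add: set_lebesgue_integral_def)
  next
    show "(LINT \<xi>:({} \<inter> sphere 0 1)|circ. f \<xi>) = 0" by (simp add: set_lebesgue_integral_def)
  next
    fix A :: "complex set" assume A: "A \<in> sigma_sets UNIV {C. closed C}" "(LINT \<xi>:(A \<inter> sphere 0
        1)|circ. f \<xi>) = 0"
    then have "A \<inter> sphere 0 1 \<in> sets circ" by (auto simp: sets_circle sets_restrict_space
        borel_eq_closed)
    then have i: "integrable circ (\<lambda>\<xi>. indicator (A \<inter> sphere 0 1) \<xi> *\<^sub>R f \<xi>)" using f by (rule
        integrable_mult_indicator)
    have "(LINT \<xi>:((UNIV - A) \<inter> sphere 0 1)|circ. f \<xi>) = (LINT \<xi>|circ. f \<xi> - indicator (A \<inter> sphere
        0 1) \<xi> *\<^sub>R f \<xi>)"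
      unfolding set_lebesgue_integral_def by (rule Bochner_Integration.integral_cong) (auto split:
          split_indicator)
    also have "\<dots> = 0" using A(2) z1[of 0] i f by (simp add: set_lebesgue_integral_def)
    finally show "(LINT \<xi>:((UNIV - A) \<inter> sphere 0 1)|circ. f \<xi>) = 0" .
  next
    fix A :: "nat \<Rightarrow> complex set"
    assume A: "disjoint_family A" "range A \<subseteq> sigma_sets UNIV {C. closed C}" "\<And>i. (LINT \<xi>:(A i \<inter>
        sphere 0 1)|circ. f \<xi>) = 0"
    have m: "A i \<inter> sphere 0 1 \<in> sets circ" for i
      using A(2) by (auto simp: sets_circle sets_restrict_space borel_eq_closed)
    have "(LINT \<xi>:(\<Union>i. A i \<inter> sphere 0 1)|circ. f \<xi>) = (\<Sum>i. (LINT \<xi>:(A i \<inter> sphere 0 1)|circ. f \<xi>))"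
    proof (rule lebesgue_integral_countable_add[OF m])
      show "(A i \<inter> sphere 0 1) \<inter> (A j \<inter> sphere 0 1) = {}" if "i \<noteq> j" for i j
        using A(1) that by (auto simp: disjoint_family_on_def)
      show "set_integrable circ (\<Union>i. A i \<inter> sphere 0 1) f"
        unfolding set_integrable_def by (rule integrable_mult_indicator[OF sets.countable_UN f])
            (use m in auto)
    qed
    then show "(LINT \<xi>:(\<Union> (range A) \<inter> sphere 0 1)|circ. f \<xi>) = 0" using A(3) by (simp add:
        UN_extend_simps del: UN_simps)
  qed auto
  show ?thesis
  proof (rule circle.density_zero[OF f])
    fix A assume "A \<in> sets circ"
    then obtain B where "B \<in> sets borel" "A = B \<inter> sphere 0 1" by (auto simp: sets_circle
        sets_restrict_space)
    then show "(LINT \<xi>:A|circ. f \<xi>) = 0" using borel0[of B] by (simp add: borel_eq_closed)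
  qed
qed

text \<open>Only indices \<open>n \<ge> 0\<close> are recorded; on \<open>hardy_H2\<close> the other
  coefficients vanish by definition.\<close>

definition fourier_coeff :: "(complex \<Rightarrow> complex) \<Rightarrow> nat \<Rightarrow> complex" where
  "fourier_coeff f n = (LINT \<xi>|circ. f \<xi> * cnj \<xi> ^ n)"

lemma fourier_coeff_inner: "fourier_coeff f n = L2_inner f (\<lambda>\<xi>. \<xi> ^ n)"
  by (simp add: fourier_coeff_def L2_inner_def)

lemma L2_inner_power_power: "L2_inner (\<lambda>\<xi>. \<xi> ^ i) (\<lambda>\<xi>. \<xi> ^ j) = (if i = j then 1 else 0)"
proof -
  have *: "L2_inner (\<lambda>\<xi>. \<xi> ^ (j + d)) (\<lambda>\<xi>. \<xi> ^ j) = (LINT \<xi>|circ. \<xi> ^ d)" for j d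
    unfolding L2_inner_def
  proof (rule Bochner_Integration.integral_cong[OF refl])
    fix \<xi> assume "\<xi> \<in> space circ"
    then have "\<xi> * cnj \<xi> = 1" by (simp add: complex_norm_square[symmetric])
    moreover have "\<xi> ^ (j + d) * cnj (\<xi> ^ j) = (\<xi> * cnj \<xi>) ^ j * \<xi> ^ d" by (simp add: power_add
        power_mult_distrib)
    ultimately show "\<xi> ^ (j + d) * cnj (\<xi> ^ j) = \<xi> ^ d" by simp
  qed
  show ?thesis
  proof (cases i j rule: linorder_cases)
    case equal
    then show ?thesis using *[of j 0] circle.prob_space by simp
  next
    case greater
    then show ?thesis using *[of j "i - j"] circle_integral_power[of "i - j"] by simp
  next
    case less
    then show ?thesis using *[of i "j - i"] circle_integral_power[of "j - i"] L2_inner_commute[of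
        "\<lambda>\<xi>. \<xi> ^ i" "\<lambda>\<xi>. \<xi> ^ j"] by simp
  qed
qed

text \<open>The index set is arbitrary so that partial sums and the blocks between two of them are
  treated alike.\<close>

definition fourier_sum :: "(nat \<Rightarrow> complex) \<Rightarrow> nat set \<Rightarrow> complex \<Rightarrow> complex" where
  "fourier_sum c J \<xi> = (\<Sum>j\<in>J. c j * \<xi> ^ j)"

lemma fourier_sum_H2: "fourier_sum c J \<in> hardy_H2"
proof -
  have "(\<lambda>\<xi>. \<Sum>j\<in>J. c j * \<xi> ^ j) \<in> hardy_H2"
    by (induction J rule: infinite_finite_induct)
       (auto intro!: L2_closed_subspace_zero[OF hardy_H2_closed_subspace]
           L2_closed_subspace_add[OF hardy_H2_closed_subspace]
          L2_closed_subspace_cmult[OF hardy_H2_closed_subspace] hardy_H2_power)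
  then show ?thesis by (simp add: fourier_sum_def[abs_def])
qed

lemma fourier_sum_L2: "fourier_sum c J \<in> circle_L2"
  by (rule hardy_H2_L2[OF fourier_sum_H2])

lemma fourier_sum_insert:
  "finite J \<Longrightarrow> j \<notin> J \<Longrightarrow> fourier_sum c (insert j J) = (\<lambda>\<xi>. fourier_sum c J \<xi> + c j * \<xi> ^ j)"
  by (simp add: fourier_sum_def fun_eq_iff)

lemma L2_inner_fourier_sum:
  "finite J \<Longrightarrow> L2_inner (fourier_sum c J) (\<lambda>\<xi>. \<xi> ^ n) = (if n \<in> J then c n else 0)"
proof (induction J rule: finite_induct)
  case empty
  then show ?case by (simp add: fourier_sum_def[abs_def] L2_inner_def)
next
  case (insert j J)
  then show ?case
    by (auto simp: fourier_sum_insert L2_inner_add_left fourier_sum_L2 circle_L2_cmult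
        circle_L2_power
        L2_inner_cmult_left L2_inner_power_power)
qed

lemma L2_norm_power_circle: "L2_norm (\<lambda>\<xi>. \<xi> ^ n) = 1"
proof -
  have "of_real ((L2_norm (\<lambda>\<xi>. \<xi> ^ n))\<^sup>2) = (1::complex)"
    unfolding L2_inner_self[symmetric] by (simp add: L2_inner_power_power)
  then have "(L2_norm (\<lambda>\<xi>. \<xi> ^ n))\<^sup>2 = 1" by (simp only: of_real_eq_1_iff)
  then show ?thesis using L2_norm_nonneg by (metis abs_of_nonneg power2_eq_1_iff real_sqrt_abs
      real_sqrt_one)
qed

lemma L2_norm_fourier_sum: "finite J \<Longrightarrow> (L2_norm (fourier_sum c J))\<^sup>2 = (\<Sum>j\<in>J. (norm (c j))\<^sup>2)"
proof (induction J rule: finite_induct)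
  case empty
  then show ?case by (simp add: fourier_sum_def[abs_def] L2_norm_def)
next
  case (insert j J)
  then show ?case
    by (simp add: fourier_sum_insert L2_norm_add_power2 fourier_sum_L2 circle_L2_cmult
        circle_L2_power
        L2_inner_cmult_right L2_inner_fourier_sum L2_norm_cmult L2_norm_power_circle)
qed

lemma bessel_identity:
  assumes f: "f \<in> circle_L2" and J: "finite J"
  shows "(L2_norm (\<lambda>\<xi>. f \<xi> - fourier_sum (fourier_coeff f) J \<xi>))\<^sup>2 = (L2_norm f)\<^sup>2 - (\<Sum>j\<in>J. (norm
      (fourier_coeff f j))\<^sup>2)"
  using J
proof (induction J rule: finite_induct)
  case empty
  then show ?case by (simp add: fourier_sum_def[abs_def])
next
  case (insert j J)
  let ?c = "fourier_coeff f" and ?g = "\<lambda>\<xi>. f \<xi> - fourier_sum (fourier_coeff f) J \<xi>"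
  have g: "?g \<in> circle_L2" by (intro circle_L2_diff f fourier_sum_L2)
  have "(\<lambda>\<xi>. f \<xi> - fourier_sum ?c (insert j J) \<xi>) = (\<lambda>\<xi>. ?g \<xi> + (- ?c j) * \<xi> ^ j)"
    using insert by (simp add: fourier_sum_insert fun_eq_iff)
  then have "(L2_norm (\<lambda>\<xi>. f \<xi> - fourier_sum ?c (insert j J) \<xi>))\<^sup>2 =
     (L2_norm ?g)\<^sup>2 + 2 * Re (L2_inner ?g (\<lambda>\<xi>. (- ?c j) * \<xi> ^ j)) + (L2_norm (\<lambda>\<xi>. (- ?c j) * \<xi> ^
         j))\<^sup>2"
    by (simp only: L2_norm_add_power2[OF g circle_L2_cmult[OF circle_L2_power]])
  also have "L2_inner ?g (\<lambda>\<xi>. (- ?c j) * \<xi> ^ j) = - of_real ((norm (?c j))\<^sup>2)"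
  proof -
    have "L2_inner ?g (\<lambda>\<xi>. \<xi> ^ j) = ?c j"
      using insert f by (simp add: L2_inner_diff_left fourier_sum_L2 circle_L2_power
          L2_inner_fourier_sum)
        (simp add: fourier_coeff_inner)
    then show ?thesis
      unfolding L2_inner_cmult_right by (simp add: complex_norm_square mult.commute del:
          of_real_power)
  qed
  also have "L2_norm (\<lambda>\<xi>. (- ?c j) * \<xi> ^ j) = norm (?c j)"
    unfolding L2_norm_cmult by (simp add: L2_norm_power_circle)
  finally show ?case using insert by simp
qed

lemma norm_fourier_coeff_le:
  assumes "f \<in> circle_L2" shows "norm (fourier_coeff f n) \<le> L2_norm f"
  using L2_Cauchy_Schwarz[OF assms circle_L2_power, of n] by (simp add: fourier_coeff_inner
      L2_norm_power_circle)

lemma summable_fourier_coeff: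
  assumes f: "f \<in> circle_L2" shows "summable (\<lambda>n. (norm (fourier_coeff f n))\<^sup>2)"
proof (rule summableI_nonneg_bounded[where x="(L2_norm f)\<^sup>2"])
  show "(\<Sum>i<n. (norm (fourier_coeff f i))\<^sup>2) \<le> (L2_norm f)\<^sup>2" for n
    using bessel_identity[OF f, of "{..<n}"] zero_le_power2[of "L2_norm (\<lambda>\<xi>. f \<xi> - fourier_sum
        (fourier_coeff f) {..<n} \<xi>)"]
    by simp
qed simp

lemma hardy_H2_AE_zero:
  assumes f: "f \<in> hardy_H2" and c: "\<And>n. fourier_coeff f n = 0"
  shows "AE \<xi> in circ. f \<xi> = 0"
proof (rule circle_uniqueness[OF circle_L2_imp_integrable[OF hardy_H2_L2[OF f]]])
  fix n
  show z: "(LINT \<xi>|circ. f \<xi> * cnj \<xi> ^ n) = 0" for n using c[of n] by (simp add: fourier_coeff_def)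
  show "(LINT \<xi>|circ. f \<xi> * \<xi> ^ n) = 0"
    using f z[of 0] by (cases n) (auto simp: hardy_H2_def)
qed

lemma fourier_coeff_diff:
  "f \<in> circle_L2 \<Longrightarrow> g \<in> circle_L2 \<Longrightarrow> fourier_coeff (\<lambda>\<xi>. f \<xi> - g \<xi>) n = fourier_coeff f n -
      fourier_coeff g n"
  by (simp add: fourier_coeff_inner L2_inner_diff_left circle_L2_power)

text \<open>The squared coefficients are summable, so the partial sums are Cauchy. Their limit
  \<open>g\<close> is in the Hardy space and has the coefficients of \<open>f\<close>; uniqueness of
  Fourier series identifies the two almost everywhere.\<close>

lemma fourier_sum_tendsto:
  assumes f: "f \<in> hardy_H2"
  shows "(\<lambda>N. L2_norm (\<lambda>\<xi>. fourier_sum (fourier_coeff f) {..<N} \<xi> - f \<xi>)) \<longlonglongrightarrow> 0"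
proof -
  note fL = hardy_H2_L2[OF f]
  define c where "c = fourier_coeff f"
  define s where "s N = fourier_sum c {..<N}" for N
  have sL: "s N \<in> circle_L2" for N unfolding s_def by (rule fourier_sum_L2)
  have diff: "(L2_norm (\<lambda>\<xi>. s M \<xi> - s N \<xi>))\<^sup>2 = (\<Sum>j\<in>{N..<M}. (norm (c j))\<^sup>2)" if "N \<le> M" for M N
  proof -
    have "(\<lambda>\<xi>. s M \<xi> - s N \<xi>) = fourier_sum c {N..<M}"
      using sum.atLeastLessThan_concat[of 0 N M "\<lambda>j. c j * _ ^ j"] that
      by (simp add: s_def fourier_sum_def fun_eq_iff lessThan_atLeast0 algebra_simps)
    then show ?thesis by (simp add: L2_norm_fourier_sum)
  qed
  have Cau: "\<exists>N. \<forall>m\<ge>N. \<forall>n\<ge>N. L2_norm (\<lambda>\<xi>. s m \<xi> - s n \<xi>) \<le> e" if e: "e > 0" for e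
  proof -
    have "e\<^sup>2 > 0" using e by simp
    with summable_fourier_coeff[OF fL] obtain N where N: "\<And>m n. m \<ge> N \<Longrightarrow> norm (\<Sum>j\<in>{m..<n}. (norm (c
        j))\<^sup>2) < e\<^sup>2"
      unfolding summable_Cauchy c_def by blast
    have *: "L2_norm (\<lambda>\<xi>. s m \<xi> - s n \<xi>) \<le> e" if "m \<ge> n" "n \<ge> N" for m n
    proof (rule power2_le_imp_le)
      show "(L2_norm (\<lambda>\<xi>. s m \<xi> - s n \<xi>))\<^sup>2 \<le> e\<^sup>2"
        unfolding diff[OF that(1)] using N[OF that(2), of m] by (simp add: sum_nonneg)
    qed (use e in simp)
    show ?thesis
    proof (intro exI allI impI)
      fix m n assume "m \<ge> N" "n \<ge> N"
      then show "L2_norm (\<lambda>\<xi>. s m \<xi> - s n \<xi>) \<le> e"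
        using *[of m n] *[of n m] L2_norm_diff_commute[of "s m" "s n"] by (cases "n \<le> m") auto
    qed
  qed
  obtain g where g: "g \<in> circle_L2" "(\<lambda>n. L2_norm (\<lambda>\<xi>. s n \<xi> - g \<xi>)) \<longlonglongrightarrow> 0"
    using L2_complete[OF sL Cau] by blast
  have gH: "g \<in> hardy_H2"
    by (rule L2_closed_subspace_limit[OF hardy_H2_closed_subspace _ g]) (simp add: s_def
        fourier_sum_H2)
  have gc: "fourier_coeff g n = c n" for n
  proof -
    have lim: "(\<lambda>N. LINT \<xi>|circ. s N \<xi> * cnj (\<xi> ^ n)) \<longlonglongrightarrow> (LINT \<xi>|circ. g \<xi> * cnj (\<xi> ^ n))"
      by (rule L2_integral_mult_tendsto[OF sL g circle_L2_cnj[OF circle_L2_power]])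
    have "\<forall>\<^sub>F N in sequentially. (LINT \<xi>|circ. s N \<xi> * cnj (\<xi> ^ n)) = c n"
      using eventually_gt_at_top[of n]
    proof eventually_elim
      case (elim N)
      then show ?case using L2_inner_fourier_sum[of "{..<N}" c n] by (simp add: s_def L2_inner_def)
    qed
    then have "(LINT \<xi>|circ. g \<xi> * cnj (\<xi> ^ n)) = c n"
      by (rule LIMSEQ_unique[OF lim tendsto_eventually])
    then show ?thesis by (simp add: fourier_coeff_def)
  qed
  have "AE \<xi> in circ. f \<xi> - g \<xi> = 0"
    by (rule hardy_H2_AE_zero[OF L2_closed_subspace_diff[OF hardy_H2_closed_subspace f gH]])
       (simp add: fourier_coeff_diff fL g gc c_def)
  then have "AE \<xi> in circ. norm (s n \<xi> - g \<xi>) = norm (s n \<xi> - f \<xi>)" for n by eventually_elim simp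
  moreover have "(\<lambda>\<xi>. s n \<xi> - g \<xi>) \<in> borel_measurable circ" "(\<lambda>\<xi>. s n \<xi> - f \<xi>) \<in> borel_measurable
      circ" for n
    using circle_L2_diff[OF sL g(1)] circle_L2_diff[OF sL fL] by measurable
  ultimately have "L2_norm (\<lambda>\<xi>. s n \<xi> - g \<xi>) = L2_norm (\<lambda>\<xi>. s n \<xi> - f \<xi>)" for n
    by (rule L2_norm_cong_AE)
  then show ?thesis using g(2) by (simp add: s_def c_def)
qed

lemma parseval:
  assumes f: "f \<in> hardy_H2"
  shows "(\<lambda>n. (norm (fourier_coeff f n))\<^sup>2) sums (L2_norm f)\<^sup>2"
proof -
  have "(\<lambda>N. (L2_norm (fourier_sum (fourier_coeff f) {..<N}))\<^sup>2) \<longlonglongrightarrow> (L2_norm f)\<^sup>2"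
    by (intro tendsto_intros L2_norm_tendsto_bounded fourier_sum_tendsto f fourier_sum_L2
        hardy_H2_L2)
  then show ?thesis by (simp add: L2_norm_fourier_sum sums_def)
qed

section \<open>Hardy space functions in the disc\<close>

text \<open>Termwise integration in the form needed for geometric expansions of Cauchy kernels and
  for Taylor series on smaller circles, where the coefficients are absolutely summable and the
  remaining factors have modulus at most 1.\<close>

lemma circle_integral_series:
  fixes g :: "complex \<Rightarrow> complex"
  assumes g: "integrable circ g" and p: "\<And>n. p n \<in> borel_measurable circ"
    and p1: "\<And>n \<xi>. norm \<xi> = 1 \<Longrightarrow> norm (p n \<xi>) \<le> 1" and a: "summable (\<lambda>n. norm (a n :: complex))"
  shows "(\<lambda>n. a n * (LINT \<xi>|circ. g \<xi> * p n \<xi>)) sums (LINT \<xi>|circ. g \<xi> * (\<Sum>n. a n * p n \<xi>))"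
proof -
  have le: "norm (g \<xi> * (a n * p n \<xi>)) \<le> norm (g \<xi>) * norm (a n)" if "norm \<xi> = 1" for n \<xi>
  proof -
    have "norm (a n) * norm (p n \<xi>) \<le> norm (a n)" by (rule mult_left_le[OF p1[OF that]]) simp
    from mult_left_mono[OF this norm_ge_zero[of "g \<xi>"]] show ?thesis by (simp add: norm_mult)
  qed
  have i1: "integrable circ (\<lambda>\<xi>. norm (g \<xi>) * norm (a n))" for n using g by simp
  have i: "integrable circ (\<lambda>\<xi>. g \<xi> * (a n * p n \<xi>))" for n
  proof (rule Bochner_Integration.integrable_bound[OF i1[of n]])
    show "(\<lambda>\<xi>. g \<xi> * (a n * p n \<xi>)) \<in> borel_measurable circ" using g p by measurable
    show "AE \<xi> in circ. norm (g \<xi> * (a n * p n \<xi>)) \<le> norm (norm (g \<xi>) * norm (a n))"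
      using AE_circle_norm by eventually_elim (use le in auto)
  qed
  have s: "summable (\<lambda>n. norm (g \<xi> * (a n * p n \<xi>)))" if "norm \<xi> = 1" for \<xi>
    by (rule summable_comparison_test'[OF summable_mult[OF a, of "norm (g \<xi>)"]]) (use le[OF that]
        in auto)
  have "(\<lambda>n. LINT \<xi>|circ. g \<xi> * (a n * p n \<xi>)) sums (LINT \<xi>|circ. (\<Sum>n. g \<xi> * (a n * p n \<xi>)))"
  proof (rule sums_integral[OF i])
    show "AE \<xi> in circ. summable (\<lambda>n. norm (g \<xi> * (a n * p n \<xi>)))"
      using AE_circle_norm by eventually_elim (rule s)
    show "summable (\<lambda>n. LINT \<xi>|circ. norm (g \<xi> * (a n * p n \<xi>)))"
    proof (rule summable_comparison_test')
      show "summable (\<lambda>n. (LINT \<xi>|circ. norm (g \<xi>)) * norm (a n))" by (rule summable_mult[OF a])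
      fix n
      have "(LINT \<xi>|circ. norm (g \<xi> * (a n * p n \<xi>))) \<le> (LINT \<xi>|circ. norm (g \<xi>) * norm (a n))"
        by (rule integral_mono) (use i i1 le in auto)
      then show "norm (LINT \<xi>|circ. norm (g \<xi> * (a n * p n \<xi>))) \<le> (LINT \<xi>|circ. norm (g \<xi>)) * norm
          (a n)"
        by simp
    qed
  qed
  moreover have "(LINT \<xi>|circ. g \<xi> * (a n * p n \<xi>)) = a n * (LINT \<xi>|circ. g \<xi> * p n \<xi>)" for n
    by (simp add: mult.left_commute)
  moreover have "(LINT \<xi>|circ. (\<Sum>n. g \<xi> * (a n * p n \<xi>))) = (LINT \<xi>|circ. g \<xi> * (\<Sum>n. a n * p n \<xi>))"
  proof (rule Bochner_Integration.integral_cong[OF refl])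
    fix \<xi> assume "\<xi> \<in> space circ"
    then have "norm \<xi> = 1" by simp
    have "norm (norm (a n * p n \<xi>)) \<le> norm (a n)" for n
      using mult_left_le[OF p1[OF \<open>norm \<xi> = 1\<close>, of n] norm_ge_zero[of "a n"]] by (simp add:
          norm_mult)
    then have "summable (\<lambda>n. norm (a n * p n \<xi>))" by (rule summable_comparison_test'[OF a])
    then show "(\<Sum>n. g \<xi> * (a n * p n \<xi>)) = g \<xi> * (\<Sum>n. a n * p n \<xi>)"
      by (rule suminf_mult[OF summable_norm_cancel])
  qed
  ultimately show ?thesis by simp
qed

text \<open>The holomorphic extension to the disc; for \<open>f\<close> in \<open>hardy_H2\<close>
  its dilates return \<open>f\<close> in the mean, see \<open>hardy_ext_boundary\<close>.\<close>

definition hardy_ext :: "(complex \<Rightarrow> complex) \<Rightarrow> complex \<Rightarrow> complex" where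
  "hardy_ext f z = (\<Sum>n. fourier_coeff f n * z ^ n)"

lemma hardy_ext_sums:
  assumes f: "f \<in> circle_L2" and z: "norm z < 1"
  shows "(\<lambda>n. fourier_coeff f n * z ^ n) sums hardy_ext f z"
  unfolding hardy_ext_def
proof (rule summable_sums, rule summable_norm_cancel, rule summable_comparison_test')
  show "summable (\<lambda>n. L2_norm f * norm z ^ n)" using z by (intro summable_mult summable_geometric)
      simp
  show "norm (norm (fourier_coeff f n * z ^ n)) \<le> L2_norm f * norm z ^ n" for n
    using norm_fourier_coeff_le[OF f, of n] by (simp add: norm_mult norm_power mult_right_mono)
qed

lemma hardy_ext_holomorphic:
  assumes f: "f \<in> circle_L2" shows "hardy_ext f holomorphic_on ball 0 1"
  by (rule power_series_holomorphic[where a="fourier_coeff f"]) (use hardy_ext_sums[OF f] in simp)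

lemma hardy_ext_Cauchy:
  assumes f: "integrable circ f" and z: "norm z < 1"
  shows "(\<lambda>n. fourier_coeff f n * z ^ n) sums (LINT \<xi>|circ. f \<xi> * (1 / (1 - z * cnj \<xi>)))"
proof -
  have "(\<lambda>n. z ^ n * (LINT \<xi>|circ. f \<xi> * cnj \<xi> ^ n)) sums (LINT \<xi>|circ. f \<xi> * (\<Sum>n. z ^ n * cnj \<xi> ^
      n))"
    by (rule circle_integral_series[OF f]) (use z in \<open>auto simp: norm_power intro!:
        summable_geometric\<close>)
  moreover have "(LINT \<xi>|circ. f \<xi> * (\<Sum>n. z ^ n * cnj \<xi> ^ n)) = (LINT \<xi>|circ. f \<xi> * (1 / (1 - z *
      cnj \<xi>)))"
  proof (rule Bochner_Integration.integral_cong[OF refl])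
    fix \<xi> assume "\<xi> \<in> space circ"
    then have "norm (z * cnj \<xi>) < 1" using z by (simp add: norm_mult)
    from suminf_geometric[OF this] show "f \<xi> * (\<Sum>n. z ^ n * cnj \<xi> ^ n) = f \<xi> * (1 / (1 - z * cnj
        \<xi>))"
      by (simp add: power_mult_distrib)
  qed
  ultimately show ?thesis by (simp add: fourier_coeff_def mult.commute)
qed

lemma hardy_ext_eq_Cauchy:
  assumes f: "f \<in> circle_L2" and z: "norm z < 1"
  shows "hardy_ext f z = (LINT \<xi>|circ. f \<xi> * (1 / (1 - z * cnj \<xi>)))"
  by (rule sums_unique2[OF hardy_ext_sums[OF f z] hardy_ext_Cauchy[OF circle_L2_imp_integrable[OF
      f] z]])

section \<open>Cauchy and Poisson kernels\<close>

lemma one_minus_nonzero: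
  fixes z \<xi> :: complex
  assumes "norm z < 1" "norm \<xi> = 1"
  shows "1 - z * cnj \<xi> \<noteq> 0" "1 - cnj z * \<xi> \<noteq> 0" "1 - \<xi> * cnj z \<noteq> 0"
proof -
  have "norm (z * cnj \<xi>) < 1" "norm (cnj z * \<xi>) < 1" "norm (\<xi> * cnj z) < 1" using assms by (auto
      simp: norm_mult)
  then show "1 - z * cnj \<xi> \<noteq> 0" "1 - cnj z * \<xi> \<noteq> 0" "1 - \<xi> * cnj z \<noteq> 0" by auto
qed

definition poisson_kernel :: "complex \<Rightarrow> complex \<Rightarrow> real" where
  "poisson_kernel z \<xi> = (1 - (norm z)\<^sup>2) / (norm (1 - \<xi> * cnj z))\<^sup>2"

text \<open>Beyond the Cauchy kernel, the Poisson kernel contains only positive powers of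
  \<open>\<xi>\<close>, which integrate to 0 against the Hardy space. There the Poisson and Cauchy
  integrals therefore agree.\<close>

lemma poisson_kernel_split:
  assumes "norm z < 1" "norm \<xi> = 1"
  shows "of_real (poisson_kernel z \<xi>) = 1 / (1 - z * cnj \<xi>) + cnj z * \<xi> * (1 / (1 - cnj z * \<xi>))"
proof -
  note nz = one_minus_nonzero[OF assms]
  have "\<xi> * cnj \<xi> = 1" using assms(2) by (simp add: mult_cnj_norm)
  then have "(1 - cnj z * \<xi>) + cnj z * \<xi> * (1 - z * cnj \<xi>) = 1 - z * cnj z"
    by (simp add: algebra_simps)
  then have "1 / (1 - z * cnj \<xi>) + cnj z * \<xi> * (1 / (1 - cnj z * \<xi>)) = (1 - z * cnj z) / ((1 - z *
      cnj \<xi>) * (1 - cnj z * \<xi>))"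
    using nz by (simp add: divide_simps)
  also have "(1 - z * cnj \<xi>) * (1 - cnj z * \<xi>) = of_real ((norm (1 - \<xi> * cnj z))\<^sup>2)"
    unfolding mult_cnj_norm[symmetric] by (simp add: algebra_simps)
  also have "z * cnj z = of_real ((norm z)\<^sup>2)" by (rule mult_cnj_norm)
  finally show ?thesis by (simp add: poisson_kernel_def)
qed

lemma poisson_kernel_nonneg: "norm z < 1 \<Longrightarrow> 0 \<le> poisson_kernel z \<xi>"
  by (simp add: poisson_kernel_def abs_square_le_1 power_le_one)

lemma borel_measurable_circle_kernel:
  assumes "norm z < 1"
  shows "(\<lambda>\<xi>. 1 / (1 - z * cnj \<xi>)) \<in> borel_measurable circ" "(\<lambda>\<xi>. 1 / (1 - cnj z * \<xi>)) \<in>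
      borel_measurable circ"
    "poisson_kernel z \<in> borel_measurable circ"
  unfolding poisson_kernel_def[abs_def]
  by (rule borel_measurable_circle_continuous; use one_minus_nonzero[OF assms] in \<open>auto intro!:
      continuous_intros\<close>)+

lemma norm_kernel_le:
  assumes "norm z < 1" "norm \<xi> = 1"
  shows "norm (1 / (1 - z * cnj \<xi>)) \<le> 1 / (1 - norm z)" "norm (1 / (1 - cnj z * \<xi>)) \<le> 1 / (1 -
      norm z)"
proof -
  have "1 - norm z \<le> norm (1 - z * cnj \<xi>)" "1 - norm z \<le> norm (1 - cnj z * \<xi>)"
    using norm_triangle_ineq2[of 1 "z * cnj \<xi>"] norm_triangle_ineq2[of 1 "cnj z * \<xi>"] assms(2) by
        (auto simp: norm_mult)
  then show "norm (1 / (1 - z * cnj \<xi>)) \<le> 1 / (1 - norm z)" "norm (1 / (1 - cnj z * \<xi>)) \<le> 1 / (1 -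
      norm z)"
    using assms by (auto simp: norm_divide intro!: divide_left_mono mult_pos_pos)
qed

text \<open>In the geometric expansion every term is a moment of \<open>f\<close> of index at least
  \<open>n\<close>. The case \<open>n = 1\<close> gives the Poisson formula, the general case puts
  the reproducing kernels into \<open>hardy_H2\<close>.\<close>

lemma hardy_H2_kernel_integral_zero:
  assumes f: "f \<in> hardy_H2" and z: "norm z < 1" and n: "n \<ge> 1"
  shows "(LINT \<xi>|circ. f \<xi> * \<xi> ^ n * (1 / (1 - cnj z * \<xi>))) = 0"
proof -
  have i: "integrable circ (\<lambda>\<xi>. f \<xi> * \<xi> ^ n)" by (intro circle_L2_integrable_mult hardy_H2_L2 f
      circle_L2_power)
  have "(\<lambda>j. cnj z ^ j * (LINT \<xi>|circ. f \<xi> * \<xi> ^ n * \<xi> ^ j)) sums (LINT \<xi>|circ. f \<xi> * \<xi> ^ n * (\<Sum>j.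
      cnj z ^ j * \<xi> ^ j))"
    by (rule circle_integral_series[OF i]) (use z in \<open>auto simp: norm_power intro!:
        summable_geometric\<close>)
  moreover have "(LINT \<xi>|circ. f \<xi> * \<xi> ^ n * \<xi> ^ j) = 0" for j
  proof -
    have "(LINT \<xi>|circ. f \<xi> * \<xi> ^ n * \<xi> ^ j) = (LINT \<xi>|circ. f \<xi> * \<xi> ^ (n + j))" by (simp add:
        power_add mult.assoc)
    then show ?thesis using f n by (simp add: hardy_H2_def)
  qed
  moreover have "(LINT \<xi>|circ. f \<xi> * \<xi> ^ n * (\<Sum>j. cnj z ^ j * \<xi> ^ j)) = (LINT \<xi>|circ. f \<xi> * \<xi> ^ n
      * (1 / (1 - cnj z * \<xi>)))"
  proof (rule Bochner_Integration.integral_cong[OF refl])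
    fix \<xi> assume "\<xi> \<in> space circ"
    then have "norm (cnj z * \<xi>) < 1" using z by (simp add: norm_mult)
    from suminf_geometric[OF this] show "f \<xi> * \<xi> ^ n * (\<Sum>j. cnj z ^ j * \<xi> ^ j) = f \<xi> * \<xi> ^ n * (1
        / (1 - cnj z * \<xi>))"
      by (simp add: power_mult_distrib)
  qed
  ultimately show ?thesis by (simp add: sums_iff)
qed

lemma integrable_mult_kernel:
  assumes f: "f \<in> circle_L2" and z: "norm z < 1"
  shows "(\<lambda>\<xi>. f \<xi> * (1 / (1 - z * cnj \<xi>))) \<in> circle_L2" "(\<lambda>\<xi>. f \<xi> * (1 / (1 - cnj z * \<xi>))) \<in>
      circle_L2"
proof -
  have "AE \<xi> in circ. norm (1 / (1 - z * cnj \<xi>)) \<le> 1 / (1 - norm z)" "AE \<xi> in circ. norm (1 / (1 -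
      cnj z * \<xi>)) \<le> 1 / (1 - norm z)"
    using norm_kernel_le[OF z] by (auto intro!: AE_I2)
  from circle_L2_mult_bounded[OF borel_measurable_circle_kernel(1)[OF z] this(1) f]
      circle_L2_mult_bounded[OF borel_measurable_circle_kernel(2)[OF z] this(2) f]
  show "(\<lambda>\<xi>. f \<xi> * (1 / (1 - z * cnj \<xi>))) \<in> circle_L2" "(\<lambda>\<xi>. f \<xi> * (1 / (1 - cnj z * \<xi>))) \<in>
      circle_L2"
    by (simp_all only: mult.commute)
qed

lemma hardy_ext_Poisson:
  assumes f: "f \<in> hardy_H2" and z: "norm z < 1"
  shows "integrable circ (\<lambda>\<xi>. f \<xi> * of_real (poisson_kernel z \<xi>))"
    "hardy_ext f z = (LINT \<xi>|circ. f \<xi> * of_real (poisson_kernel z \<xi>))"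
proof -
  note fL = hardy_H2_L2[OF f]
  have "AE \<xi> in circ. norm (\<xi> ^ 1) \<le> 1" using AE_circle_norm by eventually_elim simp
  from circle_L2_mult_bounded[OF _ this fL]
  have fx: "(\<lambda>\<xi>. f \<xi> * \<xi> ^ 1) \<in> circle_L2" by (simp add: mult.commute)
  have i1: "integrable circ (\<lambda>\<xi>. f \<xi> * (1 / (1 - z * cnj \<xi>)))"
    by (rule circle_L2_imp_integrable[OF integrable_mult_kernel(1)[OF fL z]])
  have i2: "integrable circ (\<lambda>\<xi>. cnj z * (f \<xi> * \<xi> ^ 1 * (1 / (1 - cnj z * \<xi>))))"
    by (intro integrable_mult_right circle_L2_imp_integrable integrable_mult_kernel(2)[OF fx z])
  have eq: "f \<xi> * of_real (poisson_kernel z \<xi>) = f \<xi> * (1 / (1 - z * cnj \<xi>)) + cnj z * (f \<xi> * \<xi> ^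
      1 * (1 / (1 - cnj z * \<xi>)))"
    if "\<xi> \<in> space circ" for \<xi>
    using that by (subst poisson_kernel_split[OF z]) (simp_all add: distrib_left mult.assoc
        mult.left_commute)
  show "integrable circ (\<lambda>\<xi>. f \<xi> * of_real (poisson_kernel z \<xi>))"
    using Bochner_Integration.integrable_add[OF i1 i2] by (subst
        Bochner_Integration.integrable_cong[OF refl eq]) auto
  have "(LINT \<xi>|circ. f \<xi> * of_real (poisson_kernel z \<xi>)) =
    (LINT \<xi>|circ. f \<xi> * (1 / (1 - z * cnj \<xi>))) + cnj z * (LINT \<xi>|circ. f \<xi> * \<xi> ^ 1 * (1 / (1 - cnj
        z * \<xi>)))"
    unfolding integral_mult_right_zero[symmetric]
    by (rule trans[OF Bochner_Integration.integral_cong[OF refl eq]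
        Bochner_Integration.integral_add[OF i1 i2]])
  then show "hardy_ext f z = (LINT \<xi>|circ. f \<xi> * of_real (poisson_kernel z \<xi>))"
    using hardy_H2_kernel_integral_zero[OF f z, of 1] hardy_ext_eq_Cauchy[OF fL z] by simp
qed

section \<open>Dilations and boundary values in the mean\<close>

lemma dilate_in_ball: "0 \<le> r \<Longrightarrow> r < 1 \<Longrightarrow> norm \<xi> = 1 \<Longrightarrow> norm (of_real r * \<xi>) < (1::real)" for \<xi> ::
    complex
  by (simp add: norm_mult)

lemma dilate_integral_sums:
  assumes F: "\<And>z. norm z < 1 \<Longrightarrow> (\<lambda>n. a n * z ^ n) sums F z" and r: "0 \<le> r" "r < 1" and g:
      "integrable circ g"
  shows "(\<lambda>n. a n * of_real r ^ n * (LINT \<xi>|circ. g \<xi> * \<xi> ^ n)) sums (LINT \<xi>|circ. g \<xi> * F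
      (of_real r * \<xi>))"
proof -
  have "summable (\<lambda>n. norm (a n * of_real r ^ n))"
  proof (rule powser_insidea)
    \<comment> \<open>A point strictly between \<open>r\<close> and 1: convergence there gives
      absolute convergence at \<open>r\<close>.\<close>
    have "norm (of_real ((1 + r) / 2) :: complex) < 1" unfolding norm_of_real using r by simp
    from sums_summable[OF F[OF this]] show "summable (\<lambda>n. a n * of_real ((1 + r) / 2) ^ n)" .
    show "norm (of_real r :: complex) < norm (of_real ((1 + r) / 2) :: complex)" using r by (simp
        only: norm_of_real) simp
  qed
  then have "(\<lambda>n. a n * of_real r ^ n * (LINT \<xi>|circ. g \<xi> * \<xi> ^ n)) sums (LINT \<xi>|circ. g \<xi> * (\<Sum>n.
      a n * of_real r ^ n * \<xi> ^ n))"
    by (intro circle_integral_series g) (auto simp: norm_power)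
  moreover have "(LINT \<xi>|circ. g \<xi> * (\<Sum>n. a n * of_real r ^ n * \<xi> ^ n)) = (LINT \<xi>|circ. g \<xi> * F
      (of_real r * \<xi>))"
    using F[OF dilate_in_ball[OF r]]
    by (intro Bochner_Integration.integral_cong) (auto simp: sums_iff power_mult_distrib mult.assoc)
  ultimately show ?thesis by simp
qed

lemma dilate_continuous:
  fixes F :: "complex \<Rightarrow> complex"
  assumes "continuous_on (ball 0 1) F" and r: "0 \<le> r" "r < 1"
  shows "continuous_on (sphere 0 1) (\<lambda>\<xi>. F (of_real r * \<xi>))"
  by (rule continuous_on_compose2[OF assms(1)]) (use r in \<open>auto intro!: continuous_intros simp:
      norm_mult\<close>)

lemma dilate_L2:
  assumes F: "continuous_on (ball 0 1) F" and r: "0 \<le> r" "r < 1"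
  shows "(\<lambda>\<xi>. F (of_real r * \<xi>)) \<in> circle_L2"
proof -
  note c = dilate_continuous[OF F r]
  obtain C where "\<forall>y\<in>(\<lambda>\<xi>. F (of_real r * \<xi>)) ` sphere 0 1. norm y \<le> C"
    using compact_imp_bounded[OF compact_continuous_image[OF c compact_sphere]] unfolding
        bounded_iff by blast
  then show ?thesis
    by (intro circle_L2_bounded[where C=C] borel_measurable_circle_continuous c AE_I2) auto
qed

lemma
  assumes F: "\<And>z. norm z < 1 \<Longrightarrow> (\<lambda>n. a n * z ^ n) sums F z" and r: "0 \<le> r" "r < 1"
  shows dilate_H2: "(\<lambda>\<xi>. F (of_real r * \<xi>)) \<in> hardy_H2"
    and fourier_coeff_dilate: "fourier_coeff (\<lambda>\<xi>. F (of_real r * \<xi>)) n = a n * of_real r ^ n"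
proof -
  have "F holomorphic_on ball 0 1" by (rule power_series_holomorphic[where a=a]) (use F in auto)
  then have cF: "continuous_on (ball 0 1) F" by (rule holomorphic_on_imp_continuous_on)
  have "(LINT \<xi>|circ. F (of_real r * \<xi>) * \<xi> ^ n) = 0" if "n \<ge> 1" for n
  proof -
    have "(\<lambda>j. a j * of_real r ^ j * (LINT \<xi>|circ. \<xi> ^ n * \<xi> ^ j)) sums (LINT \<xi>|circ. \<xi> ^ n * F
        (of_real r * \<xi>))"
      by (rule dilate_integral_sums[OF F r circle_L2_imp_integrable[OF circle_L2_power]])
    then have "(\<lambda>j. 0) sums (LINT \<xi>|circ. \<xi> ^ n * F (of_real r * \<xi>))"
      using that by (simp add: circle_integral_power flip: power_add)
    then show ?thesis by (simp add: sums_iff mult.commute)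
  qed
  then show "(\<lambda>\<xi>. F (of_real r * \<xi>)) \<in> hardy_H2" by (simp add: hardy_H2_def dilate_L2[OF cF r])
  have "(\<lambda>j. a j * of_real r ^ j * (LINT \<xi>|circ. cnj (\<xi> ^ n) * \<xi> ^ j)) sums (LINT \<xi>|circ. cnj (\<xi> ^
      n) * F (of_real r * \<xi>))"
    by (rule dilate_integral_sums[OF F r circle_L2_imp_integrable[OF circle_L2_cnj[OF
        circle_L2_power]]])
  moreover have "(LINT \<xi>|circ. cnj (\<xi> ^ n) * \<xi> ^ j) = (if j = n then 1 else 0)" for j
    using L2_inner_power_power[of j n] by (simp add: L2_inner_def mult.commute)
  ultimately have "(\<lambda>j. if j = n then a j * of_real r ^ j else 0) sums (LINT \<xi>|circ. cnj (\<xi> ^ n) *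
      F (of_real r * \<xi>))"
    by (simp add: if_distrib[of "\<lambda>x. _ * x"] cong: if_cong)
  from sums_unique2[OF this sums_single] show "fourier_coeff (\<lambda>\<xi>. F (of_real r * \<xi>)) n = a n *
      of_real r ^ n"
    by (simp add: fourier_coeff_def mult.commute)
qed

text \<open>One fixed sequence of radii tending to 1, so that dominated convergence and almost
  everywhere convergent subsequences apply.\<close>

definition radius :: "nat \<Rightarrow> real" where "radius k = 1 - inverse (real (Suc (Suc k)))"

lemma radius_bounds: "0 \<le> radius k" "radius k < 1"
  by (auto simp: radius_def field_simps)

lemma radius_tendsto: "radius \<longlonglongrightarrow> 1"
  unfolding radius_def by real_asymp

lemma filterlim_radius: "filterlim radius (at_left 1) sequentially"
  by (rule tendsto_imp_filterlim_at_left[OF radius_tendsto]) (simp add: radius_bounds)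

text \<open>Dilation multiplies the \<open>n\<close>-th coefficient by \<open>radius k ^ n\<close>,
  so by Parseval the squared distance is the sum of \<open>(1 - radius k ^ n)\<^sup>2\<close> times
  the squared moduli of the coefficients. Tannery's theorem sends it to 0.\<close>

lemma hardy_ext_boundary:
  assumes f: "f \<in> hardy_H2"
  shows "(\<lambda>k. L2_norm (\<lambda>\<xi>. hardy_ext f (of_real (radius k) * \<xi>) - f \<xi>)) \<longlonglongrightarrow> 0"
proof -
  note fL = hardy_H2_L2[OF f]
  let ?c = "fourier_coeff f"
  define h where "h k \<xi> = hardy_ext f (of_real (radius k) * \<xi>) - f \<xi>" for k \<xi>
  have H: "(\<lambda>\<xi>. hardy_ext f (of_real (radius k) * \<xi>)) \<in> hardy_H2" for k
    by (rule dilate_H2[OF hardy_ext_sums[OF fL] radius_bounds])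
  have Hc: "fourier_coeff (\<lambda>\<xi>. hardy_ext f (of_real (radius k) * \<xi>)) n = ?c n * of_real (radius k)
      ^ n" for k n
    by (rule fourier_coeff_dilate[OF hardy_ext_sums[OF fL] radius_bounds])
  have hH: "h k \<in> hardy_H2" for k
    unfolding h_def by (intro L2_closed_subspace_diff[OF hardy_H2_closed_subspace] H f)
  have hc: "fourier_coeff (h k) n = - (1 - of_real (radius k) ^ n) * ?c n" for k n
    unfolding h_def
    by (subst fourier_coeff_diff[OF hardy_H2_L2[OF H] fL], subst Hc) (simp add: algebra_simps)
  have sum: "(L2_norm (h k))\<^sup>2 = (\<Sum>n. (norm (fourier_coeff (h k) n))\<^sup>2)" for k
    using parseval[OF hH, of k] by (simp add: sums_iff)
  have "(\<lambda>k. \<Sum>n. (norm (fourier_coeff (h k) n))\<^sup>2) \<longlonglongrightarrow> (\<Sum>n. 0::real)"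
  proof (rule tannerys_theorem[where M="\<lambda>n. (norm (?c n))\<^sup>2", THEN conjunct2, THEN conjunct2])
    fix n
    have "(\<lambda>k. (norm (- (1 - of_real (radius k) ^ n) * ?c n))\<^sup>2) \<longlonglongrightarrow> (norm (- (1 - of_real 1 ^ n) *
        ?c n))\<^sup>2"
      by (intro tendsto_intros radius_tendsto)
    then show "(\<lambda>k. (norm (fourier_coeff (h k) n))\<^sup>2) \<longlonglongrightarrow> 0" by (simp add: hc)
  next
    have "(norm ((norm (fourier_coeff (h k) n))\<^sup>2)) \<le> (norm (?c n))\<^sup>2" for k n
    proof -
      have "norm (1 - of_real (radius k) ^ n :: complex) = norm (of_real (1 - radius k ^ n) ::
          complex)" by simp
      also have "\<dots> \<le> 1"
        unfolding norm_of_real using radius_bounds[of k] by (simp add: power_le_one)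
      finally have "norm (fourier_coeff (h k) n) \<le> 1 * norm (?c n)"
        unfolding hc norm_mult norm_minus_cancel by (rule mult_right_mono) simp
      then show ?thesis by simp
    qed
    then show "\<forall>\<^sub>F (n, k) in sequentially \<times>\<^sub>F sequentially. norm ((norm (fourier_coeff (h k)
        n))\<^sup>2) \<le> (norm (?c n))\<^sup>2"
      by (intro always_eventually) auto
  qed (simp_all add: summable_fourier_coeff[OF fL])
  then have "(\<lambda>k. (L2_norm (h k))\<^sup>2) \<longlonglongrightarrow> 0" by (simp add: sum)
  then have "(\<lambda>k. sqrt ((L2_norm (h k))\<^sup>2)) \<longlonglongrightarrow> sqrt 0" by (rule tendsto_real_sqrt)
  then show ?thesis by (simp add: h_def[abs_def])
qed

lemma hardy_ext_dilate_L2: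
  assumes "f \<in> circle_L2" shows "(\<lambda>\<xi>. hardy_ext f (of_real (radius k) * \<xi>)) \<in> circle_L2"
  by (rule hardy_H2_L2[OF dilate_H2[OF hardy_ext_sums[OF assms] radius_bounds]])

text \<open>Both claims are the Poisson formula for the constant function 1.\<close>

lemma poisson_kernel_integral:
  assumes z: "norm z < 1"
  shows "integrable circ (poisson_kernel z)" "(LINT \<xi>|circ. poisson_kernel z \<xi>) = 1"
proof -
  have one: "(\<lambda>\<xi>. 1) \<in> hardy_H2" using hardy_H2_power[of 0] by simp
  have c: "fourier_coeff (\<lambda>\<xi>. 1) n = (if n = 0 then 1 else 0)" for n
    using L2_inner_power_power[of 0 n] by (simp add: fourier_coeff_inner)
  have "hardy_ext (\<lambda>\<xi>. 1) z = 1"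
    using hardy_ext_sums[OF hardy_H2_L2[OF one] z] sums_single[of 0 "\<lambda>n. z ^ n"]
    by (simp add: c if_distrib[of "\<lambda>x. x * _"] sums_iff cong: if_cong)
  then have 1: "(LINT \<xi>|circ. complex_of_real (poisson_kernel z \<xi>)) = 1"
    using hardy_ext_Poisson(2)[OF one z] by simp
  have "integrable circ (\<lambda>\<xi>. complex_of_real (poisson_kernel z \<xi>))"
    using hardy_ext_Poisson(1)[OF one z] by simp
  then show i: "integrable circ (poisson_kernel z)" by (simp add: complex_of_real_integrable_eq)
  from 1 show "(LINT \<xi>|circ. poisson_kernel z \<xi>) = 1"
    by (simp only: integral_complex_of_real of_real_eq_1_iff)
qed

section \<open>Subharmonic functions\<close>

abbreviation wirtinger :: "(complex \<Rightarrow> complex) \<Rightarrow> (complex \<Rightarrow> complex) \<Rightarrow> (complex \<Rightarrow> complex) \<Rightarrow>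
    complex \<Rightarrow> bool" where
  "wirtinger X A B z \<equiv> (X has_derivative (\<lambda>h. A z * h + B z * cnj h)) (at z)"

text \<open>
  Second-order Wirtinger calculus: \<open>A\<close>, \<open>B\<close>, \<open>Z\<close> are the derivatives of \<open>X\<close> with respect to
  \<open>z\<close>, to the conjugate of \<open>z\<close>, and to both; \<open>Z\<close> is a quarter of the Laplacian.
\<close>

definition wirtinger2 :: "complex set \<Rightarrow> (complex \<Rightarrow> complex) \<Rightarrow> (complex \<Rightarrow> complex) \<Rightarrow>
    (complex \<Rightarrow> complex) \<Rightarrow> (complex \<Rightarrow> complex) \<Rightarrow> bool" where
  "wirtinger2 S X A B Z \<longleftrightarrow> (\<exists>Y W. continuous_on S Y \<and> continuous_on S Z \<and> continuous_on S W \<and>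
     (\<forall>z\<in>S. wirtinger X A B z \<and>
       wirtinger A Y Z z \<and>
       wirtinger B Z W z))"

lemma wirtinger2_continuous:
  assumes "wirtinger2 S X A B Z"
  shows "continuous_on S X" "continuous_on S A" "continuous_on S B" "continuous_on S Z"
proof -
  from assms obtain Y W where
    c: "continuous_on S Z" and
    d: "\<And>z. z \<in> S \<Longrightarrow> wirtinger X A B z"
      "\<And>z. z \<in> S \<Longrightarrow> wirtinger A Y Z z" "\<And>z. z \<in> S \<Longrightarrow> wirtinger B Z W z"
    unfolding wirtinger2_def by blast
  show "continuous_on S X" "continuous_on S A" "continuous_on S B" "continuous_on S Z"
    by (rule has_derivative_continuous_on[OF has_derivative_at_withinI[OF d(1)]]
        has_derivative_continuous_on[OF has_derivative_at_withinI[OF d(2)]]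
        has_derivative_continuous_on[OF has_derivative_at_withinI[OF d(3)]] c; assumption)+
qed

lemma wirtinger2I:
  assumes "\<And>z. z \<in> S \<Longrightarrow> wirtinger X A B z"
    and "\<And>z. z \<in> S \<Longrightarrow> wirtinger A Y Z z"
    and "\<And>z. z \<in> S \<Longrightarrow> wirtinger B Z W z"
    and "continuous_on S Y" "continuous_on S Z" "continuous_on S W"
  shows "wirtinger2 S X A B Z"
  using assms unfolding wirtinger2_def by blast

lemma wirtinger2_holomorphic:
  assumes "open S" "f holomorphic_on S"
  shows "wirtinger2 S f (deriv f) (\<lambda>_. 0) (\<lambda>_. 0)"
proof (rule wirtinger2I[where Y="deriv (deriv f)" and W="\<lambda>_. 0"])
  have h: "deriv f holomorphic_on S" "deriv (deriv f) holomorphic_on S"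
    using assms by (auto intro: holomorphic_deriv)
  show "continuous_on S (deriv (deriv f))" by (rule holomorphic_on_imp_continuous_on[OF h(2)])
  fix z assume z: "z \<in> S"
  show "(f has_derivative (\<lambda>h. deriv f z * h + 0 * cnj h)) (at z)"
    using holomorphic_derivI[OF assms(2,1) z] by (simp add: has_field_derivative_def)
  show "(deriv f has_derivative (\<lambda>h. deriv (deriv f) z * h + 0 * cnj h)) (at z)"
    using holomorphic_derivI[OF h(1) assms(1) z] by (simp add: has_field_derivative_def)
qed auto

lemma wirtinger2_const: "wirtinger2 S (\<lambda>_. c) (\<lambda>_. 0) (\<lambda>_. 0) (\<lambda>_. 0)"
  by (rule wirtinger2I[where Y="\<lambda>_. 0" and W="\<lambda>_. 0"]) auto

lemma wirtinger2_cnj: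
  assumes "wirtinger2 S X A B Z"
  shows "wirtinger2 S (\<lambda>z. cnj (X z)) (\<lambda>z. cnj (B z)) (\<lambda>z. cnj (A z)) (\<lambda>z. cnj (Z z))"
proof -
  from assms obtain Y W where
    c: "continuous_on S Y" "continuous_on S Z" "continuous_on S W" and
    d: "\<And>z. z \<in> S \<Longrightarrow> wirtinger X A B z"
      "\<And>z. z \<in> S \<Longrightarrow> wirtinger A Y Z z" "\<And>z. z \<in> S \<Longrightarrow> wirtinger B Z W z"
    unfolding wirtinger2_def by blast
  show ?thesis
    by (rule wirtinger2I[where Y="\<lambda>z. cnj (W z)" and W="\<lambda>z. cnj (Y z)"])
       (auto intro!: derivative_eq_intros d c continuous_intros simp: algebra_simps)
qed

lemma wirtinger2_add:
  assumes "wirtinger2 S X A B Z" "wirtinger2 S X' A' B' Z'"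
  shows "wirtinger2 S (\<lambda>z. X z + X' z) (\<lambda>z. A z + A' z) (\<lambda>z. B z + B' z) (\<lambda>z. Z z + Z' z)"
proof -
  from assms(1) obtain Y W where
    c: "continuous_on S Y" "continuous_on S Z" "continuous_on S W" and
    d: "\<And>z. z \<in> S \<Longrightarrow> wirtinger X A B z"
      "\<And>z. z \<in> S \<Longrightarrow> wirtinger A Y Z z" "\<And>z. z \<in> S \<Longrightarrow> wirtinger B Z W z"
    unfolding wirtinger2_def by blast
  from assms(2) obtain Y' W' where
    c': "continuous_on S Y'" "continuous_on S Z'" "continuous_on S W'" and
    d': "\<And>z. z \<in> S \<Longrightarrow> wirtinger X' A' B' z"
      "\<And>z. z \<in> S \<Longrightarrow> wirtinger A' Y' Z' z" "\<And>z. z \<in> S \<Longrightarrow> wirtinger B' Z' W' z"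
    unfolding wirtinger2_def by blast
  show ?thesis
    by (rule wirtinger2I[where Y="\<lambda>z. Y z + Y' z" and W="\<lambda>z. W z + W' z"])
       (auto intro!: derivative_eq_intros d c d' c' continuous_intros simp: algebra_simps)
qed

lemma wirtinger2_mult:
  assumes "wirtinger2 S X A B Z" "wirtinger2 S X' A' B' Z'"
  shows "wirtinger2 S (\<lambda>z. X z * X' z) (\<lambda>z. A z * X' z + X z * A' z) (\<lambda>z. B z * X' z + X z * B' z)
           (\<lambda>z. Z z * X' z + A z * B' z + B z * A' z + X z * Z' z)"
proof -
  note cc = wirtinger2_continuous[OF assms(1)] wirtinger2_continuous[OF assms(2)]
  from assms(1) obtain Y W where
    c: "continuous_on S Y" "continuous_on S Z" "continuous_on S W" and
    d: "\<And>z. z \<in> S \<Longrightarrow> wirtinger X A B z"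
      "\<And>z. z \<in> S \<Longrightarrow> wirtinger A Y Z z" "\<And>z. z \<in> S \<Longrightarrow> wirtinger B Z W z"
    unfolding wirtinger2_def by blast
  from assms(2) obtain Y' W' where
    c': "continuous_on S Y'" "continuous_on S Z'" "continuous_on S W'" and
    d': "\<And>z. z \<in> S \<Longrightarrow> wirtinger X' A' B' z"
      "\<And>z. z \<in> S \<Longrightarrow> wirtinger A' Y' Z' z" "\<And>z. z \<in> S \<Longrightarrow> wirtinger B' Z' W' z"
    unfolding wirtinger2_def by blast
  show ?thesis
    by (rule wirtinger2I[where Y="\<lambda>z. Y z * X' z + 2 * A z * A' z + X z * Y' z"
          and W="\<lambda>z. W z * X' z + 2 * B z * B' z + X z * W' z"])
       (auto intro!: derivative_eq_intros d c d' c' cc continuous_intros simp: algebra_simps)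
qed

lemma wirtinger2_exp:
  assumes "wirtinger2 S X A B Z"
  shows "wirtinger2 S (\<lambda>z. exp (X z)) (\<lambda>z. exp (X z) * A z) (\<lambda>z. exp (X z) * B z)
           (\<lambda>z. exp (X z) * (Z z + A z * B z))"
proof -
  note cc = wirtinger2_continuous[OF assms(1)]
  from assms(1) obtain Y W where
    c: "continuous_on S Y" "continuous_on S Z" "continuous_on S W" and
    d: "\<And>z. z \<in> S \<Longrightarrow> wirtinger X A B z"
      "\<And>z. z \<in> S \<Longrightarrow> wirtinger A Y Z z" "\<And>z. z \<in> S \<Longrightarrow> wirtinger B Z W z"
    unfolding wirtinger2_def by blast
  show ?thesis
  proof (rule wirtinger2I[where Y="\<lambda>z. exp (X z) * (Y z + A z * A z)"
          and W="\<lambda>z. exp (X z) * (W z + B z * B z)"])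
    fix z assume z: "z \<in> S"
    have e: "((\<lambda>z. exp (X z)) has_derivative (\<lambda>h. exp (X z) * (A z * h + B z * cnj h))) (at z)"
      by (rule has_derivative_compose[OF d(1)[OF z] DERIV_exp[THEN
          has_field_derivative_imp_has_derivative]])
    show "((\<lambda>z. exp (X z)) has_derivative (\<lambda>h. exp (X z) * A z * h + exp (X z) * B z * cnj h)) (at
        z)"
      by (rule has_derivative_eq_rhs[OF e]) (simp add: algebra_simps fun_eq_iff)
    show "((\<lambda>z. exp (X z) * A z) has_derivative (\<lambda>h. exp (X z) * (Y z + A z * A z) * h +
         exp (X z) * (Z z + A z * B z) * cnj h)) (at z)"
      by (rule has_derivative_eq_rhs[OF has_derivative_mult[OF e d(2)[OF z]]]) (simp add:
          algebra_simps fun_eq_iff)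
    show "((\<lambda>z. exp (X z) * B z) has_derivative (\<lambda>h. exp (X z) * (Z z + A z * B z) * h +
         exp (X z) * (W z + B z * B z) * cnj h)) (at z)"
      by (rule has_derivative_eq_rhs[OF has_derivative_mult[OF e d(3)[OF z]]]) (simp add:
          algebra_simps fun_eq_iff)
  qed (auto intro!: c cc continuous_intros)
qed

lemma has_derivative_power_Suc:
  fixes f :: "'a::real_normed_vector \<Rightarrow> 'b::real_normed_field"
  assumes "(f has_derivative f') (at x)"
  shows "((\<lambda>x. f x ^ Suc n) has_derivative (\<lambda>h. of_nat (Suc n) * f x ^ n * f' h)) (at x)"
  using has_derivative_power[OF assms, of "Suc n"] by (simp add: mult_ac)

text \<open>Writing the exponent as \<open>m + 2\<close> leaves a natural power after two
  differentiations without truncated subtraction.\<close>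

lemma wirtinger2_power:
  assumes "wirtinger2 S X A B Z"
  shows "wirtinger2 S (\<lambda>z. X z ^ Suc (Suc m)) (\<lambda>z. of_nat (Suc (Suc m)) * X z ^ Suc m * A z)
           (\<lambda>z. of_nat (Suc (Suc m)) * X z ^ Suc m * B z)
           (\<lambda>z. of_nat (Suc (Suc m)) * (X z ^ Suc m * Z z + of_nat (Suc m) * X z ^ m * A z * B z))"
proof -
  note cc = wirtinger2_continuous[OF assms(1)]
  from assms(1) obtain Y W where
    c: "continuous_on S Y" "continuous_on S Z" "continuous_on S W" and
    d: "\<And>z. z \<in> S \<Longrightarrow> wirtinger X A B z"
      "\<And>z. z \<in> S \<Longrightarrow> wirtinger A Y Z z" "\<And>z. z \<in> S \<Longrightarrow> wirtinger B Z W z"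
    unfolding wirtinger2_def by blast
  define M N :: complex where "M = of_nat (Suc (Suc m))" and "N = of_nat (Suc m)"
  note dp = has_derivative_power_Suc[OF d(1), of _ "Suc m", folded M_def]
    has_derivative_power_Suc[OF d(1), of _ m, folded N_def]
  show ?thesis
    unfolding M_def[symmetric] N_def[symmetric]
  proof (rule wirtinger2I[where
          Y="\<lambda>z. M * (X z ^ Suc m * Y z + N * X z ^ m * A z * A z)"
          and W="\<lambda>z. M * (X z ^ Suc m * W z + N * X z ^ m * B z * B z)"])
    fix z assume z: "z \<in> S"
    show "((\<lambda>z. X z ^ Suc (Suc m)) has_derivative (\<lambda>h. M * X z ^ Suc m * A z * h + M * X z ^ Suc m
        * B z * cnj h)) (at z)"
      by (rule has_derivative_eq_rhs[OF dp(1)[OF z]]) (simp add: algebra_simps fun_eq_iff)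
    show "((\<lambda>z. M * X z ^ Suc m * A z) has_derivative (\<lambda>h. M * (X z ^ Suc m * Y z + N * X z ^ m *
        A z * A z) * h +
         M * (X z ^ Suc m * Z z + N * X z ^ m * A z * B z) * cnj h)) (at z)"
      by (rule has_derivative_eq_rhs[OF has_derivative_mult[OF has_derivative_mult_right[OF
          dp(2)[OF z], of M] d(2)[OF z]]])
         (simp add: algebra_simps fun_eq_iff)
    show "((\<lambda>z. M * X z ^ Suc m * B z) has_derivative (\<lambda>h. M * (X z ^ Suc m * Z z + N * X z ^ m *
        A z * B z) * h +
         M * (X z ^ Suc m * W z + N * X z ^ m * B z * B z) * cnj h)) (at z)"
      by (rule has_derivative_eq_rhs[OF has_derivative_mult[OF has_derivative_mult_right[OF
          dp(2)[OF z], of M] d(3)[OF z]]])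
         (simp add: algebra_simps fun_eq_iff)
  qed (auto intro!: c cc continuous_intros)
qed

lemma wirtinger2_cong:
  assumes "wirtinger2 S X A B Z" "\<And>z. Z z = Z' z" "\<And>z. A z = A' z" "\<And>z. B z = B' z" "\<And>z. X z = X' z"
  shows "wirtinger2 S X' A' B' Z'"
proof -
  have "X = X'" "A = A'" "B = B'" "Z = Z'" using assms by auto
  then show ?thesis using assms(1) by simp
qed

text \<open>Let \<open>J s\<close> be the integral over the angle of \<open>Re X\<close> at radius
  \<open>s\<close>, and \<open>L s\<close> be \<open>s\<close> times its derivative. The derivative
  of \<open>L\<close> is \<open>s\<close> times the integral of the Laplacian, since the angular
  part integrates to 0 over a period. So \<open>L\<close> increases from \<open>L 0 = 0\<close>, and
  hence \<open>J\<close> increases.\<close>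

lemma circle_mean_subharmonic:
  assumes X: "wirtinger2 (ball 0 1) X A B Z"
    and nonneg: "\<And>z. norm z < 1 \<Longrightarrow> Re (Z z) \<ge> 0"
    and r: "0 \<le> r" "r < 1"
  shows "Re (X 0) \<le> (LINT \<xi>|circ. Re (X (of_real r * \<xi>)))"
proof -
  from X obtain Y W where
    c: "continuous_on (ball 0 1) Y" "continuous_on (ball 0 1) Z" "continuous_on (ball 0 1) W" and
    d: "\<And>z. z \<in> ball 0 1 \<Longrightarrow> wirtinger X A B z"
       "\<And>z. z \<in> ball 0 1 \<Longrightarrow> wirtinger A Y Z z"
       "\<And>z. z \<in> ball 0 1 \<Longrightarrow> wirtinger B Z W z"
    unfolding wirtinger2_def by blast
  note cX = wirtinger2_continuous[OF X]
  \<comment> \<open>\<open>P\<close>, \<open>Q\<close> and \<open>\<zeta>\<close> are twice the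
    first, the pure second and the mixed Wirtinger derivative of \<open>Re X\<close>.\<close>
  define P where "P z = A z + cnj (B z)" for z
  define Q where "Q z = Y z + cnj (W z)" for z
  define \<zeta> :: "complex \<Rightarrow> complex" where "\<zeta> z = of_real (2 * Re (Z z))" for z
  have cP: "continuous_on (ball 0 1) P" and cQ: "continuous_on (ball 0 1) Q" and c\<zeta>:
      "continuous_on (ball 0 1) \<zeta>"
    unfolding P_def Q_def \<zeta>_def by (intro continuous_intros c cX)+
  have dP: "(P has_derivative (\<lambda>h. Q z * h + \<zeta> z * cnj h)) (at z)" if "z \<in> ball 0 1" for z
    unfolding P_def
    by (auto intro!: derivative_eq_intros d that simp: Q_def \<zeta>_def algebra_simps fun_eq_iff
        complex_eq_iff)
  have dX: "((\<lambda>z. Re (X z)) has_derivative (\<lambda>h. Re (P z * h))) (at z)" if "z \<in> ball 0 1" for z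
    by (auto intro!: derivative_eq_intros d that simp: P_def algebra_simps fun_eq_iff)
  \<comment> \<open>A symmetric interval, so that the radius 0 is interior and derivatives there are
    two-sided.\<close>
  define U where "U = {-1<..<1::real}"
  define I where "I = {0..2*pi}"
  have in_ball: "of_real s * cis t \<in> ball 0 1" if "s \<in> U" for s t
    using that by (auto simp: U_def norm_mult)
  have oU: "open U" "convex U" by (auto simp: U_def)
  have cU: "continuous_on (U \<times> I) (\<lambda>x. F (of_real (fst x) * cis (snd x)))"
    if "continuous_on (ball 0 1) F" for F :: "complex \<Rightarrow> complex"
    by (rule continuous_on_compose2[OF that]) (use in_ball in \<open>auto intro!: continuous_intros\<close>)
  have cI: "continuous_on I (\<lambda>t. F (of_real s * cis t))"
    if "continuous_on (ball 0 1) F" "s \<in> U" for F :: "complex \<Rightarrow> complex" and s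
    by (rule continuous_on_compose2[OF that(1)]) (use in_ball that in \<open>auto intro!:
        continuous_intros\<close>)
  have dr: "((\<lambda>s. G (of_real s * cis t)) has_derivative (\<lambda>h. G' (of_real h * cis t))) (at s)"
    if "(G has_derivative G') (at (of_real s * cis t))" for G :: "complex \<Rightarrow>
        'b::real_normed_vector" and G' s t
  proof -
    have "((\<lambda>s. of_real s * cis t) has_derivative (\<lambda>h. of_real h * cis t)) (at s)"
      by (auto intro!: derivative_eq_intros)
    from has_derivative_compose[OF this, of G G'] that show ?thesis by simp
  qed
  have dt: "((\<lambda>t. G (of_real s * cis t)) has_derivative (\<lambda>h. G' (of_real (s * h) * \<i> * cis t)))
      (at t)"
    if "(G has_derivative G') (at (of_real s * cis t))" for G :: "complex \<Rightarrow>
        'b::real_normed_vector" and G' s t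
  proof -
    have "((\<lambda>t. of_real s * cis t) has_derivative (\<lambda>h. of_real (s * h) * \<i> * cis t)) (at t)"
      by (auto intro!: derivative_eq_intros simp: algebra_simps scaleR_conv_of_real)
    from has_derivative_compose[OF this, of G G'] that show ?thesis by simp
  qed
  define J where "J s = integral I (\<lambda>t. Re (X (of_real s * cis t)))" for s
  define J1 where "J1 s = integral I (\<lambda>t. Re (P (of_real s * cis t) * cis t))" for s
  define L where "L s = integral I (\<lambda>t. Re (P (of_real s * cis t) * (of_real s * cis t)))" for s
  define L1 where "L1 s = integral I (\<lambda>t. Re ((Q (of_real s * cis t) * cis t + \<zeta> (of_real s * cis
      t) * cnj (cis t)) * (of_real s * cis t) + P (of_real s * cis t) * cis t))" for s
  have dJ: "(J has_field_derivative J1 s) (at s)" if s: "s \<in> U" for s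
  proof -
    have "(J has_field_derivative J1 s) (at s within U)"
      unfolding J_def J1_def I_def cbox_interval[symmetric]
    proof (rule leibniz_rule_field_derivative[OF _ _ _ s oU(2)])
      fix x t assume x: "x \<in> U"
      show "((\<lambda>x. Re (X (of_real x * cis t))) has_field_derivative Re (P (of_real x * cis t) * cis
          t)) (at x within U)"
        unfolding has_field_derivative_def
        by (rule has_derivative_at_withinI[OF has_derivative_eq_rhs[OF dr[OF dX[OF in_ball[OF x]],
            of t]]])
           (simp add: algebra_simps fun_eq_iff)
      show "(\<lambda>t. Re (X (of_real x * cis t))) integrable_on cbox 0 (2*pi)"
        using cI[OF cX(1) x] by (auto simp: I_def intro!: integrable_continuous_interval
            continuous_intros)
    next
      show "continuous_on (U \<times> cbox 0 (2*pi)) (\<lambda>(x, t). Re (P (of_real x * cis t) * cis t))"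
        unfolding case_prod_beta using cU[OF cP] by (auto intro!: continuous_intros simp: I_def)
    qed
    then show ?thesis unfolding at_within_open[OF s oU(1)] .
  qed
  have dL: "(L has_field_derivative L1 s) (at s)" if s: "s \<in> U" for s
  proof -
    have "(L has_field_derivative L1 s) (at s within U)"
      unfolding L_def L1_def I_def cbox_interval[symmetric]
    proof (rule leibniz_rule_field_derivative[OF _ _ _ s oU(2)])
      fix x t assume x: "x \<in> U"
      show "((\<lambda>x. Re (P (of_real x * cis t) * (of_real x * cis t))) has_field_derivative
         Re ((Q (of_real x * cis t) * cis t + \<zeta> (of_real x * cis t) * cnj (cis t)) * (of_real x *
             cis t) + P (of_real x * cis t) * cis t)) (at x within U)"
        unfolding has_field_derivative_def
        by (rule has_derivative_at_withinI[OF has_derivative_eq_rhs[OF has_derivative_Re[OF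
              has_derivative_mult[OF dr[OF dP[OF in_ball[OF x]], of t] dr[of "\<lambda>z. z" "\<lambda>z. z", OF
                  has_derivative_ident]]]]])
           (simp add: algebra_simps fun_eq_iff)
      show "(\<lambda>t. Re (P (of_real x * cis t) * (of_real x * cis t))) integrable_on cbox 0 (2*pi)"
        using cI[OF cP x] by (auto simp: I_def intro!: integrable_continuous_interval
            continuous_intros)
    next
      show "continuous_on (U \<times> cbox 0 (2*pi)) (\<lambda>(x, t). Re ((Q (of_real x * cis t) * cis t + \<zeta>
          (of_real x * cis t) * cnj (cis t)) * (of_real x * cis t) + P (of_real x * cis t) * cis
          t))"
        unfolding case_prod_beta using cU[OF cP] cU[OF cQ] cU[OF c\<zeta>] by (auto intro!:
            continuous_intros simp: I_def)
    qed
    then show ?thesis unfolding at_within_open[OF s oU(1)] .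
  qed
  have L1_nonneg: "L1 s \<ge> 0" if s: "0 < s" "s < 1" for s
  proof -
    have sU: "s \<in> U" using s by (auto simp: U_def)
    \<comment> \<open>\<open>T\<close> is the angular derivative of \<open>Re X\<close> and
      \<open>T1\<close> that of \<open>T\<close>, so \<open>T1\<close> has integral 0 by
      periodicity.\<close>
    define T where "T t = Re (\<i> * P (of_real s * cis t) * (of_real s * cis t))" for t
    define T1 where "T1 t = Re (- (Q (of_real s * cis t) * (of_real s * cis t)^2) + \<zeta> (of_real s *
        cis t) * of_real (s^2)
        - P (of_real s * cis t) * (of_real s * cis t))" for t
    have "(T has_derivative (\<lambda>h. h * T1 t)) (at t)" for t
    proof -
      have 1: "cis t * cnj (cis t) = 1" by (simp add: complex_eq_iff flip: power2_eq_square)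
      have "(T has_derivative (\<lambda>h. Re (\<i> * ((Q (of_real s * cis t) * (of_real (s * h) * \<i> * cis t)
          + \<zeta> (of_real s * cis t) * cnj (of_real (s * h) * \<i> * cis t)) * (of_real s * cis t)
           + P (of_real s * cis t) * (of_real (s * h) * \<i> * cis t))))) (at t)"
        unfolding T_def
        by (rule has_derivative_eq_rhs[OF has_derivative_Re[OF has_derivative_mult[OF
              has_derivative_mult_right[OF dt[OF dP[OF in_ball[OF sU]]], of \<i>] dt[of "\<lambda>z. z" "\<lambda>z.
                  z", OF has_derivative_ident]]]])
           (simp add: algebra_simps fun_eq_iff)
      moreover have "Re (\<i> * ((Q (of_real s * cis t) * (of_real (s * h) * \<i> * cis t) + \<zeta> (of_real
          s * cis t) * cnj (of_real (s * h) * \<i> * cis t)) * (of_real s * cis t)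
           + P (of_real s * cis t) * (of_real (s * h) * \<i> * cis t))) = h * T1 t" for h
      proof -
        have "\<i> * ((Q (of_real s * cis t) * (of_real (s * h) * \<i> * cis t) + \<zeta> (of_real s * cis t)
            * cnj (of_real (s * h) * \<i> * cis t)) * (of_real s * cis t)
           + P (of_real s * cis t) * (of_real (s * h) * \<i> * cis t)) =
           of_real h * (- (Q (of_real s * cis t) * (of_real s * cis t)^2) + \<zeta> (of_real s * cis t)
               * of_real (s^2) * (cis t * cnj (cis t))
        - P (of_real s * cis t) * (of_real s * cis t))"
          by (simp add: algebra_simps power2_eq_square)
        moreover have "Re (of_real h * w) = h * Re w" for w by simp
        ultimately show ?thesis unfolding T1_def by (simp only: 1 mult_1_right)
      qed
      ultimately show ?thesis by simp
    qed
    then have "(T1 has_integral (T (2*pi) - T 0)) I"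
      unfolding I_def
      by (intro fundamental_theorem_of_calculus)
         (auto simp: has_vector_derivative_def intro: has_derivative_at_withinI)
    moreover have "T (2*pi) - T 0 = 0" by (simp add: T_def)
    ultimately have T1: "(T1 has_integral 0) I" by simp
    define \<eta> where "\<eta> t = Re (\<zeta> (of_real s * cis t))" for t
    have i\<eta>: "\<eta> integrable_on I"
      using cI[OF c\<zeta> sU] unfolding \<eta>_def by (auto simp: I_def intro!:
          integrable_continuous_interval continuous_intros)
    \<comment> \<open>Polar form of the Laplacian: \<open>s\<close> times the integrand of
      \<open>L1\<close> is \<open>s\<^sup>2\<close> times the Laplacian minus the second angular
      derivative \<open>T1\<close>, and the Laplacian of \<open>Re X\<close> is
      \<open>2 * \<eta> t\<close>.\<close>
    have "((\<lambda>t. 2 * s * \<eta> t - (1 / s) * T1 t) has_integral (2 * s * integral I \<eta> - (1/s) * 0)) I"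
      by (intro has_integral_diff has_integral_mult_right T1 integrable_integral i\<eta>)
    moreover have "2 * s * \<eta> t - (1 / s) * T1 t = Re ((Q (of_real s * cis t) * cis t + \<zeta> (of_real
        s * cis t) * cnj (cis t)) * (of_real s * cis t) + P (of_real s * cis t) * cis t)" for t
    proof -
      have 1: "cis t * cnj (cis t) = 1" by (simp add: complex_eq_iff flip: power2_eq_square)
      have "of_real s * ((Q (of_real s * cis t) * cis t + \<zeta> (of_real s * cis t) * cnj (cis t)) *
          (of_real s * cis t) + P (of_real s * cis t) * cis t)
        = 2 * of_real (s\<^sup>2) * \<zeta> (of_real s * cis t) - (- (Q (of_real s * cis t) * (of_real s * cis
            t)^2) + \<zeta> (of_real s * cis t) * of_real (s^2)
        - P (of_real s * cis t) * (of_real s * cis t)) + of_real (s\<^sup>2) * \<zeta> (of_real s * cis t) *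
            (cis t * cnj (cis t) - 1)"
        by (simp add: algebra_simps power2_eq_square)
      from arg_cong[OF this, of Re] have "s * Re ((Q (of_real s * cis t) * cis t + \<zeta> (of_real s *
          cis t) * cnj (cis t)) * (of_real s * cis t) + P (of_real s * cis t) * cis t)
        = 2 * s^2 * \<eta> t - T1 t"
        unfolding 1 T1_def \<eta>_def by (simp add: power2_eq_square)
      then show ?thesis using s by (simp add: field_simps power2_eq_square)
    qed
    ultimately have "L1 s = 2 * s * integral I \<eta>" unfolding L1_def by (simp add: integral_unique)
    moreover have "integral I \<eta> \<ge> 0"
      by (rule integral_nonneg[OF i\<eta>]) (use nonneg in_ball[OF sU] in \<open>auto simp: \<eta>_def \<zeta>_def\<close>)
    ultimately show ?thesis using s by simp
  qed
  have "L s \<ge> 0" if s: "0 \<le> s" "s < 1" for s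
  proof -
    have "L 0 \<le> L s"
    proof (rule DERIV_nonneg_imp_increasing_open[OF s(1)])
      fix x assume "0 < x" "x < s"
      then show "\<exists>y. DERIV L x :> y \<and> 0 \<le> y" using dL[of x] L1_nonneg[of x] s by (auto simp: U_def)
    next
      show "continuous_on {0..s} L"
        by (rule DERIV_continuous_on[where D=L1], rule has_field_derivative_at_within, rule dL)
           (use s in \<open>auto simp: U_def\<close>)
    qed
    then show ?thesis by (simp add: L_def)
  qed
  moreover have "L s = s * J1 s" for s
  proof -
    have "L s = integral I (\<lambda>t. s * Re (P (of_real s * cis t) * cis t))"
      unfolding L_def by (intro integral_cong) (simp add: algebra_simps)
    then show ?thesis by (simp add: J1_def)
  qed
  ultimately have "0 \<le> s * J1 s" if "0 < s" "s < 1" for s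
    using that by (metis less_imp_le)
  then have J1: "J1 s \<ge> 0" if "0 < s" "s < 1" for s
    using that by (meson less_le_not_le zero_le_mult_iff)
  have "J 0 \<le> J r"
  proof (rule DERIV_nonneg_imp_increasing_open[OF r(1)])
    fix x assume "0 < x" "x < r"
    then show "\<exists>y. DERIV J x :> y \<and> 0 \<le> y" using dJ[of x] J1[of x] r by (auto simp: U_def)
  next
    show "continuous_on {0..r} J"
      by (rule DERIV_continuous_on[where D=J1], rule has_field_derivative_at_within, rule dJ)
         (use r in \<open>auto simp: U_def\<close>)
  qed
  moreover have "J 0 = 2 * pi * Re (X 0)" by (simp add: J_def I_def)
  moreover have "(LINT \<xi>|circ. Re (X (of_real r * \<xi>))) = (1 / (2 * pi)) *\<^sub>R J r"
    unfolding J_def I_def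
    by (rule circle_integral_continuous)
       (intro continuous_intros continuous_on_compose2[OF cX(1)], use r in \<open>auto simp: norm_mult\<close>)
  ultimately show ?thesis
    using pi_gt_zero by (simp add: pos_le_divide_eq mult.commute[of "Re (X 0)"])
qed

text \<open>
  A smooth extension of the boundary function \<open>1 / w\<close> of the unit circle to the disc, equal to
  \<open>(1 - (1 - \<bar>w\<bar>\<^sup>2) ^ (m + 2)) / w\<close>; it fails to be holomorphic only to order
  \<open>(1 - \<bar>w\<bar>\<^sup>2) ^ (m + 1)\<close>.
\<close>

definition inverse_ext :: "nat \<Rightarrow> complex \<Rightarrow> complex" where
  "inverse_ext m w = cnj w * (\<Sum>j<m + 2. (1 - w * cnj w) ^ j)"

lemma inverse_ext_circle:
  assumes "norm w = 1" shows "inverse_ext m w = cnj w"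
proof -
  have "1 - w * cnj w = 0" using assms by (simp add: mult_cnj_norm)
  moreover have "(\<Sum>j<m + 2. (0::complex) ^ j) = 1" by (simp add: sum.lessThan_Suc_shift del:
      sum.lessThan_Suc)
  ultimately show ?thesis by (simp add: inverse_ext_def)
qed

text \<open>The bound may grow with \<open>m\<close>: it serves as a dominating constant when the
  radius tends to 1 with \<open>m\<close> fixed.\<close>

lemma norm_inverse_ext_le:
  assumes "norm w \<le> 1" shows "norm (inverse_ext m w) \<le> m + 2"
proof -
  have "1 - w * cnj w = of_real (1 - (norm w)\<^sup>2)" by (simp add: mult_cnj_norm)
  moreover have "0 \<le> 1 - (norm w)\<^sup>2" "1 - (norm w)\<^sup>2 \<le> 1" using assms by (auto simp: power_le_one)
  ultimately have q: "norm (1 - w * cnj w) \<le> 1" by (simp del: of_real_diff)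
  have "norm (inverse_ext m w) \<le> 1 * (\<Sum>j<m + 2. 1)"
    unfolding inverse_ext_def norm_mult
    by (intro mult_mono order_trans[OF norm_sum] sum_mono)
       (use assms q in \<open>auto simp: norm_power intro!: power_le_one\<close>)
  then show ?thesis by simp
qed

lemma continuous_inverse_ext: "continuous_on S (inverse_ext m)"
  unfolding inverse_ext_def by (intro continuous_intros)

text \<open>The induction adds one summand of the geometric sum at a time and so avoids the quotient
  by \<open>w\<close>, which may vanish. The derivative in \<open>z\<close> stays existential
  because it drops out of the mixed derivative of the product with a holomorphic function.\<close>

lemma wirtinger2_inverse_ext:
  assumes S: "open S" and \<Theta>: "\<Theta> holomorphic_on S"
  shows "\<exists>A. wirtinger2 S (\<lambda>z. inverse_ext m (\<Theta> z)) A
     (\<lambda>z. of_nat (m + 2) * (1 - \<Theta> z * cnj (\<Theta> z)) ^ (m + 1) * cnj (deriv \<Theta> z))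
     (\<lambda>z. - (of_nat (m + 2) * of_nat (m + 1) * (1 - \<Theta> z * cnj (\<Theta> z)) ^ m * cnj (\<Theta> z) * (deriv \<Theta> z
         * cnj (deriv \<Theta> z))))"
proof -
  note h = wirtinger2_holomorphic[OF S \<Theta>]
  note c = wirtinger2_cnj[OF h]
  have q: "wirtinger2 S (\<lambda>z. 1 - \<Theta> z * cnj (\<Theta> z)) (\<lambda>z. - (deriv \<Theta> z * cnj (\<Theta> z))) (\<lambda>z. - (\<Theta> z *
      cnj (deriv \<Theta> z)))
      (\<lambda>z. - (deriv \<Theta> z * cnj (deriv \<Theta> z)))"
    by (rule wirtinger2_cong[OF wirtinger2_add[OF wirtinger2_const[of S 1] wirtinger2_mult[OF
        wirtinger2_const[of S "-1"] wirtinger2_mult[OF h c]]]])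
       auto
  show ?thesis
  proof (induction m)
    case 0
    have eq: "inverse_ext 0 w = cnj w * (2 + - (w * cnj w))" for w by (simp add: inverse_ext_def
        numeral_2_eq_2)
    show ?case
      by (rule exI, rule wirtinger2_cong[OF wirtinger2_mult[OF c wirtinger2_add[OF
          wirtinger2_const[of S 1] q]]])
         (auto simp: eq algebra_simps)
  next
    case (Suc m)
    then obtain A where A: "wirtinger2 S (\<lambda>z. inverse_ext m (\<Theta> z)) A
     (\<lambda>z. of_nat (m + 2) * (1 - \<Theta> z * cnj (\<Theta> z)) ^ (m + 1) * cnj (deriv \<Theta> z))
     (\<lambda>z. - (of_nat (m + 2) * of_nat (m + 1) * (1 - \<Theta> z * cnj (\<Theta> z)) ^ m * cnj (\<Theta> z) * (deriv \<Theta> z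
         * cnj (deriv \<Theta> z))))"
      by blast
    have eq: "inverse_ext (Suc m) w = inverse_ext m w + cnj w * (1 - w * cnj w) ^ Suc (Suc m)" for w
      by (simp add: inverse_ext_def algebra_simps)
    define M :: complex where "M = of_nat m"
    have M: "of_nat (m + 2) = M + 2" "of_nat (m + 1) = M + 1" "of_nat (Suc (Suc m)) = M + 2"
        "of_nat (Suc m) = M + 1"
      "of_nat (Suc m + 2) = M + 3" "of_nat (Suc m + 1) = M + 2"
      by (auto simp: M_def)
    show ?case
    proof (rule exI, rule wirtinger2_cong[OF wirtinger2_add[OF A wirtinger2_mult[OF c
        wirtinger2_power[OF q, of m]]]])
      fix z
      define t d p where "t = \<Theta> z" and "d = deriv \<Theta> z" and "p = (1 - t * cnj t) ^ m"
      define s where "s = t * cnj t"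
      have p1: "(1 - t * cnj t) ^ (m + 1) = (1 - s) * p" "(1 - t * cnj t) ^ Suc m = (1 - s) * p"
        "(1 - t * cnj t) ^ Suc (Suc m) = (1 - s)^2 * p" "(1 - t * cnj t) ^ (Suc m + 1) = (1 - s)^2
            * p"
        by (auto simp: p_def s_def power2_eq_square)
      show "- (of_nat (m + 2) * of_nat (m + 1) * (1 - \<Theta> z * cnj (\<Theta> z)) ^ m * cnj (\<Theta> z) * (deriv \<Theta>
          z * cnj (deriv \<Theta> z))) +
         (cnj 0 * (1 - \<Theta> z * cnj (\<Theta> z)) ^ Suc (Suc m) +
          cnj 0 * (of_nat (Suc (Suc m)) * (1 - \<Theta> z * cnj (\<Theta> z)) ^ Suc m * - (\<Theta> z * cnj (deriv \<Theta>
              z))) +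
          cnj (deriv \<Theta> z) * (of_nat (Suc (Suc m)) * (1 - \<Theta> z * cnj (\<Theta> z)) ^ Suc m * - (deriv \<Theta> z *
              cnj (\<Theta> z))) +
          cnj (\<Theta> z) *
          (of_nat (Suc (Suc m)) *
           ((1 - \<Theta> z * cnj (\<Theta> z)) ^ Suc m * - (deriv \<Theta> z * cnj (deriv \<Theta> z)) +
            of_nat (Suc m) * (1 - \<Theta> z * cnj (\<Theta> z)) ^ m * - (deriv \<Theta> z * cnj (\<Theta> z)) * - (\<Theta> z * cnj
                (deriv \<Theta> z))))) =
         - (of_nat (Suc m + 2) * of_nat (Suc m + 1) * (1 - \<Theta> z * cnj (\<Theta> z)) ^ Suc m * cnj (\<Theta> z) *
             (deriv \<Theta> z * cnj (deriv \<Theta> z)))"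
        unfolding M t_def[symmetric] d_def[symmetric] p1 p_def[symmetric] s_def
        by (simp add: algebra_simps)
      show "of_nat (m + 2) * (1 - \<Theta> z * cnj (\<Theta> z)) ^ (m + 1) * cnj (deriv \<Theta> z) +
         (cnj (deriv \<Theta> z) * (1 - \<Theta> z * cnj (\<Theta> z)) ^ Suc (Suc m) +
          cnj (\<Theta> z) * (of_nat (Suc (Suc m)) * (1 - \<Theta> z * cnj (\<Theta> z)) ^ Suc m * - (\<Theta> z * cnj (deriv
              \<Theta> z)))) =
         of_nat (Suc m + 2) * (1 - \<Theta> z * cnj (\<Theta> z)) ^ (Suc m + 1) * cnj (deriv \<Theta> z)"
        unfolding M t_def[symmetric] d_def[symmetric] p1 p_def[symmetric] s_def
        by (simp add: algebra_simps power2_eq_square)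
    qed (auto simp: eq)
  qed
qed

text \<open>Completing the square: since the first derivatives of \<open>V\<close> are conjugate to
  each other, as for real \<open>V\<close>, the first-order terms combine into the squared modulus
  of the twisted derivative \<open>deriv f z + A z * f z\<close>. This square later absorbs
  \<open>deriv f z\<close>.\<close>

lemma wirtinger2_weighted_norm:
  assumes S: "open S" and f: "f holomorphic_on S" and V: "wirtinger2 S V A (\<lambda>z. cnj (A z)) Z"
  shows "\<exists>B C. wirtinger2 S (\<lambda>z. exp (V z) * (f z * cnj (f z))) B C
    (\<lambda>z. exp (V z) * (Z z * (f z * cnj (f z)) + (deriv f z + A z * f z) * cnj (deriv f z + A z * f
        z)))"
proof -
  note h = wirtinger2_holomorphic[OF S f]
  note c = wirtinger2_cnj[OF h]
  show ?thesis
    by (intro exI, rule wirtinger2_cong[OF wirtinger2_mult[OF wirtinger2_exp[OF V]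
        wirtinger2_mult[OF h c]]])
       (auto simp: algebra_simps)
qed

text \<open>In the application \<open>F\<close>, \<open>K\<close> are the moduli of
  \<open>f\<close>, \<open>k\<close>; \<open>t\<close>, \<open>a\<close> those of the derivatives of
  \<open>\<Theta>\<close>, \<open>w\<close>; \<open>p\<close>, \<open>R\<close> those of the twisted
  derivatives of \<open>f\<close>, \<open>k\<close>; \<open>E\<close>, \<open>S\<close> are the
  weights and \<open>e\<close> is \<open>exp (N * Re (w z))\<close>. The left side bounds the mixed
  derivative of the cross term, the right side is that of the weighted squares. Each product on the
  left pairs a quantity attached to \<open>f\<close>, scaled by \<open>e\<close>, with one attached
  to \<open>k\<close>, and is split by the arithmetic-geometric mean inequality.\<close>

lemma absorption_inequality:
  fixes \<tau> e E S a t F K p R b1 b2 N :: real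
  assumes nn: "0 \<le> \<tau>" "1 \<le> e" "0 \<le> a" "0 \<le> t" "0 \<le> F" "0 \<le> K" "0 \<le> p" "0 \<le> R" "0 \<le> N" "0 \<le> b1"
    and E: "e\<^sup>2 \<le> E" and S: "1 \<le> S"
    and b: "b2 \<le> \<tau> * e" "b1 * (N + 1) \<le> \<tau> * e"
  shows "b2 * (t\<^sup>2 * (F * K)) + b1 * (t * ((p + (N + 1) * a * F + t * F) * K + F * (R + t * K)))
    \<le> 3 * \<tau> * (E * ((a\<^sup>2 / 2 + t\<^sup>2) * F\<^sup>2 + p\<^sup>2) + S * (t\<^sup>2 * K\<^sup>2 + R\<^sup>2))"
proof -
  have b1: "b1 \<le> \<tau> * e"
  proof -
    have "b1 * 1 \<le> b1 * (N + 1)" by (rule mult_left_mono) (use nn in auto)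
    with b show ?thesis by simp
  qed
  have "b1 * (t * ((p + (N + 1) * a * F + t * F) * K + F * (R + t * K)))
      = b1 * (t * (p * K + t * F * K + F * (R + t * K))) + (b1 * (N + 1)) * (a * t * F * K)"
    by (simp add: algebra_simps)
  also have "\<dots> \<le> (\<tau> * e) * (t * (p * K + t * F * K + F * (R + t * K))) + (\<tau> * e) * (a * t * F * K)"
    by (intro add_mono mult_right_mono b1 b) (use nn in auto)
  moreover have "b2 * (t\<^sup>2 * (F * K)) \<le> (\<tau> * e) * (t\<^sup>2 * (F * K))"
    by (intro mult_right_mono b) (use nn in auto)
  ultimately have 1: "b2 * (t\<^sup>2 * (F * K)) + b1 * (t * ((p + (N + 1) * a * F + t * F) * K + F * (R
      + t * K)))
     \<le> \<tau> * (t * (e * p) * K + a * (t * K) * (e * F) + 3 * (t * (e * F)) * (t * K) + t * (e * F) *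
         R)"
    by (simp add: algebra_simps power2_eq_square)
  define P where "P = e * p"
  define G where "G = e * F"
  define Q where "Q = t * G"
  define T where "T = t * K"
  define H where "H = a * G"
  have sq: "x * y \<le> x\<^sup>2 / 2 + y\<^sup>2 / 2" for x y :: real
    using sum_squares_bound[of x y] by simp
  have "t * P * K + a * T * G + 3 * Q * T + Q * R = P * T + H * T + 3 * (Q * T) + Q * R"
    by (simp add: T_def H_def algebra_simps)
  also have "\<dots> \<le> 3 * ((H\<^sup>2 / 2 + Q\<^sup>2) + P\<^sup>2 + (T\<^sup>2 + R\<^sup>2))"
  proof -
    \<comment> \<open>The square \<open>T\<^sup>2\<close> collects the largest coefficient,
      \<open>1/2 + 1/2 + 3/2 = 5/2\<close>, whence the factor 3.\<close>
    have "x1 + x2 + 3 * x3 + x4 \<le> 3 * ((h / 2 + q) + p + (t + r))"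
      if "x1 \<le> p / 2 + t / 2" "x2 \<le> h / 2 + t / 2" "x3 \<le> q / 2 + t / 2" "x4 \<le> q / 2 + r / 2"
        "0 \<le> p" "0 \<le> h" "0 \<le> q" "0 \<le> t" "0 \<le> r" for x1 x2 x3 x4 p h q t r :: real
      using that by (simp add: field_simps)
    from this[OF sq sq sq sq] show ?thesis by simp
  qed
  also have "H\<^sup>2 / 2 + Q\<^sup>2 + P\<^sup>2 = e\<^sup>2 * ((a\<^sup>2 / 2 + t\<^sup>2) * F\<^sup>2 + p\<^sup>2)"
    by (simp add: H_def Q_def P_def G_def algebra_simps power2_eq_square)
  also have "T\<^sup>2 + R\<^sup>2 = 1 * (t\<^sup>2 * K\<^sup>2 + R\<^sup>2)" by (simp add: T_def power_mult_distrib)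
  also have "3 * (e\<^sup>2 * ((a\<^sup>2 / 2 + t\<^sup>2) * F\<^sup>2 + p\<^sup>2) + 1 * (t\<^sup>2 * K\<^sup>2 + R\<^sup>2))
      \<le> 3 * (E * ((a\<^sup>2 / 2 + t\<^sup>2) * F\<^sup>2 + p\<^sup>2) + S * (t\<^sup>2 * K\<^sup>2 + R\<^sup>2))"
    by (intro mult_left_mono add_mono mult_right_mono E S) auto
  finally have "t * (e * p) * K + a * (t * K) * (e * F) + 3 * (t * (e * F)) * (t * K) + t * (e *
      F) * R
     \<le> 3 * (E * ((a\<^sup>2 / 2 + t\<^sup>2) * F\<^sup>2 + p\<^sup>2) + S * (t\<^sup>2 * K\<^sup>2 + R\<^sup>2))"
    by (simp add: P_def G_def Q_def T_def)
  from mult_left_mono[OF this nn(1)] 1 show ?thesis by (simp add: mult_ac)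
qed

text \<open>The two smallness hypotheses compare the conjugate and the mixed derivative of
  \<open>inverse_ext\<close> with \<open>exp (N * Re (w z))\<close>, the geometric mean of the
  factors \<open>exp (2 * N * Re (w z))\<close> and 1 in the weights of \<open>f\<close> and
  \<open>k\<close>. The factor \<open>N + 1\<close> in the first one pays for the derivative of the
  weight, which is of size \<open>N + 1\<close> times that of \<open>w\<close>.\<close>

lemma circle_mean_estimate:
  fixes f k \<Theta> w :: "complex \<Rightarrow> complex" and m :: nat and N \<tau> r :: real
  assumes hol: "f holomorphic_on ball 0 1" "k holomorphic_on ball 0 1" "\<Theta> holomorphic_on ball 0 1"
      "w holomorphic_on ball 0 1"
    and k0: "k 0 = 0"
    and \<Theta>1: "\<And>z. norm z < 1 \<Longrightarrow> norm (\<Theta> z) \<le> 1"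
    and w01: "\<And>z. norm z < 1 \<Longrightarrow> 0 \<le> Re (w z)" "\<And>z. norm z < 1 \<Longrightarrow> Re (w z) \<le> 1"
    and N: "0 \<le> N" and \<tau>: "0 \<le> \<tau>" and r: "0 \<le> r" "r < 1"
    and small1: "\<And>z. norm z < 1 \<Longrightarrow>
       real (m + 2) * (1 - (norm (\<Theta> z))\<^sup>2) ^ (m + 1) * (N + 1) \<le> \<tau> * exp (N * Re (w z))"
    and small2: "\<And>z. norm z < 1 \<Longrightarrow>
       real (m + 2) * real (m + 1) * (1 - (norm (\<Theta> z))\<^sup>2) ^ m \<le> \<tau> * exp (N * Re (w z))"
  shows "0 \<le> (LINT \<xi>|circ. (let z = of_real r * \<xi> in
     3 * \<tau> * (exp (2 * N * Re (w z) + (Re (w z))\<^sup>2 + (norm (\<Theta> z))\<^sup>2) * (norm (f z))\<^sup>2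
               + exp ((norm (\<Theta> z))\<^sup>2) * (norm (k z))\<^sup>2)
       - Re (inverse_ext m (\<Theta> z) * (f z * k z))))"
proof -
  let ?D = "ball 0 1 :: complex set"
  have o: "open ?D" by simp
  note hf = wirtinger2_holomorphic[OF o hol(1)] and hk = wirtinger2_holomorphic[OF o hol(2)]
    and h\<Theta> = wirtinger2_holomorphic[OF o hol(3)] and hw = wirtinger2_holomorphic[OF o hol(4)]
  \<comment> \<open>\<open>u\<close> is the real part of \<open>w\<close>, kept complex-valued for
    the calculus, and \<open>a\<close> is its derivative in \<open>z\<close>.\<close>
  define u where "u z = (w z + cnj (w z)) * (1/2)" for z
  define a where "a z = deriv w z * (1/2)" for z
  define t where "t z = deriv \<Theta> z" for z
  have uR: "u z = of_real (Re (w z))" for z by (simp add: u_def complex_eq_iff)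
  have wu: "wirtinger2 ?D u a (\<lambda>z. cnj (a z)) (\<lambda>_. 0)"
    unfolding u_def
    by (rule wirtinger2_cong[OF wirtinger2_mult[OF wirtinger2_add[OF hw wirtinger2_cnj[OF hw]]
        wirtinger2_const[of _ "1/2"]]])
       (auto simp: a_def)
  define S where "S z = \<Theta> z * cnj (\<Theta> z)" for z
  have wS: "wirtinger2 ?D S (\<lambda>z. cnj (\<Theta> z) * t z) (\<lambda>z. cnj (cnj (\<Theta> z) * t z)) (\<lambda>z. t z * cnj (t z))"
    unfolding S_def
    by (rule wirtinger2_cong[OF wirtinger2_mult[OF h\<Theta> wirtinger2_cnj[OF h\<Theta>]]]) (auto simp: t_def)
  \<comment> \<open>The summand \<open>2 * N * u\<close> is harmonic and sets the size of the
    weight. The mixed derivatives \<open>2 * a * cnj a\<close> of \<open>u\<^sup>2\<close> and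
    \<open>t * cnj t\<close> of \<open>S\<close> are the positive terms available for
    absorption.\<close>
  define V where "V z = (of_real (2 * N) * u z + u z * u z) + S z" for z
  define A where "A z = of_real (2 * N) * a z + 2 * (u z * a z) + cnj (\<Theta> z) * t z" for z
  have wV: "wirtinger2 ?D V A (\<lambda>z. cnj (A z)) (\<lambda>z. 2 * (a z * cnj (a z)) + t z * cnj (t z))"
    unfolding V_def
    by (rule wirtinger2_cong[OF wirtinger2_add[OF wirtinger2_add[OF wirtinger2_mult[OF
        wirtinger2_const[of _ "of_real (2 * N)"] wu] wirtinger2_mult[OF wu wu]] wS]])
       (auto simp: A_def uR)
  obtain B1 C1 where X1: "wirtinger2 ?D (\<lambda>z. exp (V z) * (f z * cnj (f z))) B1 C1
    (\<lambda>z. exp (V z) * ((2 * (a z * cnj (a z)) + t z * cnj (t z)) * (f z * cnj (f z)) + (deriv f z +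
        A z * f z) * cnj (deriv f z + A z * f z)))"
    using wirtinger2_weighted_norm[OF o hol(1) wV] by blast
  obtain B2 C2 where X2: "wirtinger2 ?D (\<lambda>z. exp (S z) * (k z * cnj (k z))) B2 C2
    (\<lambda>z. exp (S z) * ((t z * cnj (t z)) * (k z * cnj (k z)) + (deriv k z + (cnj (\<Theta> z) * t z) * k
        z) * cnj (deriv k z + (cnj (\<Theta> z) * t z) * k z)))"
    using wirtinger2_weighted_norm[OF o hol(2) wS] by blast
  obtain B3 where X3: "wirtinger2 ?D (\<lambda>z. inverse_ext m (\<Theta> z)) B3
     (\<lambda>z. of_nat (m + 2) * (1 - \<Theta> z * cnj (\<Theta> z)) ^ (m + 1) * cnj (deriv \<Theta> z))
     (\<lambda>z. - (of_nat (m + 2) * of_nat (m + 1) * (1 - \<Theta> z * cnj (\<Theta> z)) ^ m * cnj (\<Theta> z) * (deriv \<Theta> z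
         * cnj (deriv \<Theta> z))))"
    using wirtinger2_inverse_ext[OF o hol(3)] by blast
  define b1 where "b1 z = real (m + 2) * (1 - (norm (\<Theta> z))\<^sup>2) ^ (m + 1)" for z
  define b2 where "b2 z = real (m + 2) * real (m + 1) * (1 - (norm (\<Theta> z))\<^sup>2) ^ m" for z
  have bb: "of_nat (m + 2) * (1 - \<Theta> z * cnj (\<Theta> z)) ^ (m + 1) = of_real (b1 z)"
    "of_nat (m + 2) * of_nat (m + 1) * (1 - \<Theta> z * cnj (\<Theta> z)) ^ m = of_real (b2 z)" for z
    unfolding b1_def b2_def complex_norm_square[symmetric] of_real_mult of_real_power of_real_diff
        of_real_of_nat_eq of_real_1
    by (rule refl)+
  define X where "X z = of_real (3 * \<tau>) * (exp (V z) * (f z * cnj (f z)) + exp (S z) * (k z * cnj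
      (k z)))
     + (-1) * (inverse_ext m (\<Theta> z) * (f z * k z))" for z
  note Z = wirtinger2_add[OF wirtinger2_mult[OF wirtinger2_const[of _ "of_real (3 * \<tau>)"]
      wirtinger2_add[OF X1 X2]]
     wirtinger2_mult[OF wirtinger2_const[of _ "-1"] wirtinger2_mult[OF X3 wirtinger2_mult[OF hf
         hk]]]]
  define Zt where "Zt z = of_real (3 * \<tau>) * (exp (V z) * ((2 * (a z * cnj (a z)) + t z * cnj (t
      z)) * (f z * cnj (f z)) + (deriv f z + A z * f z) * cnj (deriv f z + A z * f z))
     + exp (S z) * ((t z * cnj (t z)) * (k z * cnj (k z)) + (deriv k z + (cnj (\<Theta> z) * t z) * k z)
         * cnj (deriv k z + (cnj (\<Theta> z) * t z) * k z)))
     - ((- (of_real (b2 z) * cnj (\<Theta> z) * (t z * cnj (t z)))) * (f z * k z) + of_real (b1 z) * cnj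
         (t z) * (deriv f z * k z + f z * deriv k z))" for z
  have "\<exists>B C. wirtinger2 ?D X B C Zt"
    by (intro exI, rule wirtinger2_cong[OF Z _ refl refl])
       (unfold Zt_def bb t_def, (simp add: X_def algebra_simps)+)
  then obtain B C where wX: "wirtinger2 ?D X B C Zt" by blast
  have "0 \<le> Re (Zt z)" if z: "norm z < 1" for z
  proof -
    let ?e = "exp (N * Re (w z))"
    define D where "D = deriv f z + A z * f z"
    define R where "R = deriv k z + (cnj (\<Theta> z) * t z) * k z"
    have eV: "exp (V z) = of_real (exp (2 * N * Re (w z) + (Re (w z))\<^sup>2 + (norm (\<Theta> z))\<^sup>2))"
      by (simp add: V_def uR S_def exp_of_real power2_eq_square mult_cnj_norm flip: of_real_mult
          of_real_add exp_of_real)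
    have eS: "exp (S z) = of_real (exp ((norm (\<Theta> z))\<^sup>2))"
      by (simp add: S_def mult_cnj_norm exp_of_real flip: of_real_power)
    \<comment> \<open>The derivatives are expressed through the twisted ones, because the squares of
      \<open>D\<close> and \<open>R\<close> are what occurs in \<open>Zt\<close>.\<close>
    have df: "deriv f z = D - A z * f z" and dk: "deriv k z = R - (cnj (\<Theta> z) * t z) * k z"
      by (auto simp: D_def R_def)
    \<comment> \<open>The linear and quadratic parts of the exponent together contribute
      \<open>N + Re (w z)\<close> times the derivative of \<open>w\<close>, and
      \<open>Re (w z)\<close> lies between 0 and 1.\<close>
    have nA: "norm (A z) \<le> (N + 1) * norm (deriv w z) + norm (t z)"
    proof -
      have "norm (A z) \<le> norm (of_real (2 * N) * a z + 2 * (u z * a z)) + norm (cnj (\<Theta> z) * t z)"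
        unfolding A_def by (rule norm_triangle_ineq)
      also have "of_real (2 * N) * a z + 2 * (u z * a z) = of_real (N + Re (w z)) * deriv w z"
        by (simp add: a_def uR algebra_simps)
      also have "norm \<dots> \<le> (N + 1) * norm (deriv w z)"
        unfolding norm_mult norm_of_real by (intro mult_right_mono) (use w01[OF z] N in auto)
      also have "norm (cnj (\<Theta> z) * t z) \<le> 1 * norm (t z)"
        unfolding norm_mult by (intro mult_right_mono) (use \<Theta>1[OF z] in auto)
      finally show ?thesis by simp
    qed
    have q0: "0 \<le> 1 - (norm (\<Theta> z))\<^sup>2" using \<Theta>1[OF z] by (simp add: power_le_one)
    have b0: "0 \<le> b1 z" "0 \<le> b2 z" using q0 by (auto simp: b1_def b2_def)
    have n1: "norm (deriv f z * k z + f z * deriv k z) \<le>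
       (norm D + (N + 1) * norm (deriv w z) * norm (f z) + norm (t z) * norm (f z)) * norm (k z)
         + norm (f z) * (norm R + norm (t z) * norm (k z))"
    proof -
      have "norm (deriv f z) \<le> norm D + norm (A z) * norm (f z)"
        unfolding df by (rule order_trans[OF norm_triangle_ineq4]) (simp add: norm_mult)
      also have "\<dots> \<le> norm D + ((N + 1) * norm (deriv w z) + norm (t z)) * norm (f z)"
        by (intro add_left_mono mult_right_mono nA) auto
      finally have 1: "norm (deriv f z) \<le> norm D + (N + 1) * norm (deriv w z) * norm (f z) + norm
          (t z) * norm (f z)"
        by (simp add: algebra_simps)
      have "norm (deriv k z) \<le> norm R + norm (\<Theta> z) * (norm (t z) * norm (k z))"
        unfolding dk by (rule order_trans[OF norm_triangle_ineq4]) (simp add: norm_mult)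
      also have "\<dots> \<le> norm R + 1 * (norm (t z) * norm (k z))"
        by (intro add_left_mono mult_right_mono \<Theta>1[OF z]) auto
      finally have 2: "norm (deriv k z) \<le> norm R + norm (t z) * norm (k z)" by simp
      show ?thesis
        by (rule order_trans[OF norm_triangle_ineq]) (unfold norm_mult, intro add_mono
            mult_right_mono mult_left_mono 1 2, auto)
    qed
    have "norm ((- (of_real (b2 z) * cnj (\<Theta> z) * (t z * cnj (t z)))) * (f z * k z) + of_real (b1
        z) * cnj (t z) * (deriv f z * k z + f z * deriv k z))
      \<le> norm (of_real (b2 z) * cnj (\<Theta> z) * (t z * cnj (t z)) * (f z * k z)) + norm (of_real (b1 z)
          * cnj (t z) * (deriv f z * k z + f z * deriv k z))"
      by (rule order_trans[OF norm_triangle_ineq]) simp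
    also have "\<dots> = norm (\<Theta> z) * (b2 z * ((norm (t z))\<^sup>2 * (norm (f z) * norm (k z)))) + b1 z *
        (norm (t z) * norm (deriv f z * k z + f z * deriv k z))"
      using b0 by (simp add: norm_mult power2_eq_square)
    also have "\<dots> \<le> 1 * (b2 z * ((norm (t z))\<^sup>2 * (norm (f z) * norm (k z)))) + b1 z * (norm (t z)
        * ((norm D + (N + 1) * norm (deriv w z) * norm (f z) + norm (t z) * norm (f z)) * norm (k z)
         + norm (f z) * (norm R + norm (t z) * norm (k z))))"
      by (intro add_mono mult_right_mono mult_left_mono \<Theta>1[OF z] n1) (use b0 in auto)
    also have "\<dots> \<le> 3 * \<tau> * (exp (2 * N * Re (w z) + (Re (w z))\<^sup>2 + (norm (\<Theta> z))\<^sup>2) * (((norm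
        (deriv w z))\<^sup>2 / 2 + (norm (t z))\<^sup>2) * (norm (f z))\<^sup>2 + (norm D)\<^sup>2)
        + exp ((norm (\<Theta> z))\<^sup>2) * ((norm (t z))\<^sup>2 * (norm (k z))\<^sup>2 + (norm R)\<^sup>2))"
      unfolding mult_1
    proof (rule absorption_inequality[where e="?e"])
      show "1 \<le> ?e" using N w01(1)[OF z] by simp
      show "?e\<^sup>2 \<le> exp (2 * N * Re (w z) + (Re (w z))\<^sup>2 + (norm (\<Theta> z))\<^sup>2)"
        by (simp add: power2_eq_square flip: exp_add)
      show "b2 z \<le> \<tau> * ?e" unfolding b2_def by (rule small2[OF z])
      show "b1 z * (N + 1) \<le> \<tau> * ?e" unfolding b1_def by (rule small1[OF z])
    qed (use N \<tau> b0 in auto)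
    also have "\<dots> = Re (of_real (3 * \<tau>) * (exp (V z) * ((2 * (a z * cnj (a z)) + t z * cnj (t z)) *
        (f z * cnj (f z)) + D * cnj D)
     + exp (S z) * ((t z * cnj (t z)) * (k z * cnj (k z)) + R * cnj R)))"
    proof -
      \<comment> \<open>\<open>a\<close> is half the derivative of \<open>w\<close>, so
        \<open>2 * a * cnj a\<close> is the term \<open>a\<^sup>2 / 2\<close> of
        \<open>absorption_inequality\<close>, whose \<open>a\<close> is the modulus of
        \<open>deriv w z\<close>.\<close>
      have "(norm (deriv w z))\<^sup>2 = 4 * (norm (a z))\<^sup>2"
        by (simp add: a_def norm_divide power_divide)
      then show ?thesis unfolding eV eS mult_cnj_norm by simp
    qed
    finally show ?thesis
      unfolding Zt_def D_def[symmetric] R_def[symmetric] minus_complex.sel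
      by (smt (verit) abs_Re_le_cmod)
  qed
  from circle_mean_subharmonic[OF wX this r]
  have "Re (X 0) \<le> (LINT \<xi>|circ. Re (X (of_real r * \<xi>)))" .
  moreover have ReX: "Re (X z) = 3 * \<tau> * (exp (2 * N * Re (w z) + (Re (w z))\<^sup>2 + (norm (\<Theta> z))\<^sup>2) *
      (norm (f z))\<^sup>2
               + exp ((norm (\<Theta> z))\<^sup>2) * (norm (k z))\<^sup>2)
       - Re (inverse_ext m (\<Theta> z) * (f z * k z))" for z
  proof -
    have eV: "exp (V z) = of_real (exp (2 * N * Re (w z) + (Re (w z))\<^sup>2 + (norm (\<Theta> z))\<^sup>2))"
      by (simp add: V_def uR S_def exp_of_real power2_eq_square mult_cnj_norm flip: of_real_mult
          of_real_add exp_of_real)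
    have eS: "exp (S z) = of_real (exp ((norm (\<Theta> z))\<^sup>2))"
      by (simp add: S_def mult_cnj_norm exp_of_real flip: of_real_power)
    have "of_real (3 * \<tau>) * (exp (V z) * (f z * cnj (f z)) + exp (S z) * (k z * cnj (k z)))
      = of_real (3 * \<tau> * (exp (2 * N * Re (w z) + (Re (w z))\<^sup>2 + (norm (\<Theta> z))\<^sup>2) * (norm (f z))\<^sup>2
               + exp ((norm (\<Theta> z))\<^sup>2) * (norm (k z))\<^sup>2))"
      unfolding eV eS complex_norm_square[symmetric] by simp
    then show ?thesis unfolding X_def by (simp only: plus_complex.sel Re_complex_of_real) simp
  qed
  \<comment> \<open>At 0 the cross term vanishes with \<open>k\<close>, leaving a nonnegative
    multiple of \<open>(norm (f 0))\<^sup>2\<close>.\<close>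
  moreover have "0 \<le> Re (X 0)" unfolding ReX using \<tau> by (simp add: k0)
  ultimately show ?thesis by (simp add: Let_def)
qed

section \<open>Inner functions and model spaces\<close>

lemma inner_function_holomorphic: "inner_function \<Theta> \<Longrightarrow> \<Theta> holomorphic_on ball 0 1"
  by (simp add: inner_function_def)

lemma inner_radial_measurable: "inner_function \<Theta> \<Longrightarrow> radial_limit \<Theta> \<in> borel_measurable circ"
  by (intro radial_limit_measurable holomorphic_on_imp_continuous_on inner_function_holomorphic)

lemma inner_radial_norm: "inner_function \<Theta> \<Longrightarrow> AE \<xi> in circ. norm (radial_limit \<Theta> \<xi>) = 1"
  unfolding inner_function_def by (auto elim!: eventually_mono)

lemma inner_radial_tendsto:
  assumes "inner_function \<Theta>"
  shows "AE \<xi> in circ. (\<lambda>k. \<Theta> (of_real (radius k) * \<xi>)) \<longlonglongrightarrow> radial_limit \<Theta> \<xi>"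
proof -
  have "AE \<xi> in circ. ((\<lambda>r::real. \<Theta> (of_real r * \<xi>)) \<longlongrightarrow> radial_limit \<Theta> \<xi>) (at_left 1)"
    using assms unfolding inner_function_def by (auto elim!: eventually_mono)
  then show ?thesis by eventually_elim (rule filterlim_compose[OF _ filterlim_radius])
qed

lemma inner_taylor:
  assumes "inner_function \<Theta>" "norm z < 1"
  shows "(\<lambda>n. ((deriv ^^ n) \<Theta> 0 / fact n) * z ^ n) sums \<Theta> z"
  using holomorphic_power_series[OF inner_function_holomorphic[OF assms(1)], of z] assms(2) by simp

lemma inner_dilate_measurable:
  assumes "inner_function \<Theta>" shows "(\<lambda>\<xi>. \<Theta> (of_real (radius k) * \<xi>)) \<in> borel_measurable circ"
  by (intro borel_measurable_circle_continuous dilate_continuous radius_bounds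
      holomorphic_on_imp_continuous_on inner_function_holomorphic assms)

text \<open>Identities for the dilates of \<open>\<Theta>\<close>, which are absolutely convergent
  power series on the circle, pass to the boundary function in this way.\<close>

lemma inner_integral_tendsto:
  assumes \<Theta>: "inner_function \<Theta>" and g: "integrable circ g"
  shows "(\<lambda>k. LINT \<xi>|circ. g \<xi> * \<Theta> (of_real (radius k) * \<xi>)) \<longlonglongrightarrow> (LINT \<xi>|circ. g \<xi> * radial_limit \<Theta>
      \<xi>)"
proof -
  obtain C where C: "\<And>z. z \<in> ball 0 1 \<Longrightarrow> norm (\<Theta> z) \<le> C"
    using \<Theta> unfolding inner_function_def bounded_iff by blast
  show ?thesis
  proof (rule integral_dominated_convergence[where w="\<lambda>\<xi>. C * norm (g \<xi>)"])
    show "(\<lambda>\<xi>. g \<xi> * radial_limit \<Theta> \<xi>) \<in> borel_measurable circ"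
      using g inner_radial_measurable[OF \<Theta>] by measurable
    show "(\<lambda>\<xi>. g \<xi> * \<Theta> (of_real (radius k) * \<xi>)) \<in> borel_measurable circ" for k
      using g inner_dilate_measurable[OF \<Theta>] by measurable
    show "integrable circ (\<lambda>\<xi>. C * norm (g \<xi>))" using g by simp
    show "AE \<xi> in circ. (\<lambda>k. g \<xi> * \<Theta> (of_real (radius k) * \<xi>)) \<longlonglongrightarrow> g \<xi> * radial_limit \<Theta> \<xi>"
      using inner_radial_tendsto[OF \<Theta>] by eventually_elim (intro tendsto_intros)
    show "AE \<xi> in circ. norm (g \<xi> * \<Theta> (of_real (radius k) * \<xi>)) \<le> C * norm (g \<xi>)" for k
      using AE_circle_norm
    proof eventually_elim
      case (elim \<xi>)
      have "norm (\<Theta> (of_real (radius k) * \<xi>)) \<le> C"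
        using dilate_in_ball[OF radius_bounds elim] by (intro C) simp
      then have "norm (\<Theta> (of_real (radius k) * \<xi>)) * norm (g \<xi>) \<le> C * norm (g \<xi>)" by (rule
          mult_right_mono) simp
      then show ?case by (simp add: norm_mult mult.commute)
    qed
  qed
qed

lemma inner_radial_L2_mult:
  assumes \<Theta>: "inner_function \<Theta>" and g: "g \<in> circle_L2"
  shows "(\<lambda>\<xi>. radial_limit \<Theta> \<xi> * g \<xi>) \<in> circle_L2"
  by (rule circle_L2_mult_bounded[OF inner_radial_measurable[OF \<Theta>] _ g, where C=1])
     (use inner_radial_norm[OF \<Theta>] in \<open>auto elim!: eventually_mono\<close>)

text \<open>For a dilate of \<open>\<Theta>\<close> each Taylor term contributes a moment of
  \<open>g\<close> of index at least \<open>n\<close>, which is 0; then the radius tends to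
  1.\<close>

lemma inner_radial_mult_H2:
  assumes \<Theta>: "inner_function \<Theta>" and g: "g \<in> hardy_H2"
  shows "(\<lambda>\<xi>. radial_limit \<Theta> \<xi> * g \<xi>) \<in> hardy_H2"
proof -
  have "(LINT \<xi>|circ. radial_limit \<Theta> \<xi> * g \<xi> * \<xi> ^ n) = 0" if n: "n \<ge> 1" for n
  proof -
    have i: "integrable circ (\<lambda>\<xi>. g \<xi> * \<xi> ^ n)" by (intro circle_L2_integrable_mult hardy_H2_L2 g
        circle_L2_power)
    have "(LINT \<xi>|circ. g \<xi> * \<xi> ^ n * \<Theta> (of_real (radius k) * \<xi>)) = 0" for k
    proof -
      have "(LINT \<xi>|circ. g \<xi> * \<xi> ^ n * \<xi> ^ j) = 0" for j
      proof -
        have "(LINT \<xi>|circ. g \<xi> * \<xi> ^ n * \<xi> ^ j) = (LINT \<xi>|circ. g \<xi> * \<xi> ^ (n + j))" by (simp add: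
            power_add mult.assoc)
        then show ?thesis using g n by (simp add: hardy_H2_def)
      qed
      with dilate_integral_sums[OF inner_taylor[OF \<Theta>] radius_bounds i, of k]
      show ?thesis by (simp add: sums_iff)
    qed
    with inner_integral_tendsto[OF \<Theta> i] have "(LINT \<xi>|circ. g \<xi> * \<xi> ^ n * radial_limit \<Theta> \<xi>) = 0"
      by (simp add: LIMSEQ_const_iff)
    then show ?thesis by (simp add: mult_ac)
  qed
  then show ?thesis by (simp add: hardy_H2_def inner_radial_L2_mult[OF \<Theta> hardy_H2_L2[OF g]])
qed

lemma inner_radial_H2:
  assumes \<Theta>: "inner_function \<Theta>" shows "radial_limit \<Theta> \<in> hardy_H2"
  using inner_radial_mult_H2[OF \<Theta> hardy_H2_power[of 0]] by simp

text \<open>On the circle \<open>\<xi> / (1 - z * cnj \<xi>) = \<xi> + z / (1 - z * cnj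
  \<xi>)\<close>, and the moment from the first summand vanishes. This is the multiplicativity of
  the Cauchy integral for monomials, from which \<open>inner_mult_Cauchy\<close> is summed
  up.\<close>

lemma hardy_H2_shifted_Cauchy:
  assumes g: "g \<in> hardy_H2" and z: "norm z < 1"
  shows "(LINT \<xi>|circ. g \<xi> * (1 / (1 - z * cnj \<xi>)) * \<xi> ^ j) = z ^ j * hardy_ext g z"
proof (induction j)
  case 0
  then show ?case using hardy_ext_eq_Cauchy[OF hardy_H2_L2[OF g] z] by simp
next
  case (Suc j)
  have i1: "integrable circ (\<lambda>\<xi>. g \<xi> * \<xi> ^ Suc j)" by (intro circle_L2_integrable_mult hardy_H2_L2
      g circle_L2_power)
  have i2: "integrable circ (\<lambda>\<xi>. z * (g \<xi> * (1 / (1 - z * cnj \<xi>)) * \<xi> ^ j))"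
    by (intro integrable_mult_right circle_L2_integrable_mult integrable_mult_kernel(1)[OF
        hardy_H2_L2[OF g] z] circle_L2_power)
  have "(LINT \<xi>|circ. g \<xi> * (1 / (1 - z * cnj \<xi>)) * \<xi> ^ Suc j) =
     (LINT \<xi>|circ. g \<xi> * \<xi> ^ Suc j + z * (g \<xi> * (1 / (1 - z * cnj \<xi>)) * \<xi> ^ j))"
  proof (rule Bochner_Integration.integral_cong[OF refl])
    fix \<xi> assume "\<xi> \<in> space circ"
    then have n: "norm \<xi> = 1" by simp
    then have "\<xi> * cnj \<xi> = 1" by (simp add: mult_cnj_norm)
    then have "\<xi> = \<xi> * (1 - z * cnj \<xi>) + z" by (simp add: algebra_simps)
    then have "\<xi> * (1 / (1 - z * cnj \<xi>)) = \<xi> + z * (1 / (1 - z * cnj \<xi>))"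
      using one_minus_nonzero(1)[OF z n] by (simp add: field_simps)
    from arg_cong[OF this, of "\<lambda>x. g \<xi> * \<xi> ^ j * x"]
    show "g \<xi> * (1 / (1 - z * cnj \<xi>)) * \<xi> ^ Suc j = g \<xi> * \<xi> ^ Suc j + z * (g \<xi> * (1 / (1 - z * cnj
        \<xi>)) * \<xi> ^ j)"
      by (simp add: algebra_simps)
  qed
  also have "\<dots> = (LINT \<xi>|circ. g \<xi> * \<xi> ^ Suc j) + z * (LINT \<xi>|circ. g \<xi> * (1 / (1 - z * cnj \<xi>)) *
      \<xi> ^ j)"
    unfolding integral_mult_right_zero[symmetric] by (rule Bochner_Integration.integral_add[OF i1
        i2])
  also have "(LINT \<xi>|circ. g \<xi> * \<xi> ^ Suc j) = 0" using g by (simp add: hardy_H2_def del: power_Suc)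
  finally show ?case using Suc by simp
qed

text \<open>The Cauchy integral is multiplicative in the factor \<open>\<Theta>\<close>: this holds
  termwise for the Taylor series of a dilate and survives the limit of the radii. For constant
  \<open>g = 1\<close> it recovers \<open>\<Theta>\<close> from its radial limits.\<close>

lemma inner_mult_Cauchy:
  assumes \<Theta>: "inner_function \<Theta>" and g: "g \<in> hardy_H2" and z: "norm z < 1"
  shows "(LINT \<xi>|circ. g \<xi> * (1 / (1 - z * cnj \<xi>)) * radial_limit \<Theta> \<xi>) = \<Theta> z * hardy_ext g z"
proof -
  have i: "integrable circ (\<lambda>\<xi>. g \<xi> * (1 / (1 - z * cnj \<xi>)))"
    by (rule circle_L2_imp_integrable[OF integrable_mult_kernel(1)[OF hardy_H2_L2[OF g] z]])
  have "(LINT \<xi>|circ. g \<xi> * (1 / (1 - z * cnj \<xi>)) * \<Theta> (of_real (radius k) * \<xi>)) = \<Theta> (of_real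
      (radius k) * z) * hardy_ext g z" for k
  proof -
    have "norm (of_real (radius k) * z) < 1"
    proof -
      have "radius k * norm z \<le> 1 * norm z" using radius_bounds[of k] by (intro mult_right_mono)
          auto
      then show ?thesis using z radius_bounds[of k] by (simp add: norm_mult)
    qed
    from sums_mult2[OF inner_taylor[OF \<Theta> this], of "hardy_ext g z"]
    have "(\<lambda>n. (deriv ^^ n) \<Theta> 0 / fact n * of_real (radius k) ^ n * (z ^ n * hardy_ext g z)) sums
        (\<Theta> (of_real (radius k) * z) * hardy_ext g z)"
      by (simp add: power_mult_distrib mult_ac)
    moreover have "(\<lambda>n. (deriv ^^ n) \<Theta> 0 / fact n * of_real (radius k) ^ n * (z ^ n * hardy_ext g
        z)) sums
       (LINT \<xi>|circ. g \<xi> * (1 / (1 - z * cnj \<xi>)) * \<Theta> (of_real (radius k) * \<xi>))"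
      using dilate_integral_sums[OF inner_taylor[OF \<Theta>] radius_bounds i, of k]
      unfolding hardy_H2_shifted_Cauchy[OF g z] by simp
    ultimately show ?thesis by (rule sums_unique2[symmetric])
  qed
  with inner_integral_tendsto[OF \<Theta> i]
  have 1: "(\<lambda>k. \<Theta> (of_real (radius k) * z) * hardy_ext g z) \<longlonglongrightarrow> (LINT \<xi>|circ. g \<xi> * (1 / (1 - z *
      cnj \<xi>)) * radial_limit \<Theta> \<xi>)"
    by simp
  have "isCont \<Theta> z"
    using holomorphic_on_imp_continuous_on[OF inner_function_holomorphic[OF \<Theta>]] z
    by (simp add: continuous_on_eq_continuous_at)
  moreover have "(\<lambda>k. of_real (radius k) * z) \<longlonglongrightarrow> of_real 1 * z" by (intro tendsto_intros
      radius_tendsto)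
  ultimately have "(\<lambda>k. \<Theta> (of_real (radius k) * z)) \<longlonglongrightarrow> \<Theta> z"
    by (auto intro: isCont_tendsto_compose)
  then have "(\<lambda>k. \<Theta> (of_real (radius k) * z) * hardy_ext g z) \<longlonglongrightarrow> \<Theta> z * hardy_ext g z" by (intro
      tendsto_intros)
  from LIMSEQ_unique[OF 1 this] show ?thesis .
qed

lemma hardy_ext_one: "norm z < 1 \<Longrightarrow> hardy_ext (\<lambda>_. 1) z = 1"
  using hardy_ext_Poisson(2)[of "\<lambda>_. 1" z] hardy_H2_power[of 0] poisson_kernel_integral[of z] by
      simp

lemma hardy_ext_inner:
  assumes \<Theta>: "inner_function \<Theta>" and z: "norm z < 1"
  shows "hardy_ext (radial_limit \<Theta>) z = \<Theta> z"
  using inner_mult_Cauchy[OF \<Theta> hardy_H2_power[of 0] z] hardy_ext_one[OF z]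
    hardy_ext_eq_Cauchy[OF hardy_H2_L2[OF inner_radial_H2[OF \<Theta>]] z] by (simp add: mult.commute)

text \<open>The definition asks for some bound on the disc. The bound 1 comes from
  \<open>\<Theta>\<close> being the Poisson integral of unimodular boundary values.\<close>

lemma inner_norm_le_1:
  assumes \<Theta>: "inner_function \<Theta>" and z: "norm z < 1"
  shows "norm (\<Theta> z) \<le> 1"
proof -
  have "norm (\<Theta> z) = norm (LINT \<xi>|circ. radial_limit \<Theta> \<xi> * of_real (poisson_kernel z \<xi>))"
    using hardy_ext_Poisson(2)[OF inner_radial_H2[OF \<Theta>] z] hardy_ext_inner[OF \<Theta> z] by simp
  also have "\<dots> \<le> (LINT \<xi>|circ. norm (radial_limit \<Theta> \<xi> * of_real (poisson_kernel z \<xi>)))"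
    by (rule integral_norm_bound)
  also have "\<dots> = (LINT \<xi>|circ. poisson_kernel z \<xi>)"
  proof (rule integral_cong_AE)
    show "AE \<xi> in circ. norm (radial_limit \<Theta> \<xi> * of_real (poisson_kernel z \<xi>)) = poisson_kernel z \<xi>"
      using inner_radial_norm[OF \<Theta>] by eventually_elim (simp add: norm_mult
          poisson_kernel_nonneg[OF z])
  qed (use inner_radial_measurable[OF \<Theta>] borel_measurable_circle_kernel(3)[OF z] in measurable)
  finally show ?thesis using poisson_kernel_integral(2)[OF z] by simp
qed

section \<open>Model spaces and the harmonic completion of a weight\<close>

lemma model_space_closed_subspace:
  assumes \<Theta>: "inner_function \<Theta>" shows "L2_closed_subspace (model_space \<Theta>)"
  unfolding L2_closed_subspace_def
proof (intro conjI ballI allI impI)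
  note H = hardy_H2_closed_subspace
  have TL: "(\<lambda>\<xi>. radial_limit \<Theta> \<xi> * g \<xi>) \<in> circle_L2" if "g \<in> hardy_H2" for g
    by (rule inner_radial_L2_mult[OF \<Theta> hardy_H2_L2[OF that]])
  show "model_space \<Theta> \<subseteq> circle_L2" by (auto simp: model_space_def hardy_H2_L2)
  show "(\<lambda>_. 0) \<in> model_space \<Theta>"
    using L2_closed_subspace_zero[OF H] by (auto simp: model_space_def L2_inner_def)
  show "(\<lambda>\<xi>. f \<xi> + g \<xi>) \<in> model_space \<Theta>" if "f \<in> model_space \<Theta>" "g \<in> model_space \<Theta>" for f g
    using that by (auto simp: model_space_def L2_closed_subspace_add[OF H] L2_inner_add_left
        hardy_H2_L2 TL)
  show "(\<lambda>\<xi>. c * f \<xi>) \<in> model_space \<Theta>" if "f \<in> model_space \<Theta>" for c f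
    using that by (auto simp: model_space_def L2_closed_subspace_cmult[OF H] L2_inner_cmult_left)
  fix F g assume F: "\<forall>n. F n \<in> model_space \<Theta>" and g: "g \<in> circle_L2"
    and lim: "(\<lambda>n. L2_norm (\<lambda>\<xi>. F n \<xi> - g \<xi>)) \<longlonglongrightarrow> 0"
  have FL: "F n \<in> circle_L2" for n using F by (auto simp: model_space_def hardy_H2_L2)
  have "g \<in> hardy_H2" by (rule L2_closed_subspace_limit[OF H _ g lim]) (use F in \<open>auto simp:
      model_space_def\<close>)
  moreover have "L2_inner g (\<lambda>\<xi>. radial_limit \<Theta> \<xi> * h \<xi>) = 0" if h: "h \<in> hardy_H2" for h
  proof -
    have "(\<lambda>n. L2_inner (F n) (\<lambda>\<xi>. radial_limit \<Theta> \<xi> * h \<xi>)) \<longlonglongrightarrow> L2_inner g (\<lambda>\<xi>. radial_limit \<Theta> \<xi> * h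
        \<xi>)"
      unfolding L2_inner_def by (rule L2_integral_mult_tendsto[OF FL g lim circle_L2_cnj[OF TL[OF
          h]]])
    moreover have "L2_inner (F n) (\<lambda>\<xi>. radial_limit \<Theta> \<xi> * h \<xi>) = 0" for n using F h by (auto simp:
        model_space_def)
    ultimately show ?thesis by (simp add: LIMSEQ_const_iff)
  qed
  ultimately show "g \<in> model_space \<Theta>" by (auto simp: model_space_def)
qed

text \<open>The conjugation of the model space, up to the factor \<open>\<xi>\<close>.\<close>

lemma
  assumes \<Theta>: "inner_function \<Theta>" and f: "f \<in> model_space \<Theta>"
  shows model_space_conjugate_H2: "(\<lambda>\<xi>. radial_limit \<Theta> \<xi> * cnj (f \<xi>)) \<in> hardy_H2"
    and model_space_conjugate_zero: "hardy_ext (\<lambda>\<xi>. radial_limit \<Theta> \<xi> * cnj (f \<xi>)) 0 = 0"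
proof -
  have fL: "f \<in> circle_L2" using f by (simp add: model_space_def hardy_H2_L2)
  have kL: "(\<lambda>\<xi>. radial_limit \<Theta> \<xi> * cnj (f \<xi>)) \<in> circle_L2"
    by (rule inner_radial_L2_mult[OF \<Theta> circle_L2_cnj[OF fL]])
  \<comment> \<open>The exponents \<open>n \<ge> 1\<close> give membership in
    \<open>hardy_H2\<close>, the exponent 0 gives the zero at the origin.\<close>
  have z: "(LINT \<xi>|circ. radial_limit \<Theta> \<xi> * cnj (f \<xi>) * \<xi> ^ n) = 0" for n
  proof -
    have "\<forall>h\<in>hardy_H2. L2_inner f (\<lambda>\<xi>. radial_limit \<Theta> \<xi> * h \<xi>) = 0"
      using f by (simp add: model_space_def)
    from bspec[OF this hardy_H2_power]
    have "L2_inner f (\<lambda>\<xi>. radial_limit \<Theta> \<xi> * \<xi> ^ n) = 0" .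
    then have "cnj (LINT \<xi>|circ. f \<xi> * cnj (radial_limit \<Theta> \<xi> * \<xi> ^ n)) = 0" by (simp add:
        L2_inner_def)
    then have "(LINT \<xi>|circ. cnj (f \<xi> * cnj (radial_limit \<Theta> \<xi> * \<xi> ^ n))) = 0" by (simp only:
        Bochner_Integration.integral_cnj)
    then show ?thesis by (simp add: mult_ac)
  qed
  show "(\<lambda>\<xi>. radial_limit \<Theta> \<xi> * cnj (f \<xi>)) \<in> hardy_H2" using kL z by (simp add: hardy_H2_def)
  show "hardy_ext (\<lambda>\<xi>. radial_limit \<Theta> \<xi> * cnj (f \<xi>)) 0 = 0"
    using hardy_ext_eq_Cauchy[OF kL, of 0] z[of 0] by simp
qed

text \<open>Doubling the analytic projection of \<open>\<rho>\<close> and removing one copy of the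
  mean gives a function with real part \<open>\<rho>\<close>. The Poisson transform thereby becomes
  the real part of a holomorphic function, to which the Wirtinger calculus applies. The function
  \<open>w\<close> itself need not be bounded.\<close>

lemma harmonic_completion:
  fixes \<rho> :: "complex \<Rightarrow> real"
  assumes m: "\<rho> \<in> borel_measurable circ" and b: "AE \<xi> in circ. \<bar>\<rho> \<xi>\<bar> \<le> C"
  obtains w where "w \<in> hardy_H2" "AE \<xi> in circ. Re (w \<xi>) = \<rho> \<xi>"
    "\<And>z. norm z < 1 \<Longrightarrow> Re (hardy_ext w z) = poisson_transform \<rho> z"
proof -
  define p where "p \<xi> = complex_of_real (\<rho> \<xi>)" for \<xi>
  have pL: "p \<in> circle_L2"
    by (rule circle_L2_bounded[where C=C]) (use m b in \<open>auto simp: p_def[abs_def]\<close>)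
  define g where "g = L2_proj hardy_H2 p"
  have gH: "g \<in> hardy_H2" unfolding g_def by (rule L2_proj_in[OF hardy_H2_closed_subspace pL])
  note gL = hardy_H2_L2[OF gH]
  have gc: "fourier_coeff g n = fourier_coeff p n" for n
    unfolding fourier_coeff_inner g_def by (rule L2_inner_proj[OF hardy_H2_closed_subspace pL
        hardy_H2_power])
  define c where "c = (LINT \<xi>|circ. p \<xi>)"
  have cR: "cnj c = c"
    unfolding c_def p_def by simp
  define w where "w \<xi> = 2 * g \<xi> - c * \<xi> ^ 0" for \<xi>
  have wH: "w \<in> hardy_H2" unfolding w_def[abs_def]
    by (intro L2_closed_subspace_diff[OF hardy_H2_closed_subspace] L2_closed_subspace_cmult[OF
        hardy_H2_closed_subspace] gH hardy_H2_power)
  note wL = hardy_H2_L2[OF wH]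
  have wc: "fourier_coeff w n = 2 * fourier_coeff p n - (if n = 0 then c else 0)" for n
  proof -
    have "fourier_coeff w n = 2 * fourier_coeff g n - c * L2_inner (\<lambda>\<xi>. \<xi> ^ 0) (\<lambda>\<xi>. \<xi> ^ n)"
      unfolding w_def[abs_def] fourier_coeff_inner
        L2_inner_diff_left[OF circle_L2_cmult[OF gL] circle_L2_cmult[OF circle_L2_power]
            circle_L2_power] L2_inner_cmult_left
      by (rule refl)
    then show ?thesis unfolding gc L2_inner_power_power by simp
  qed
  \<comment> \<open>\<open>h\<close> is real-valued, so its moments against powers of
    \<open>\<xi>\<close> determine by conjugation those against powers of
    \<open>cnj \<xi>\<close>.\<close>
  define h where "h \<xi> = p \<xi> - (1/2) * (w \<xi> + cnj (w \<xi>))" for \<xi>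
  have hL: "h \<in> circle_L2" unfolding h_def[abs_def] by (intro circle_L2_diff circle_L2_cmult
      circle_L2_add circle_L2_cnj pL wL)
  have hc: "(LINT \<xi>|circ. h \<xi> * \<xi> ^ n) = 0" for n
  proof -
    have ii: "integrable circ (\<lambda>\<xi>. q \<xi> * \<xi> ^ n)" if "q \<in> circle_L2" for q by (intro
        circle_L2_integrable_mult that circle_L2_power)
    have "(LINT \<xi>|circ. h \<xi> * \<xi> ^ n) = (LINT \<xi>|circ. p \<xi> * \<xi> ^ n - ((1/2) * (w \<xi> * \<xi> ^ n) + (1/2)
        * (cnj (w \<xi>) * \<xi> ^ n)))"
      by (simp add: h_def algebra_simps)
    also have "\<dots> = (LINT \<xi>|circ. p \<xi> * \<xi> ^ n) - ((1/2) * (LINT \<xi>|circ. w \<xi> * \<xi> ^ n) + (1/2) *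
        (LINT \<xi>|circ. cnj (w \<xi>) * \<xi> ^ n))"
      by (subst Bochner_Integration.integral_diff; (subst Bochner_Integration.integral_add)?)
         (auto intro!: ii pL wL circle_L2_cnj integrable_mult_right)
    also have "(LINT \<xi>|circ. p \<xi> * \<xi> ^ n) = cnj (fourier_coeff p n)"
      by (simp add: fourier_coeff_def p_def flip: Bochner_Integration.integral_cnj)
    also have "(LINT \<xi>|circ. cnj (w \<xi>) * \<xi> ^ n) = cnj (fourier_coeff w n)"
      by (simp add: fourier_coeff_def flip: Bochner_Integration.integral_cnj)
    also have "(LINT \<xi>|circ. w \<xi> * \<xi> ^ n) = (if n = 0 then fourier_coeff w 0 else 0)"
      using wH by (auto simp: hardy_H2_def fourier_coeff_def)
    also have "fourier_coeff p 0 = c" by (simp add: fourier_coeff_def c_def)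
    then have "cnj (fourier_coeff p n) - ((1/2) * (if n = 0 then fourier_coeff w 0 else 0) + (1/2)
        * cnj (fourier_coeff w n)) = 0"
      by (auto simp: wc cR)
    finally show ?thesis .
  qed
  have "AE \<xi> in circ. h \<xi> = 0"
  proof (rule circle_uniqueness[OF circle_L2_imp_integrable[OF hL] hc])
    fix n
    have "(LINT \<xi>|circ. h \<xi> * cnj \<xi> ^ n) = cnj (LINT \<xi>|circ. h \<xi> * \<xi> ^ n)"
      by (simp add: h_def p_def add.commute flip: Bochner_Integration.integral_cnj)
    then show "(LINT \<xi>|circ. h \<xi> * cnj \<xi> ^ n) = 0" by (simp add: hc)
  qed
  then have ae: "AE \<xi> in circ. Re (w \<xi>) = \<rho> \<xi>"
    by eventually_elim (simp add: h_def p_def complex_eq_iff)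
  moreover have "Re (hardy_ext w z) = poisson_transform \<rho> z" if z: "norm z < 1" for z
  proof -
    have "Re (hardy_ext w z) = (LINT \<xi>|circ. Re (w \<xi> * of_real (poisson_kernel z \<xi>)))"
      unfolding hardy_ext_Poisson(2)[OF wH z] by (rule integral_Re[OF hardy_ext_Poisson(1)[OF wH
          z], symmetric])
    also have "\<dots> = (LINT \<xi>|circ. poisson_kernel z \<xi> *\<^sub>R \<rho> \<xi>)"
    proof (rule integral_cong_AE)
      show "AE \<xi> in circ. Re (w \<xi> * of_real (poisson_kernel z \<xi>)) = poisson_kernel z \<xi> *\<^sub>R \<rho> \<xi>"
        using ae by eventually_elim simp
    qed (use wL m borel_measurable_circle_kernel(3)[OF z] in measurable)
    finally show ?thesis by (simp add: poisson_transform_def poisson_kernel_def)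
  qed
  ultimately show ?thesis by (intro that[OF wH]) auto
qed

lemma poisson_transform_bounds:
  fixes \<rho> :: "complex \<Rightarrow> real"
  assumes m: "\<rho> \<in> borel_measurable circ" and b: "AE \<xi> in circ. 0 \<le> \<rho> \<xi> \<and> \<rho> \<xi> \<le> 1" and z: "norm z <
      1"
  shows "0 \<le> poisson_transform \<rho> z" "poisson_transform \<rho> z \<le> 1"
proof -
  have pt: "poisson_transform \<rho> z = (LINT \<xi>|circ. poisson_kernel z \<xi> * \<rho> \<xi>)"
    by (simp add: poisson_transform_def poisson_kernel_def)
  note k = poisson_kernel_integral[OF z] poisson_kernel_nonneg[OF z]
  have le: "AE \<xi> in circ. 0 \<le> poisson_kernel z \<xi> * \<rho> \<xi> \<and> poisson_kernel z \<xi> * \<rho> \<xi> \<le> poisson_kernel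
      z \<xi>"
    using b by eventually_elim (use k(3) in \<open>auto intro: mult_left_le\<close>)
  show "0 \<le> poisson_transform \<rho> z" unfolding pt
    by (rule integral_nonneg_AE) (use le in \<open>auto elim!: eventually_mono\<close>)
  have "poisson_transform \<rho> z \<le> (LINT \<xi>|circ. poisson_kernel z \<xi>)" unfolding pt
  proof (rule integral_mono_AE)
    show "integrable circ (\<lambda>\<xi>. poisson_kernel z \<xi> * \<rho> \<xi>)"
    proof (rule Bochner_Integration.integrable_bound[OF k(1)])
      show "(\<lambda>\<xi>. poisson_kernel z \<xi> * \<rho> \<xi>) \<in> borel_measurable circ"
        using m borel_measurable_circle_kernel(3)[OF z] by measurable
      show "AE x in circ. norm (poisson_kernel z x * \<rho> x) \<le> norm (poisson_kernel z x)"
        using le by eventually_elim (use k(3) in auto)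
    qed
  qed (use k le in \<open>auto elim!: eventually_mono\<close>)
  then show "poisson_transform \<rho> z \<le> 1" using k by simp
qed

section \<open>Coercivity\<close>

text \<open>Since \<open>u\<^sup>2 \<le> u\<close>, the lower bound on \<open>u + s\<close> gives
  \<open>u + s\<^sup>2 \<ge> \<delta>\<^sup>2 / 2\<close>. So
  \<open>(1 - s\<^sup>2) ^ m \<le> exp (- m * s\<^sup>2)\<close> is at most
  \<open>exp (m * u)\<close> times \<open>exp (- m * \<delta>\<^sup>2 / 2)\<close>, and the last
  factor beats the polynomial in \<open>m\<close>.\<close>

lemma damping_exists:
  fixes \<tau> \<delta> :: real
  assumes "\<tau> > 0" "\<delta> > 0"
  obtains m :: nat where "\<And>u s. 0 \<le> u \<Longrightarrow> u \<le> 1 \<Longrightarrow> 0 \<le> s \<Longrightarrow> s \<le> 1 \<Longrightarrow> u + s \<ge> \<delta> \<Longrightarrow>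
      real (m + 2) * real (m + 1) * (1 - s\<^sup>2) ^ m \<le> \<tau> * exp (real m * u)"
proof -
  define \<epsilon> where "\<epsilon> = \<delta>\<^sup>2 / 2"
  have \<epsilon>: "\<epsilon> > 0" using assms by (simp add: \<epsilon>_def)
  have "(\<lambda>m. real (m + 2) * real (m + 1) * exp (- (real m * \<epsilon>))) \<longlonglongrightarrow> 0"
    using \<epsilon> by real_asymp
  from order_tendstoD(2)[OF this assms(1)] obtain m
    where m: "real (m + 2) * real (m + 1) * exp (- (real m * \<epsilon>)) < \<tau>"
    by (auto simp: eventually_sequentially)
  show ?thesis
  proof (rule that[of m])
    fix u s :: real assume us: "0 \<le> u" "u \<le> 1" "0 \<le> s" "s \<le> 1" "u + s \<ge> \<delta>"
    have "\<delta>\<^sup>2 \<le> (u + s)\<^sup>2" by (rule power_mono) (use us assms in auto)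
    also have "\<dots> \<le> 2 * u\<^sup>2 + 2 * s\<^sup>2" using sum_squares_bound[of u s] by (simp add: power2_sum)
    also have "\<dots> \<le> 2 * (u + s\<^sup>2)"
      using mult_left_le[of u u] us by (simp add: power2_eq_square)
    finally have e: "\<epsilon> \<le> u + s\<^sup>2" by (simp add: \<epsilon>_def)
    have "1 - s\<^sup>2 \<le> exp (- s\<^sup>2)" using exp_ge_add_one_self[of "- s\<^sup>2"] by simp
    moreover have "0 \<le> 1 - s\<^sup>2" using us by (simp add: power_le_one)
    ultimately have "(1 - s\<^sup>2) ^ m \<le> exp (- s\<^sup>2) ^ m" by (intro power_mono)
    also have "\<dots> = exp (- (real m * s\<^sup>2))" by (simp flip: exp_of_nat_mult)
    also have "\<dots> \<le> exp (- (real m * \<epsilon>) + real m * u)"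
    proof -
      have "real m * \<epsilon> \<le> real m * (u + s\<^sup>2)" using e by (intro mult_left_mono) auto
      then show ?thesis by (simp add: algebra_simps)
    qed
    finally have "(1 - s\<^sup>2) ^ m \<le> exp (- (real m * \<epsilon>)) * exp (real m * u)" by (simp only: exp_add)
    then have "real (m + 2) * real (m + 1) * (1 - s\<^sup>2) ^ m \<le> real (m + 2) * real (m + 1) * (exp (-
        (real m * \<epsilon>)) * exp (real m * u))"
      by (intro mult_left_mono) auto
    also have "\<dots> = (real (m + 2) * real (m + 1) * exp (- (real m * \<epsilon>))) * exp (real m * u)" by
        (simp only: mult.assoc)
    also have "\<dots> \<le> \<tau> * exp (real m * u)" using m by (intro mult_right_mono) auto
    finally show "real (m + 2) * real (m + 1) * (1 - s\<^sup>2) ^ m \<le> \<tau> * exp (real m * u)" .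
  qed
qed

text \<open>The nonnegative circular means are taken along radii tending to 1. On the circle
  \<open>inverse_ext m\<close> of the unimodular radial limit is its conjugate, so the cross term
  becomes \<open>(L2_norm f)\<^sup>2\<close>. The exponent \<open>m\<close> comes from
  \<open>damping_exists\<close> and serves all \<open>f\<close> at once.\<close>

lemma model_space_estimate:
  fixes \<rho> :: "complex \<Rightarrow> real" and \<tau> \<delta> :: real
  assumes \<Theta>: "inner_function \<Theta>" and m\<rho>: "\<rho> \<in> borel_measurable circ"
    and b\<rho>: "AE \<xi> in circ. 0 \<le> \<rho> \<xi> \<and> \<rho> \<xi> \<le> 1" and \<delta>: "\<delta> > 0"
    and low: "\<And>z. norm z < 1 \<Longrightarrow> poisson_transform \<rho> z + norm (\<Theta> z) \<ge> \<delta>"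
    and \<tau>: "\<tau> > 0"
  obtains m :: nat where "\<And>f. f \<in> model_space \<Theta> \<Longrightarrow>
     (L2_norm f)\<^sup>2 \<le> 3 * \<tau> * ((LINT \<xi>|circ. exp (2 * real m * \<rho> \<xi> + (\<rho> \<xi>)\<^sup>2 + 1) * (norm (f \<xi>))\<^sup>2)
         + exp 1 * (L2_norm f)\<^sup>2)"
proof -
  have b\<rho>': "AE \<xi> in circ. \<bar>\<rho> \<xi>\<bar> \<le> 1" using b\<rho> by eventually_elim simp
  obtain w where wH: "w \<in> hardy_H2" and wae: "AE \<xi> in circ. Re (w \<xi>) = \<rho> \<xi>"
    and wP: "\<And>z. norm z < 1 \<Longrightarrow> Re (hardy_ext w z) = poisson_transform \<rho> z"
    by (rule harmonic_completion[OF m\<rho> b\<rho>']) blast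
  note wL = hardy_H2_L2[OF wH]
  obtain m :: nat where m: "\<And>u s. 0 \<le> u \<Longrightarrow> u \<le> 1 \<Longrightarrow> 0 \<le> s \<Longrightarrow> s \<le> 1 \<Longrightarrow> u + s \<ge> \<delta> \<Longrightarrow>
      real (m + 2) * real (m + 1) * (1 - s\<^sup>2) ^ m \<le> \<tau> * exp (real m * u)"
    using damping_exists[OF \<tau> \<delta>] by blast
  define W where "W = hardy_ext w"
  have W01: "0 \<le> Re (W z)" "Re (W z) \<le> 1" if "norm z < 1" for z
    using poisson_transform_bounds[OF m\<rho> b\<rho> that] wP[OF that] by (simp_all add: W_def)
  note \<Theta>1 = inner_norm_le_1[OF \<Theta>]
  have small2: "real (m + 2) * real (m + 1) * (1 - (norm (\<Theta> z))\<^sup>2) ^ m \<le> \<tau> * exp (real m * Re (W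
      z))" if z: "norm z < 1" for z
    by (rule m) (use W01[OF z] \<Theta>1[OF z] low[OF z] wP[OF z] in \<open>auto simp: W_def\<close>)
  \<comment> \<open>The additional factor \<open>1 - (norm (\<Theta> z))\<^sup>2\<close> lies
    between 0 and 1, so this follows from \<open>small2\<close>; the parameter \<open>N\<close> of
    \<open>circle_mean_estimate\<close> is \<open>m\<close> here.\<close>
  have small1: "real (m + 2) * (1 - (norm (\<Theta> z))\<^sup>2) ^ (m + 1) * (real m + 1) \<le> \<tau> * exp (real m *
      Re (W z))" if z: "norm z < 1" for z
  proof -
    have q: "0 \<le> 1 - (norm (\<Theta> z))\<^sup>2" "1 - (norm (\<Theta> z))\<^sup>2 \<le> 1" using \<Theta>1[OF z] by (auto simp:
        power_le_one)
    have "(1 - (norm (\<Theta> z))\<^sup>2) ^ (m + 1) \<le> (1 - (norm (\<Theta> z))\<^sup>2) ^ m" by (rule power_decreasing)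
        (use q in auto)
    then have "real (m + 2) * real (m + 1) * (1 - (norm (\<Theta> z))\<^sup>2) ^ (m + 1) \<le> real (m + 2) * real
        (m + 1) * (1 - (norm (\<Theta> z))\<^sup>2) ^ m"
      by (intro mult_left_mono) auto
    moreover have "real (m + 2) * (1 - (norm (\<Theta> z))\<^sup>2) ^ (m + 1) * (real m + 1) = real (m + 2) *
        real (m + 1) * (1 - (norm (\<Theta> z))\<^sup>2) ^ (m + 1)"
      by (simp only: of_nat_add of_nat_1 mult_ac)
    ultimately show ?thesis using small2[OF z] by linarith
  qed
  have "(\<lambda>k. LINT \<xi>|circ. norm (W (of_real (radius k) * \<xi>) - w \<xi>)) \<longlonglongrightarrow> 0"
  proof (rule tendsto_sandwich[OF _ _ tendsto_const hardy_ext_boundary[OF wH]])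
    show "\<forall>\<^sub>F k in sequentially. (LINT \<xi>|circ. norm (W (of_real (radius k) * \<xi>) - w \<xi>)) \<le> L2_norm
        (\<lambda>\<xi>. hardy_ext w (of_real (radius k) * \<xi>) - w \<xi>)"
      unfolding W_def by (intro always_eventually allI L1_le_L2_norm circle_L2_diff
          hardy_ext_dilate_L2 wL)
  qed auto
  moreover have "integrable circ (\<lambda>\<xi>. W (of_real (radius k) * \<xi>) - w \<xi>)" for k
    unfolding W_def by (intro circle_L2_imp_integrable circle_L2_diff hardy_ext_dilate_L2 wL)
  \<comment> \<open>The dilates of \<open>w\<close> are only known to converge in the mean. The
    weights need pointwise limits, hence a subsequence, along which the other limits
    persist.\<close>
  ultimately obtain s :: "nat \<Rightarrow> nat" where s: "strict_mono s"
    and sae: "AE \<xi> in circ. (\<lambda>k. W (of_real (radius (s k)) * \<xi>) - w \<xi>) \<longlonglongrightarrow> 0"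
    using tendsto_L1_AE_subseq[of circ "\<lambda>k \<xi>. W (of_real (radius k) * \<xi>) - w \<xi>"] by blast
  define R where "R k = radius (s k)" for k
  have R: "0 \<le> R k" "R k < 1" for k by (simp_all add: R_def radius_bounds)
  have Wae: "AE \<xi> in circ. (\<lambda>k. Re (W (of_real (R k) * \<xi>))) \<longlonglongrightarrow> \<rho> \<xi>"
    using sae wae
  proof eventually_elim
    case (elim \<xi>)
    have "(\<lambda>k. W (of_real (R k) * \<xi>)) \<longlonglongrightarrow> w \<xi>" using elim(1) by (simp add: R_def LIM_zero_iff)
    from tendsto_Re[OF this] elim(2) show ?case by simp
  qed
  define T where "T = radial_limit \<Theta>"
  have Tae: "AE \<xi> in circ. (\<lambda>k. \<Theta> (of_real (R k) * \<xi>)) \<longlonglongrightarrow> T \<xi>"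
    using inner_radial_tendsto[OF \<Theta>]
    by eventually_elim (auto simp: R_def T_def intro: LIMSEQ_subseq_LIMSEQ[OF _ s, unfolded
        comp_def])
  note Tn = inner_radial_norm[OF \<Theta>, folded T_def]
  note Tm = inner_radial_measurable[OF \<Theta>, folded T_def]
  have cW: "continuous_on (ball 0 1) W" unfolding W_def by (intro holomorphic_on_imp_continuous_on
      hardy_ext_holomorphic wL)
  have c\<Theta>: "continuous_on (ball 0 1) \<Theta>" by (intro holomorphic_on_imp_continuous_on
      inner_function_holomorphic \<Theta>)
  have mW: "(\<lambda>\<xi>. W (of_real (R k) * \<xi>)) \<in> borel_measurable circ" for k
    by (intro borel_measurable_circle_continuous dilate_continuous cW R)
  have m\<Theta>: "(\<lambda>\<xi>. \<Theta> (of_real (R k) * \<xi>)) \<in> borel_measurable circ" for k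
    by (intro borel_measurable_circle_continuous dilate_continuous c\<Theta> R)
  \<comment> \<open>Complex-valued versions of the two weights and the extended inverse, so that
    \<open>L2_integral_tendsto\<close> serves all three terms.\<close>
  define b1 where "b1 k \<xi> = complex_of_real (exp (2 * real m * Re (W (of_real (R k) * \<xi>)) + (Re (W
      (of_real (R k) * \<xi>)))\<^sup>2 + (norm (\<Theta> (of_real (R k) * \<xi>)))\<^sup>2))" for k \<xi>
  define b2 where "b2 k \<xi> = complex_of_real (exp ((norm (\<Theta> (of_real (R k) * \<xi>)))\<^sup>2))" for k \<xi>
  define b3 where "b3 k \<xi> = inverse_ext m (\<Theta> (of_real (R k) * \<xi>))" for k \<xi>
  define B1 where "B1 \<xi> = complex_of_real (exp (2 * real m * \<rho> \<xi> + (\<rho> \<xi>)\<^sup>2 + 1))" for \<xi>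
  have bm: "b1 k \<in> borel_measurable circ" "b2 k \<in> borel_measurable circ" "b3 k \<in> borel_measurable
      circ" for k
  proof -
    show "b1 k \<in> borel_measurable circ" "b2 k \<in> borel_measurable circ"
      unfolding b1_def[abs_def] b2_def[abs_def] using mW[of k] m\<Theta>[of k] by measurable
    show "b3 k \<in> borel_measurable circ"
      unfolding b3_def[abs_def]
      by (rule borel_measurable_circle_continuous, rule continuous_on_compose2[OF
          continuous_inverse_ext[of UNIV]])
         (intro dilate_continuous c\<Theta> R, simp)
  qed
  have B1m: "B1 \<in> borel_measurable circ" unfolding B1_def[abs_def] using m\<rho> by measurable
  have bb: "AE \<xi> in circ. norm (b1 k \<xi>) \<le> exp (2 * real m + 2)" "AE \<xi> in circ. norm (b2 k \<xi>) \<le> exp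
      1"
    "AE \<xi> in circ. norm (b3 k \<xi>) \<le> m + 2" for k
  proof -
    have "norm (b1 k \<xi>) \<le> exp (2 * real m + 2)" "norm (b2 k \<xi>) \<le> exp 1" "norm (b3 k \<xi>) \<le> m + 2" if
        n: "norm \<xi> = 1" for \<xi>
    proof -
      have z: "norm (of_real (R k) * \<xi>) < 1" by (rule dilate_in_ball[OF R n])
      have 1: "Re (W (of_real (R k) * \<xi>)) \<le> 1" "(Re (W (of_real (R k) * \<xi>)))\<^sup>2 \<le> 1" "(norm (\<Theta>
          (of_real (R k) * \<xi>)))\<^sup>2 \<le> 1"
        using W01[OF z] \<Theta>1[OF z] by (auto simp: power_le_one)
      have "2 * real m * Re (W (of_real (R k) * \<xi>)) \<le> 2 * real m * 1" by (intro mult_left_mono 1)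
          auto
      then show "norm (b1 k \<xi>) \<le> exp (2 * real m + 2)" using 1 unfolding b1_def norm_of_real by simp
      show "norm (b2 k \<xi>) \<le> exp 1" using 1 unfolding b2_def norm_of_real by simp
      show "norm (b3 k \<xi>) \<le> m + 2" unfolding b3_def by (rule norm_inverse_ext_le[OF \<Theta>1[OF z]])
    qed
    then show "AE \<xi> in circ. norm (b1 k \<xi>) \<le> exp (2 * real m + 2)" "AE \<xi> in circ. norm (b2 k \<xi>) \<le>
        exp 1"
      "AE \<xi> in circ. norm (b3 k \<xi>) \<le> m + 2" by (auto intro!: AE_I2)
  qed
  have bl: "AE \<xi> in circ. (\<lambda>k. b1 k \<xi>) \<longlonglongrightarrow> B1 \<xi>" "AE \<xi> in circ. (\<lambda>k. b2 k \<xi>) \<longlonglongrightarrow> of_real (exp 1)"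
    "AE \<xi> in circ. (\<lambda>k. b3 k \<xi>) \<longlonglongrightarrow> cnj (T \<xi>)"
  proof -
    show "AE \<xi> in circ. (\<lambda>k. b1 k \<xi>) \<longlonglongrightarrow> B1 \<xi>"
      using Wae Tae Tn
    proof eventually_elim
      case (elim \<xi>)
      have "(\<lambda>k. b1 k \<xi>) \<longlonglongrightarrow> complex_of_real (exp (2 * real m * \<rho> \<xi> + (\<rho> \<xi>)\<^sup>2 + (norm (T \<xi>))\<^sup>2))"
        unfolding b1_def by (intro tendsto_intros elim(1,2))
      then show ?case by (simp add: B1_def elim(3))
    qed
    show "AE \<xi> in circ. (\<lambda>k. b2 k \<xi>) \<longlonglongrightarrow> of_real (exp 1)"
      using Tae Tn
    proof eventually_elim
      case (elim \<xi>)
      have "(\<lambda>k. b2 k \<xi>) \<longlonglongrightarrow> complex_of_real (exp ((norm (T \<xi>))\<^sup>2))"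
        unfolding b2_def by (intro tendsto_intros elim(1))
      then show ?case by (simp add: elim(2))
    qed
    show "AE \<xi> in circ. (\<lambda>k. b3 k \<xi>) \<longlonglongrightarrow> cnj (T \<xi>)"
      using Tae Tn
    proof eventually_elim
      case (elim \<xi>)
      have "isCont (inverse_ext m) (T \<xi>)"
        using continuous_inverse_ext[of UNIV m] by (simp add: continuous_on_eq_continuous_at)
      from isCont_tendsto_compose[OF this elim(1)] show ?case
        unfolding b3_def inverse_ext_circle[OF elim(2)] .
    qed
  qed
  show ?thesis
  proof (rule that[of m])
    fix f assume f: "f \<in> model_space \<Theta>"
    \<comment> \<open>This is the function \<open>k\<close> of the overview; it has the same norm as
      \<open>f\<close>.\<close>
    define g where "g \<xi> = T \<xi> * cnj (f \<xi>)" for \<xi>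
    have fH: "f \<in> hardy_H2" using f by (simp add: model_space_def)
    have gH: "g \<in> hardy_H2" and g0: "hardy_ext g 0 = 0"
      using model_space_conjugate_H2[OF \<Theta> f] model_space_conjugate_zero[OF \<Theta> f] by (simp_all add:
          g_def[abs_def] T_def)
    note fL = hardy_H2_L2[OF fH] and gL = hardy_H2_L2[OF gH]
    have gn: "AE \<xi> in circ. norm (g \<xi>) = norm (f \<xi>)" using Tn by eventually_elim (simp add: g_def
        norm_mult)
    have gnorm: "L2_norm g = L2_norm f" by (rule L2_norm_cong_AE[OF gn]) (use fL gL in measurable)
    define F where "F k \<xi> = hardy_ext f (of_real (R k) * \<xi>)" for k \<xi>
    define G where "G k \<xi> = hardy_ext g (of_real (R k) * \<xi>)" for k \<xi>
    have FL: "F k \<in> circle_L2" and GL: "G k \<in> circle_L2" for k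
      unfolding F_def[abs_def] G_def[abs_def] R_def by (intro hardy_ext_dilate_L2 fL gL)+
    have Fl: "(\<lambda>k. L2_norm (\<lambda>\<xi>. F k \<xi> - f \<xi>)) \<longlonglongrightarrow> 0" and Gl: "(\<lambda>k. L2_norm (\<lambda>\<xi>. G k \<xi> - g \<xi>)) \<longlonglongrightarrow> 0"
      using LIMSEQ_subseq_LIMSEQ[OF hardy_ext_boundary[OF fH] s] LIMSEQ_subseq_LIMSEQ[OF
          hardy_ext_boundary[OF gH] s]
      by (simp_all add: F_def G_def R_def comp_def)
    have cl: "(\<lambda>k. L2_norm (\<lambda>\<xi>. cnj (h k \<xi>) - cnj (h' \<xi>))) \<longlonglongrightarrow> 0" if "(\<lambda>k. L2_norm (\<lambda>\<xi>. h k \<xi> - h'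
        \<xi>)) \<longlonglongrightarrow> 0" for h h'
    proof -
      have "L2_norm (\<lambda>\<xi>. cnj (h k \<xi>) - cnj (h' \<xi>)) = L2_norm (\<lambda>\<xi>. h k \<xi> - h' \<xi>)" for k
        unfolding L2_norm_def by (simp flip: complex_cnj_diff)
      then show ?thesis using that by simp
    qed
    have l1: "(\<lambda>k. LINT \<xi>|circ. b1 k \<xi> * (F k \<xi> * cnj (F k \<xi>))) \<longlonglongrightarrow> (LINT \<xi>|circ. B1 \<xi> * (f \<xi> * cnj
        (f \<xi>)))"
      by (rule L2_integral_tendsto[OF FL fL Fl circle_L2_cnj[OF FL] circle_L2_cnj[OF fL] cl[OF Fl]
          bm(1) B1m bb(1) bl(1)])
    have l2: "(\<lambda>k. LINT \<xi>|circ. b2 k \<xi> * (G k \<xi> * cnj (G k \<xi>))) \<longlonglongrightarrow> (LINT \<xi>|circ. of_real (exp 1) *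
        (g \<xi> * cnj (g \<xi>)))"
      by (rule L2_integral_tendsto[OF GL gL Gl circle_L2_cnj[OF GL] circle_L2_cnj[OF gL] cl[OF Gl]
          bm(2) _ bb(2) bl(2)]) simp
    have l3: "(\<lambda>k. LINT \<xi>|circ. b3 k \<xi> * (F k \<xi> * G k \<xi>)) \<longlonglongrightarrow> (LINT \<xi>|circ. cnj (T \<xi>) * (f \<xi> * g \<xi>))"
      by (rule L2_integral_tendsto[OF FL fL Fl GL gL Gl bm(3) borel_measurable_cnj[OF Tm] bb(3)
          bl(3)])
    \<comment> \<open>The real part of \<open>Y k\<close> is the integrand of
      \<open>circle_mean_estimate\<close> at radius \<open>R k\<close>.\<close>
    define Y where "Y k \<xi> = of_real (3 * \<tau>) * (b1 k \<xi> * (F k \<xi> * cnj (F k \<xi>)) + b2 k \<xi> * (G k \<xi> *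
        cnj (G k \<xi>))) - b3 k \<xi> * (F k \<xi> * G k \<xi>)" for k \<xi>
    have i: "integrable circ (\<lambda>\<xi>. b \<xi> * (h1 \<xi> * h2 \<xi>))"
      if "h1 \<in> circle_L2" "h2 \<in> circle_L2" "b \<in> borel_measurable circ" "AE \<xi> in circ. norm (b \<xi>) \<le>
          C" for b h1 h2 C
      using circle_L2_integrable_mult[OF circle_L2_mult_bounded[OF that(3,4,1)] that(2)] by (simp
          add: mult.assoc)
    note i1 = i[OF FL circle_L2_cnj[OF FL] bm(1) bb(1)] and i2 = i[OF GL circle_L2_cnj[OF GL]
        bm(2) bb(2)]
      and i3 = i[OF FL GL bm(3) bb(3)]
    have Yi: "integrable circ (Y k)" for k
      unfolding Y_def by (intro Bochner_Integration.integrable_diff integrable_mult_right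
          Bochner_Integration.integrable_add i1 i2 i3)
    have YL: "(LINT \<xi>|circ. Y k \<xi>) = of_real (3 * \<tau>) * ((LINT \<xi>|circ. b1 k \<xi> * (F k \<xi> * cnj (F k
        \<xi>))) + (LINT \<xi>|circ. b2 k \<xi> * (G k \<xi> * cnj (G k \<xi>))))
        - (LINT \<xi>|circ. b3 k \<xi> * (F k \<xi> * G k \<xi>))" for k
      unfolding Y_def using i1[of k k] i2[of k k] i3[of k k k]
      by (subst Bochner_Integration.integral_diff) (auto simp: Bochner_Integration.integral_add)
    have lim: "(\<lambda>k. LINT \<xi>|circ. Y k \<xi>) \<longlonglongrightarrow> of_real (3 * \<tau>) * ((LINT \<xi>|circ. B1 \<xi> * (f \<xi> * cnj (f
        \<xi>))) + (LINT \<xi>|circ. of_real (exp 1) * (g \<xi> * cnj (g \<xi>))))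
        - (LINT \<xi>|circ. cnj (T \<xi>) * (f \<xi> * g \<xi>))"
      unfolding YL by (intro tendsto_intros l1 l2 l3)
    have "0 \<le> Re (LINT \<xi>|circ. Y k \<xi>)" for k
    proof -
      have "0 \<le> (LINT \<xi>|circ. (let z = of_real (R k) * \<xi> in
           3 * \<tau> * (exp (2 * real m * Re (W z) + (Re (W z))\<^sup>2 + (norm (\<Theta> z))\<^sup>2) * (norm (hardy_ext
               f z))\<^sup>2
               + exp ((norm (\<Theta> z))\<^sup>2) * (norm (hardy_ext g z))\<^sup>2)
           - Re (inverse_ext m (\<Theta> z) * (hardy_ext f z * hardy_ext g z))))"
      proof (rule circle_mean_estimate[OF hardy_ext_holomorphic[OF fL] hardy_ext_holomorphic[OF
          gL] inner_function_holomorphic[OF \<Theta>] _ g0 \<Theta>1 W01])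
        show "W holomorphic_on ball 0 1" unfolding W_def by (rule hardy_ext_holomorphic[OF wL])
      qed (use small1 small2 R \<tau> in auto)
      also have "\<dots> = (LINT \<xi>|circ. Re (Y k \<xi>))"
      proof (rule Bochner_Integration.integral_cong[OF refl])
        fix \<xi>
        have "Re (Y k \<xi>) = Re (of_real (3 * \<tau> * (exp (2 * real m * Re (W (of_real (R k) * \<xi>)) +
            (Re (W (of_real (R k) * \<xi>)))\<^sup>2 + (norm (\<Theta> (of_real (R k) * \<xi>)))\<^sup>2) * (norm (F k \<xi>))\<^sup>2
            + exp ((norm (\<Theta> (of_real (R k) * \<xi>)))\<^sup>2) * (norm (G k \<xi>))\<^sup>2)) - b3 k \<xi> * (F k \<xi> * G k
                \<xi>))"
          unfolding Y_def b1_def b2_def mult_cnj_norm by (simp only: of_real_mult of_real_add)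
        then show "(let z = of_real (R k) * \<xi> in
           3 * \<tau> * (exp (2 * real m * Re (W z) + (Re (W z))\<^sup>2 + (norm (\<Theta> z))\<^sup>2) * (norm (hardy_ext
               f z))\<^sup>2
               + exp ((norm (\<Theta> z))\<^sup>2) * (norm (hardy_ext g z))\<^sup>2)
           - Re (inverse_ext m (\<Theta> z) * (hardy_ext f z * hardy_ext g z))) = Re (Y k \<xi>)"
          unfolding Let_def by (simp only: minus_complex.sel Re_complex_of_real F_def G_def b3_def)
      qed
      also have "\<dots> = Re (LINT \<xi>|circ. Y k \<xi>)" using Yi by simp
      finally show ?thesis .
    qed
    with tendsto_Re[OF lim] have "0 \<le> Re (of_real (3 * \<tau>) * ((LINT \<xi>|circ. B1 \<xi> * (f \<xi> * cnj (f
        \<xi>))) + (LINT \<xi>|circ. of_real (exp 1) * (g \<xi> * cnj (g \<xi>))))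
        - (LINT \<xi>|circ. cnj (T \<xi>) * (f \<xi> * g \<xi>)))"
      by (intro tendsto_lowerbound[OF _ _ sequentially_bot]) auto
    also have "(LINT \<xi>|circ. B1 \<xi> * (f \<xi> * cnj (f \<xi>))) = of_real (LINT \<xi>|circ. exp (2 * real m * \<rho>
        \<xi> + (\<rho> \<xi>)\<^sup>2 + 1) * (norm (f \<xi>))\<^sup>2)"
      unfolding B1_def mult_cnj_norm of_real_mult[symmetric] by (rule integral_complex_of_real)
    also have "(LINT \<xi>|circ. of_real (exp 1) * (g \<xi> * cnj (g \<xi>))) = of_real (exp 1 * (L2_norm f)\<^sup>2)"
      unfolding integral_mult_right_zero L2_inner_def[symmetric] L2_inner_self gnorm by (simp
          only: of_real_mult)
    also have "(LINT \<xi>|circ. cnj (T \<xi>) * (f \<xi> * g \<xi>)) = of_real ((L2_norm f)\<^sup>2)"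
    proof -
      have "(LINT \<xi>|circ. cnj (T \<xi>) * (f \<xi> * g \<xi>)) = (LINT \<xi>|circ. f \<xi> * cnj (f \<xi>))"
      proof (rule integral_cong_AE)
        show "AE \<xi> in circ. cnj (T \<xi>) * (f \<xi> * g \<xi>) = f \<xi> * cnj (f \<xi>)"
          using Tn
        proof eventually_elim
          case (elim \<xi>)
          have "cnj (T \<xi>) * (f \<xi> * g \<xi>) = (T \<xi> * cnj (T \<xi>)) * (f \<xi> * cnj (f \<xi>))" by (simp add:
              g_def)
          then show ?case unfolding mult_cnj_norm[of "T \<xi>"] elim by simp
        qed
      qed (use fL gL Tm in measurable)
      then show ?thesis by (simp only: L2_inner_def[symmetric] L2_inner_self)
    qed
    finally show "(L2_norm f)\<^sup>2 \<le> 3 * \<tau> * ((LINT \<xi>|circ. exp (2 * real m * \<rho> \<xi> + (\<rho> \<xi>)\<^sup>2 + 1) *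
        (norm (f \<xi>))\<^sup>2) + exp 1 * (L2_norm f)\<^sup>2)"
      by (simp only: of_real_add[symmetric] of_real_mult[symmetric] of_real_diff[symmetric]
          Re_complex_of_real)
  qed
qed

lemma model_space_coercive:
  fixes \<rho> :: "complex \<Rightarrow> real" and \<delta> :: real
  assumes \<Theta>: "inner_function \<Theta>" and m\<rho>: "\<rho> \<in> borel_measurable circ"
    and b\<rho>: "AE \<xi> in circ. 0 \<le> \<rho> \<xi> \<and> \<rho> \<xi> \<le> 1" and \<delta>: "\<delta> > 0"
    and low: "\<And>z. norm z < 1 \<Longrightarrow> poisson_transform \<rho> z + norm (\<Theta> z) \<ge> \<delta>"
  obtains c where "c > 0" "\<And>f. f \<in> model_space \<Theta> \<Longrightarrow> c * (L2_norm f)\<^sup>2 \<le> (LINT \<xi>|circ. \<rho> \<xi> * (norm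
      (f \<xi>))\<^sup>2)"
proof -
  \<comment> \<open>With this value \<open>3 * \<tau> * (2 * exp 1) = 1/2\<close>, so half of
    \<open>(L2_norm f)\<^sup>2\<close> can be moved to the left.\<close>
  define \<tau> :: real where "\<tau> = 1 / (12 * exp 1)"
  have \<tau>: "\<tau> > 0" by (simp add: \<tau>_def)
  obtain m :: nat where m: "\<And>f. f \<in> model_space \<Theta> \<Longrightarrow>
     (L2_norm f)\<^sup>2 \<le> 3 * \<tau> * ((LINT \<xi>|circ. exp (2 * real m * \<rho> \<xi> + (\<rho> \<xi>)\<^sup>2 + 1) * (norm (f \<xi>))\<^sup>2)
         + exp 1 * (L2_norm f)\<^sup>2)"
    using model_space_estimate[OF \<Theta> m\<rho> b\<rho> \<delta> low \<tau>] by blast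
  \<comment> \<open>From \<open>exp y \<le> 1 + y * exp y\<close> with
    \<open>y = 2 * m * x + x\<^sup>2\<close>, which is at most \<open>(2 * m + 1) * x\<close> for
    \<open>x\<close> between 0 and 1.\<close>
  define C where "C = (2 * real m + 1) * exp (2 * real m + 1)"
  have C: "C > 0" by (simp add: C_def)
  have ex: "exp (2 * real m * x + x\<^sup>2 + 1) \<le> exp 1 + exp 1 * C * x" if x: "0 \<le> x" "x \<le> 1" for x ::
      real
  proof -
    define y where "y = 2 * real m * x + x\<^sup>2"
    have "x\<^sup>2 \<le> x" using x mult_left_le[of x x] by (simp add: power2_eq_square)
    then have y: "0 \<le> y" "y \<le> (2 * real m + 1) * x" using x by (auto simp: y_def algebra_simps)
    moreover have "(2 * real m + 1) * x \<le> 2 * real m + 1" by (rule mult_left_le) (use x in auto)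
    ultimately have y1: "y \<le> 2 * real m + 1" by (meson order_trans)
    have "1 - y \<le> exp (- y)" using exp_ge_add_one_self[of "- y"] by simp
    from mult_right_mono[OF this, of "exp y"] have "exp y - y * exp y \<le> 1"
      by (simp add: algebra_simps flip: exp_add)
    moreover have "y * exp y \<le> ((2 * real m + 1) * x) * exp (2 * real m + 1)"
      by (intro mult_mono) (use y y1 x in auto)
    ultimately have "exp y \<le> 1 + C * x" by (simp add: C_def algebra_simps)
    from mult_left_mono[OF this, of "exp 1"] show ?thesis
      by (simp add: y_def exp_add algebra_simps)
  qed
  define c where "c = 2 / C"
  show ?thesis
  proof (rule that[of c])
    show "c > 0" using C by (simp add: c_def)
    fix f assume f: "f \<in> model_space \<Theta>"
    have fL: "f \<in> circle_L2" by (rule L2_closed_subspace_L2[OF model_space_closed_subspace[OF \<Theta>] f])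
    note i = circle_L2_integrable[OF fL]
    have i\<rho>: "integrable circ (\<lambda>\<xi>. \<rho> \<xi> * (norm (f \<xi>))\<^sup>2)"
    proof (rule Bochner_Integration.integrable_bound[OF i])
      show "(\<lambda>\<xi>. \<rho> \<xi> * (norm (f \<xi>))\<^sup>2) \<in> borel_measurable circ" using m\<rho> fL by measurable
      show "AE x in circ. norm (\<rho> x * (norm (f x))\<^sup>2) \<le> norm ((norm (f x))\<^sup>2)"
        using b\<rho> by eventually_elim (simp add: abs_mult mult_left_le_one_le)
    qed
    have "(LINT \<xi>|circ. exp (2 * real m * \<rho> \<xi> + (\<rho> \<xi>)\<^sup>2 + 1) * (norm (f \<xi>))\<^sup>2) \<le>
       (LINT \<xi>|circ. exp 1 * (norm (f \<xi>))\<^sup>2 + exp 1 * C * (\<rho> \<xi> * (norm (f \<xi>))\<^sup>2))"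
    proof (rule integral_mono_AE)
      have le: "AE \<xi> in circ. exp (2 * real m * \<rho> \<xi> + (\<rho> \<xi>)\<^sup>2 + 1) * (norm (f \<xi>))\<^sup>2 \<le> exp 1 *
          (norm (f \<xi>))\<^sup>2 + exp 1 * C * (\<rho> \<xi> * (norm (f \<xi>))\<^sup>2)"
        using b\<rho>
      proof eventually_elim
        case (elim \<xi>)
        from mult_right_mono[OF ex[of "\<rho> \<xi>"], of "(norm (f \<xi>))\<^sup>2"] elim show ?case by (simp add:
            algebra_simps)
      qed
      then show "AE \<xi> in circ. exp (2 * real m * \<rho> \<xi> + (\<rho> \<xi>)\<^sup>2 + 1) * (norm (f \<xi>))\<^sup>2 \<le> exp 1 *
          (norm (f \<xi>))\<^sup>2 + exp 1 * C * (\<rho> \<xi> * (norm (f \<xi>))\<^sup>2)" .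
      show i2: "integrable circ (\<lambda>\<xi>. exp 1 * (norm (f \<xi>))\<^sup>2 + exp 1 * C * (\<rho> \<xi> * (norm (f \<xi>))\<^sup>2))"
        by (intro Bochner_Integration.integrable_add integrable_mult_right i i\<rho>)
      show "integrable circ (\<lambda>\<xi>. exp (2 * real m * \<rho> \<xi> + (\<rho> \<xi>)\<^sup>2 + 1) * (norm (f \<xi>))\<^sup>2)"
      proof (rule Bochner_Integration.integrable_bound[OF i2])
        show "(\<lambda>\<xi>. exp (2 * real m * \<rho> \<xi> + (\<rho> \<xi>)\<^sup>2 + 1) * (norm (f \<xi>))\<^sup>2) \<in> borel_measurable circ"
          using m\<rho> fL by measurable
        show "AE x in circ. norm (exp (2 * real m * \<rho> x + (\<rho> x)\<^sup>2 + 1) * (norm (f x))\<^sup>2) \<le> norm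
            (exp 1 * (norm (f x))\<^sup>2 + exp 1 * C * (\<rho> x * (norm (f x))\<^sup>2))"
          using le by eventually_elim simp
      qed
    qed
    also have "\<dots> = exp 1 * (L2_norm f)\<^sup>2 + exp 1 * C * (LINT \<xi>|circ. \<rho> \<xi> * (norm (f \<xi>))\<^sup>2)"
      using i i\<rho> by (simp add: L2_norm_power2)
    finally have "(LINT \<xi>|circ. exp (2 * real m * \<rho> \<xi> + (\<rho> \<xi>)\<^sup>2 + 1) * (norm (f \<xi>))\<^sup>2) + exp 1 *
        (L2_norm f)\<^sup>2
       \<le> exp 1 * (2 * (L2_norm f)\<^sup>2 + C * (LINT \<xi>|circ. \<rho> \<xi> * (norm (f \<xi>))\<^sup>2))" by (simp add:
           algebra_simps)
    from mult_left_mono[OF this, of "3 * \<tau>"] \<tau> m[OF f]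
    have "(L2_norm f)\<^sup>2 \<le> 3 * \<tau> * (exp 1 * (2 * (L2_norm f)\<^sup>2 + C * (LINT \<xi>|circ. \<rho> \<xi> * (norm (f
        \<xi>))\<^sup>2)))"
      by linarith
    also have "\<dots> = (2 * (L2_norm f)\<^sup>2 + C * (LINT \<xi>|circ. \<rho> \<xi> * (norm (f \<xi>))\<^sup>2)) / 4"
      by (simp add: \<tau>_def)
    finally have "2 * (L2_norm f)\<^sup>2 \<le> C * (LINT \<xi>|circ. \<rho> \<xi> * (norm (f \<xi>))\<^sup>2)" by simp
    then show "c * (L2_norm f)\<^sup>2 \<le> (LINT \<xi>|circ. \<rho> \<xi> * (norm (f \<xi>))\<^sup>2)"
      using C by (simp add: c_def field_simps)
  qed
qed

section \<open>Truncated Toeplitz operators\<close>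

lemma circle_Linf_bound:
  assumes "\<phi> \<in> circle_Linf"
  obtains C where "C \<ge> 1" "AE \<xi> in circ. norm (\<phi> \<xi>) \<le> C"
proof -
  obtain C where C: "AE \<xi> in circ. norm (\<phi> \<xi>) \<le> C" using assms by (auto simp: circle_Linf_def)
  show ?thesis by (rule that[of "max C 1"]) (use C in \<open>auto elim!: eventually_mono\<close>)
qed

lemma circle_Linf_mult_L2: "\<phi> \<in> circle_Linf \<Longrightarrow> f \<in> circle_L2 \<Longrightarrow> (\<lambda>\<xi>. \<phi> \<xi> * f \<xi>) \<in> circle_L2"
  by (auto simp: circle_Linf_def intro: circle_L2_mult_bounded)

text \<open>From here on the operator enters through these three facts, which hold for any
  representative that \<open>L2_proj\<close> may choose.\<close>

lemma
  assumes \<Theta>: "inner_function \<Theta>" and \<phi>: "\<phi> \<in> circle_Linf" and f: "f \<in> model_space \<Theta>"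
  shows truncated_toeplitz_in: "truncated_toeplitz \<Theta> \<phi> f \<in> model_space \<Theta>"
    and truncated_toeplitz_inner: "k \<in> model_space \<Theta> \<Longrightarrow>
      L2_inner (truncated_toeplitz \<Theta> \<phi> f) k = L2_inner (\<lambda>\<xi>. \<phi> \<xi> * f \<xi>) k"
    and truncated_toeplitz_norm_le: "L2_norm (truncated_toeplitz \<Theta> \<phi> f) \<le> L2_norm (\<lambda>\<xi>. \<phi> \<xi> * f \<xi>)"
proof -
  note K = model_space_closed_subspace[OF \<Theta>]
  have L: "(\<lambda>\<xi>. \<phi> \<xi> * f \<xi>) \<in> circle_L2" by (rule circle_Linf_mult_L2[OF \<phi> L2_closed_subspace_L2[OF
      K f]])
  show "truncated_toeplitz \<Theta> \<phi> f \<in> model_space \<Theta>"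
    unfolding truncated_toeplitz_def by (rule L2_proj_in[OF K L])
  show "L2_inner (truncated_toeplitz \<Theta> \<phi> f) k = L2_inner (\<lambda>\<xi>. \<phi> \<xi> * f \<xi>) k" if "k \<in> model_space \<Theta>"
    unfolding truncated_toeplitz_def by (rule L2_inner_proj[OF K L that])
  show "L2_norm (truncated_toeplitz \<Theta> \<phi> f) \<le> L2_norm (\<lambda>\<xi>. \<phi> \<xi> * f \<xi>)"
    unfolding truncated_toeplitz_def by (rule L2_norm_proj_le[OF K L])
qed

lemma truncated_toeplitz_bounded_operator:
  assumes \<Theta>: "inner_function \<Theta>" and \<phi>: "\<phi> \<in> circle_Linf"
  shows "bounded_operator_on (model_space \<Theta>) (truncated_toeplitz \<Theta> \<phi>)"
  unfolding bounded_operator_on_def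
proof (intro conjI ballI allI)
  let ?K = "model_space \<Theta>" and ?T = "truncated_toeplitz \<Theta> \<phi>"
  note K = model_space_closed_subspace[OF \<Theta>]
  note KL = L2_closed_subspace_L2[OF K]
  note T = truncated_toeplitz_in[OF \<Theta> \<phi>] and Ti = truncated_toeplitz_inner[OF \<Theta> \<phi>]
  note \<phi>L = circle_Linf_mult_L2[OF \<phi> KL]
  show "?T f \<in> ?K" if "f \<in> ?K" for f by (rule T[OF that])
  show "AE \<xi> in circ. ?T (\<lambda>x. f x + g x) \<xi> = ?T f \<xi> + ?T g \<xi>" if f: "f \<in> ?K" and g: "g \<in> ?K" for f g
  proof (rule AE_eq_of_inner[OF K])
    note fg = L2_closed_subspace_add[OF K f g]
    show "?T (\<lambda>x. f x + g x) \<in> ?K" by (rule T[OF fg])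
    show "(\<lambda>\<xi>. ?T f \<xi> + ?T g \<xi>) \<in> ?K" by (intro L2_closed_subspace_add[OF K] T f g)
    fix k assume k: "k \<in> ?K"
    have "L2_inner (?T (\<lambda>x. f x + g x)) k = L2_inner (\<lambda>\<xi>. \<phi> \<xi> * f \<xi> + \<phi> \<xi> * g \<xi>) k"
      using Ti[OF fg k] by (simp add: distrib_left)
    then show "L2_inner (?T (\<lambda>x. f x + g x)) k = L2_inner (\<lambda>\<xi>. ?T f \<xi> + ?T g \<xi>) k"
      by (simp add: L2_inner_add_left \<phi>L KL T f g k Ti)
  qed
  show "AE \<xi> in circ. ?T (\<lambda>x. c * f x) \<xi> = c * ?T f \<xi>" if f: "f \<in> ?K" for c f
  proof (rule AE_eq_of_inner[OF K])
    note cf = L2_closed_subspace_cmult[OF K f]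
    show "?T (\<lambda>x. c * f x) \<in> ?K" by (rule T[OF cf])
    show "(\<lambda>\<xi>. c * ?T f \<xi>) \<in> ?K" by (intro L2_closed_subspace_cmult[OF K] T f)
    fix k assume k: "k \<in> ?K"
    have "L2_inner (?T (\<lambda>x. c * f x)) k = L2_inner (\<lambda>\<xi>. c * (\<phi> \<xi> * f \<xi>)) k"
      using Ti[OF cf k] by (simp add: mult.left_commute)
    then show "L2_inner (?T (\<lambda>x. c * f x)) k = L2_inner (\<lambda>\<xi>. c * ?T f \<xi>) k"
      by (simp only: L2_inner_cmult_left Ti[OF f k])
  qed
  obtain C where C: "C \<ge> 1" "AE \<xi> in circ. norm (\<phi> \<xi>) \<le> C" by (rule circle_Linf_bound[OF \<phi>])
  show "\<exists>C. \<forall>f\<in>?K. L2_norm (?T f) \<le> C * L2_norm f"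
  proof (intro exI ballI)
    fix f assume f: "f \<in> ?K"
    have "L2_norm (?T f) \<le> L2_norm (\<lambda>\<xi>. \<phi> \<xi> * f \<xi>)" by (rule truncated_toeplitz_norm_le[OF \<Theta> \<phi> f])
    also have "\<dots> \<le> L2_norm (\<lambda>\<xi>. of_real C * f \<xi>)"
    proof (rule L2_norm_mono)
      show "AE \<xi> in circ. norm (\<phi> \<xi> * f \<xi>) \<le> norm (of_real C * f \<xi>)"
        using C(2) by eventually_elim (use C(1) in \<open>auto simp: norm_mult intro!: mult_right_mono\<close>)
      show "(\<lambda>\<xi>. \<phi> \<xi> * f \<xi>) \<in> borel_measurable circ" using \<phi>L[OF f] by measurable
      show "(\<lambda>\<xi>. of_real C * f \<xi>) \<in> circle_L2" by (intro circle_L2_cmult KL f)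
    qed
    also have "\<dots> = C * L2_norm f" unfolding L2_norm_cmult using C(1) by simp
    finally show "L2_norm (?T f) \<le> C * L2_norm f" .
  qed
qed

section \<open>Bounded operators and their inverses, up to null sets\<close>

lemma
  assumes "bounded_operator_on K T"
  shows bounded_operator_on_in: "f \<in> K \<Longrightarrow> T f \<in> K"
    and bounded_operator_on_add: "f \<in> K \<Longrightarrow> g \<in> K \<Longrightarrow> AE \<xi> in circ. T (\<lambda>x. f x + g x) \<xi> = T f \<xi> + T g \<xi>"
    and bounded_operator_on_cmult: "f \<in> K \<Longrightarrow> AE \<xi> in circ. T (\<lambda>x. a * f x) \<xi> = a * T f \<xi>"
  using assms unfolding bounded_operator_on_def by simp_all

lemma bounded_operator_diff_AE:
  assumes K: "L2_closed_subspace K" and T: "bounded_operator_on K T" and f: "f \<in> K" and g: "g \<in> K"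
  shows "AE \<xi> in circ. T (\<lambda>x. f x - g x) \<xi> = T f \<xi> - T g \<xi>"
proof -
  have mg: "(\<lambda>x. (-1) * g x) \<in> K" by (rule L2_closed_subspace_cmult[OF K g])
  have "AE \<xi> in circ. T (\<lambda>x. f x + (-1) * g x) \<xi> = T f \<xi> + T (\<lambda>x. (-1) * g x) \<xi>"
    by (rule bounded_operator_on_add[OF T f mg])
  moreover have "AE \<xi> in circ. T (\<lambda>x. (-1) * g x) \<xi> = (-1) * T g \<xi>"
    by (rule bounded_operator_on_cmult[OF T g])
  ultimately show ?thesis by eventually_elim simp
qed

lemma bounded_below_inj_AE:
  assumes K: "L2_closed_subspace K" and T: "bounded_operator_on K T" and b: "bounded_below_on K T"
    and f: "f \<in> K" and g: "g \<in> K" and eq: "AE \<xi> in circ. T f \<xi> = T g \<xi>"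
  shows "AE \<xi> in circ. f \<xi> = g \<xi>"
proof -
  note KL = L2_closed_subspace_L2[OF K]
  note d = L2_closed_subspace_diff[OF K f g]
  obtain c where c: "c > 0" "\<And>h. h \<in> K \<Longrightarrow> c * L2_norm h \<le> L2_norm (T h)"
    using b unfolding bounded_below_on_def by blast
  have Td: "T (\<lambda>x. f x - g x) \<in> K" by (rule bounded_operator_on_in[OF T d])
  have "AE \<xi> in circ. T (\<lambda>x. f x - g x) \<xi> = 0"
    using bounded_operator_diff_AE[OF K T f g] eq by eventually_elim simp
  then have "L2_norm (T (\<lambda>x. f x - g x)) = 0" using L2_norm_zero_iff[OF KL[OF Td]] by simp
  with c(2)[OF d] c(1) have "L2_norm (\<lambda>x. f x - g x) \<le> 0" by (simp add: mult_le_0_iff)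
  then have "L2_norm (\<lambda>x. f x - g x) = 0" using L2_norm_nonneg by (rule antisym)
  then show ?thesis using L2_norm_zero_iff[OF KL[OF d]] by simp
qed

text \<open>The inverse is chosen separately for each element by \<open>SOME\<close>. Its additivity
  and homogeneity up to null sets follow from the injectivity of \<open>T\<close> up to null sets,
  its boundedness from the lower bound.\<close>

lemma invertible_onI:
  assumes K: "L2_closed_subspace K" and T: "bounded_operator_on K T" and b: "bounded_below_on K T"
    and surj: "\<And>g. g \<in> K \<Longrightarrow> \<exists>h\<in>K. AE \<xi> in circ. T h \<xi> = g \<xi>"
  shows "invertible_on K T"
proof -
  note KL = L2_closed_subspace_L2[OF K]
  define S where "S g = (SOME h. h \<in> K \<and> (AE \<xi> in circ. T h \<xi> = g \<xi>))" for g
  have S: "S g \<in> K" "AE \<xi> in circ. T (S g) \<xi> = g \<xi>" if "g \<in> K" for g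
    using someI_ex[of "\<lambda>h. h \<in> K \<and> (AE \<xi> in circ. T h \<xi> = g \<xi>)"] surj[OF that]
    unfolding S_def by blast+
  have TK: "T f \<in> K" if "f \<in> K" for f by (rule bounded_operator_on_in[OF T that])
  note inj = bounded_below_inj_AE[OF K T b]
  obtain c where c: "c > 0" "\<And>h. h \<in> K \<Longrightarrow> c * L2_norm h \<le> L2_norm (T h)"
    using b unfolding bounded_below_on_def by blast
  have "bounded_operator_on K S"
    unfolding bounded_operator_on_def
  proof (intro conjI ballI allI)
    show "S f \<in> K" if "f \<in> K" for f by (rule S[OF that])
    show "AE \<xi> in circ. S (\<lambda>x. f x + g x) \<xi> = S f \<xi> + S g \<xi>" if f: "f \<in> K" and g: "g \<in> K" for f g
    proof (rule inj)
      note fg = L2_closed_subspace_add[OF K f g]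
      show "S (\<lambda>x. f x + g x) \<in> K" by (rule S[OF fg])
      show "(\<lambda>\<xi>. S f \<xi> + S g \<xi>) \<in> K" by (intro L2_closed_subspace_add[OF K] S f g)
      have "AE \<xi> in circ. T (\<lambda>\<xi>. S f \<xi> + S g \<xi>) \<xi> = T (S f) \<xi> + T (S g) \<xi>"
        by (rule bounded_operator_on_add[OF T S(1)[OF f] S(1)[OF g]])
      with S(2)[OF fg] S(2)[OF f] S(2)[OF g]
      show "AE \<xi> in circ. T (S (\<lambda>x. f x + g x)) \<xi> = T (\<lambda>\<xi>. S f \<xi> + S g \<xi>) \<xi>" by eventually_elim simp
    qed
    show "AE \<xi> in circ. S (\<lambda>x. a * f x) \<xi> = a * S f \<xi>" if f: "f \<in> K" for a f
    proof (rule inj)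
      note af = L2_closed_subspace_cmult[OF K f]
      show "S (\<lambda>x. a * f x) \<in> K" by (rule S[OF af])
      show "(\<lambda>\<xi>. a * S f \<xi>) \<in> K" by (intro L2_closed_subspace_cmult[OF K] S f)
      have "AE \<xi> in circ. T (\<lambda>\<xi>. a * S f \<xi>) \<xi> = a * T (S f) \<xi>"
        by (rule bounded_operator_on_cmult[OF T S(1)[OF f]])
      with S(2)[OF af] S(2)[OF f]
      show "AE \<xi> in circ. T (S (\<lambda>x. a * f x)) \<xi> = T (\<lambda>\<xi>. a * S f \<xi>) \<xi>" by eventually_elim simp
    qed
    show "\<exists>C. \<forall>f\<in>K. L2_norm (S f) \<le> C * L2_norm f"
    proof (intro exI ballI)
      fix f assume f: "f \<in> K"
      have "L2_norm (T (S f)) = L2_norm f"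
        by (rule L2_norm_cong_AE) (use S(2)[OF f] KL[OF TK[OF S(1)[OF f]]] KL[OF f] in \<open>auto
            elim!: eventually_mono dest: circle_L2_measurable\<close>)
      with c(2)[OF S(1)[OF f]] show "L2_norm (S f) \<le> (1 / c) * L2_norm f" using c(1) by (simp add:
          field_simps)
    qed
  qed
  moreover have "AE \<xi> in circ. S (T f) \<xi> = f \<xi>" if f: "f \<in> K" for f
    by (rule inj[OF S(1)[OF TK[OF f]] f S(2)[OF TK[OF f]]])
  ultimately show ?thesis unfolding invertible_on_def using T S(2) by blast
qed

lemma invertible_imp_bounded_below:
  assumes K: "L2_closed_subspace K" and inv: "invertible_on K T"
  shows "bounded_below_on K T"
proof -
  note KL = L2_closed_subspace_L2[OF K]
  obtain S where T: "bounded_operator_on K T" and S: "bounded_operator_on K S"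
    and ST: "\<And>f. f \<in> K \<Longrightarrow> AE \<xi> in circ. S (T f) \<xi> = f \<xi>"
    using inv unfolding invertible_on_def by blast
  obtain C where C: "\<And>f. f \<in> K \<Longrightarrow> L2_norm (S f) \<le> C * L2_norm f"
    using S unfolding bounded_operator_on_def by blast
  have TK: "T f \<in> K" and SK: "S f \<in> K" if "f \<in> K" for f
    using bounded_operator_on_in[OF T that] bounded_operator_on_in[OF S that] by simp_all
  show ?thesis
    unfolding bounded_below_on_def
  \<comment> \<open>\<open>C\<close> may be nonpositive when all elements of \<open>K\<close> are
    null, hence the maximum with 1.\<close>
  proof (intro exI[of _ "1 / max C 1"] conjI ballI)
    fix f assume f: "f \<in> K"
    have "L2_norm f = L2_norm (S (T f))"
      by (rule L2_norm_cong_AE) (use ST[OF f] KL[OF SK[OF TK[OF f]]] KL[OF f] in \<open>auto elim!: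
          eventually_mono dest: circle_L2_measurable\<close>)
    also have "\<dots> \<le> C * L2_norm (T f)" by (rule C[OF TK[OF f]])
    also have "\<dots> \<le> max C 1 * L2_norm (T f)" by (rule mult_right_mono) auto
    finally show "1 / max C 1 * L2_norm f \<le> L2_norm (T f)" by (simp add: divide_le_eq mult.commute)
  qed simp
qed

lemma Cauchy_of_geometric:
  assumes h: "\<And>n. h n \<in> circle_L2" and q: "0 \<le> q" "q < 1"
    and step: "\<And>n. L2_norm (\<lambda>\<xi>. h (Suc n) \<xi> - h n \<xi>) \<le> D * q ^ n" and e: "e > 0"
  shows "\<exists>N. \<forall>m\<ge>N. \<forall>n\<ge>N. L2_norm (\<lambda>\<xi>. h m \<xi> - h n \<xi>) \<le> e"
proof -
  have D: "D \<ge> 0" using order_trans[OF L2_norm_nonneg step[of 0]] by simp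
  \<comment> \<open>The exact geometric sum, with the factor \<open>1 - q ^ k\<close>, is the form
    that the induction on \<open>k\<close> reproduces.\<close>
  have tail: "L2_norm (\<lambda>\<xi>. h (n + k) \<xi> - h n \<xi>) \<le> D * q ^ n * (1 - q ^ k) / (1 - q)" for n k
  proof (induction k)
    case 0
    then show ?case by (simp add: L2_norm_def)
  next
    case (Suc k)
    have "L2_norm (\<lambda>\<xi>. h (n + Suc k) \<xi> - h n \<xi>) \<le> L2_norm (\<lambda>\<xi>. h (n + Suc k) \<xi> - h (n + k) \<xi>) +
        L2_norm (\<lambda>\<xi>. h (n + k) \<xi> - h n \<xi>)"
      by (rule L2_norm_diff_triangle[OF h h h])
    also have "\<dots> \<le> D * q ^ (n + k) + D * q ^ n * (1 - q ^ k) / (1 - q)"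
      using step[of "n + k"] Suc by simp
    also have "\<dots> = D * q ^ n * (1 - q ^ Suc k) / (1 - q)" using q by (simp add: field_simps
        power_add)
    finally show ?case .
  qed
  have tail': "L2_norm (\<lambda>\<xi>. h m \<xi> - h n \<xi>) \<le> D / (1 - q) * q ^ n" if "n \<le> m" for m n
  proof -
    have "D * q ^ n * (1 - q ^ (m - n)) / (1 - q) \<le> D * q ^ n * 1 / (1 - q)"
      by (intro divide_right_mono mult_left_mono) (use q D in auto)
    then show ?thesis using tail[of n "m - n"] that by simp
  qed
  have "(\<lambda>n. D / (1 - q) * q ^ n) \<longlonglongrightarrow> D / (1 - q) * 0"
    by (intro tendsto_intros LIMSEQ_power_zero) (use q in auto)
  then have "(\<lambda>n. D / (1 - q) * q ^ n) \<longlonglongrightarrow> 0" by simp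
  from order_tendstoD(2)[OF this e] obtain N where N: "\<And>n. n \<ge> N \<Longrightarrow> D / (1 - q) * q ^ n < e"
    by (auto simp: eventually_sequentially)
  show ?thesis
  proof (intro exI allI impI)
    fix m n assume mn: "m \<ge> N" "n \<ge> N"
    show "L2_norm (\<lambda>\<xi>. h m \<xi> - h n \<xi>) \<le> e"
    proof (cases "n \<le> m")
      case True
      then show ?thesis using tail'[OF True] N[OF mn(2)] by linarith
    next
      case False
      then show ?thesis using tail'[of m n] N[OF mn(1)] L2_norm_diff_commute[of "h m" "h n"] by
          linarith
    qed
  qed
qed

text \<open>
  The compression of multiplication by \<open>1 - \<rho>\<close> is a strict contraction, so the equation is solved
  by iteration.
\<close>

lemma weighted_equation_solvable:
  fixes \<rho> :: "complex \<Rightarrow> real"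
  assumes K: "L2_closed_subspace K" and m: "\<rho> \<in> borel_measurable circ"
    and b: "AE \<xi> in circ. 0 \<le> \<rho> \<xi> \<and> \<rho> \<xi> \<le> 1"
    and c: "c > 0" and coer: "\<And>f. f \<in> K \<Longrightarrow> c * (L2_norm f)\<^sup>2 \<le> (LINT \<xi>|circ. \<rho> \<xi> * (norm (f \<xi>))\<^sup>2)"
    and g: "g \<in> K"
  shows "\<exists>h\<in>K. \<forall>k\<in>K. L2_inner (\<lambda>\<xi>. of_real (\<rho> \<xi>) * h \<xi>) k = L2_inner g k"
proof -
  note KL = L2_closed_subspace_L2[OF K]
  define \<sigma> where "\<sigma> \<xi> = complex_of_real (1 - \<rho> \<xi>)" for \<xi>
  have \<sigma>m: "\<sigma> \<in> borel_measurable circ" unfolding \<sigma>_def[abs_def] using m by measurable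
  have \<sigma>b: "AE \<xi> in circ. norm (\<sigma> \<xi>) \<le> 1"
    using b unfolding \<sigma>_def norm_of_real by eventually_elim auto
  have \<sigma>L: "(\<lambda>\<xi>. \<sigma> \<xi> * f \<xi>) \<in> circle_L2" if "f \<in> circle_L2" for f
    by (rule circle_L2_mult_bounded[OF \<sigma>m \<sigma>b that])
  \<comment> \<open>The maximum covers \<open>c > 1\<close>, which is possible only if all elements
    of \<open>K\<close> are null.\<close>
  define q where "q = sqrt (max 0 (1 - c))"
  have q: "0 \<le> q" "q < 1" using c by (auto simp: q_def max_def)
  have contr: "L2_norm (\<lambda>\<xi>. \<sigma> \<xi> * f \<xi>) \<le> q * L2_norm f" if f: "f \<in> K" for f
  proof (rule power2_le_imp_le)
    note i = circle_L2_integrable[OF KL[OF f]]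
    have i\<rho>: "integrable circ (\<lambda>\<xi>. \<rho> \<xi> * (norm (f \<xi>))\<^sup>2)"
    proof (rule Bochner_Integration.integrable_bound[OF i])
      show "(\<lambda>\<xi>. \<rho> \<xi> * (norm (f \<xi>))\<^sup>2) \<in> borel_measurable circ" using m KL[OF f] by measurable
      show "AE x in circ. norm (\<rho> x * (norm (f x))\<^sup>2) \<le> norm ((norm (f x))\<^sup>2)"
        using b by eventually_elim (simp add: abs_mult mult_left_le_one_le)
    qed
    have "(L2_norm (\<lambda>\<xi>. \<sigma> \<xi> * f \<xi>))\<^sup>2 = (LINT \<xi>|circ. (norm (\<sigma> \<xi> * f \<xi>))\<^sup>2)" by (rule
        L2_norm_power2)
    also have "\<dots> \<le> (LINT \<xi>|circ. (norm (f \<xi>))\<^sup>2 - \<rho> \<xi> * (norm (f \<xi>))\<^sup>2)"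
    proof (rule integral_mono_AE)
      show "AE \<xi> in circ. (norm (\<sigma> \<xi> * f \<xi>))\<^sup>2 \<le> (norm (f \<xi>))\<^sup>2 - \<rho> \<xi> * (norm (f \<xi>))\<^sup>2"
        using b
      proof eventually_elim
        case (elim \<xi>)
        \<comment> \<open>Since \<open>1 - \<rho>\<close> lies between 0 and 1, its square is no
          larger, and the coercive integral is gained in full.\<close>
        then have "(1 - \<rho> \<xi>)\<^sup>2 \<le> 1 - \<rho> \<xi>" using mult_left_le[of "1 - \<rho> \<xi>" "1 - \<rho> \<xi>"] by (simp add:
            power2_eq_square)
        from mult_right_mono[OF this, of "(norm (f \<xi>))\<^sup>2"]
        show ?case unfolding \<sigma>_def norm_mult norm_of_real by (simp add: power_mult_distrib
            left_diff_distrib)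
      qed
      show "integrable circ (\<lambda>\<xi>. (norm (\<sigma> \<xi> * f \<xi>))\<^sup>2)" by (rule circle_L2_integrable[OF \<sigma>L[OF
          KL[OF f]]])
    qed (use i i\<rho> in simp)
    also have "\<dots> = (L2_norm f)\<^sup>2 - (LINT \<xi>|circ. \<rho> \<xi> * (norm (f \<xi>))\<^sup>2)"
      using i i\<rho> by (simp add: L2_norm_power2)
    also have "\<dots> \<le> (1 - c) * (L2_norm f)\<^sup>2" using coer[OF f] by (simp add: left_diff_distrib)
    also have "\<dots> \<le> max 0 (1 - c) * (L2_norm f)\<^sup>2" by (rule mult_right_mono) auto
    also have "\<dots> = (q * L2_norm f)\<^sup>2" by (simp add: q_def power_mult_distrib)
    finally show "(L2_norm (\<lambda>\<xi>. \<sigma> \<xi> * f \<xi>))\<^sup>2 \<le> (q * L2_norm f)\<^sup>2" .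
  qed (use q in simp)
  define R where "R f = L2_proj K (\<lambda>\<xi>. \<sigma> \<xi> * f \<xi>)" for f
  have RK: "R f \<in> K" if "f \<in> K" for f unfolding R_def by (rule L2_proj_in[OF K \<sigma>L[OF KL[OF that]]])
  have Ri: "L2_inner (R f) k = L2_inner (\<lambda>\<xi>. \<sigma> \<xi> * f \<xi>) k" if "f \<in> K" "k \<in> K" for f k
    unfolding R_def by (rule L2_inner_proj[OF K \<sigma>L[OF KL[OF that(1)]] that(2)])
  have Rdiff: "L2_norm (\<lambda>\<xi>. R f \<xi> - R f' \<xi>) \<le> q * L2_norm (\<lambda>\<xi>. f \<xi> - f' \<xi>)" if f: "f \<in> K" "f' \<in> K"
      for f f'
  proof -
    note d = L2_closed_subspace_diff[OF K f]
    have "L2_norm (\<lambda>\<xi>. R f \<xi> - R f' \<xi>) \<le> L2_norm (\<lambda>\<xi>. \<sigma> \<xi> * (f \<xi> - f' \<xi>))"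
    proof (rule L2_norm_le_of_inner[OF K L2_closed_subspace_diff[OF K RK[OF f(1)] RK[OF f(2)]]
        \<sigma>L[OF KL[OF d]]])
      fix k assume k: "k \<in> K"
      have "L2_inner (\<lambda>\<xi>. \<sigma> \<xi> * (f \<xi> - f' \<xi>)) k = L2_inner (\<lambda>\<xi>. \<sigma> \<xi> * f \<xi>) k - L2_inner (\<lambda>\<xi>. \<sigma> \<xi> *
          f' \<xi>) k"
        unfolding right_diff_distrib by (rule L2_inner_diff_left) (intro \<sigma>L KL f k)+
      moreover have "L2_inner (\<lambda>\<xi>. R f \<xi> - R f' \<xi>) k = L2_inner (R f) k - L2_inner (R f') k"
        by (rule L2_inner_diff_left) (intro KL RK f k)+
      ultimately show "L2_inner (\<lambda>\<xi>. R f \<xi> - R f' \<xi>) k = L2_inner (\<lambda>\<xi>. \<sigma> \<xi> * (f \<xi> - f' \<xi>)) k"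
        by (simp add: Ri f k)
    qed
    also have "\<dots> \<le> q * L2_norm (\<lambda>\<xi>. f \<xi> - f' \<xi>)" by (rule contr[OF d])
    finally show ?thesis .
  qed
  \<comment> \<open>Fixed-point iteration for \<open>h = g + R h\<close>. As \<open>R\<close>
    compresses multiplication by \<open>1 - \<rho>\<close>, a fixed point satisfies the required
    weak equation.\<close>
  define h where "h = rec_nat (\<lambda>_. 0) (\<lambda>_ f \<xi>. g \<xi> + R f \<xi>)"
  have h0: "h 0 = (\<lambda>_. 0)" and hS: "h (Suc n) = (\<lambda>\<xi>. g \<xi> + R (h n) \<xi>)" for n by (simp_all add:
      h_def)
  have hK: "h n \<in> K" for n
    by (induction n) (auto simp: h0 hS intro: L2_closed_subspace_zero[OF K]
        L2_closed_subspace_add[OF K] g RK)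
  have hL: "h n \<in> circle_L2" for n by (rule KL[OF hK])
  define D where "D = L2_norm (\<lambda>\<xi>. h (Suc 0) \<xi> - h 0 \<xi>)"
  have step: "L2_norm (\<lambda>\<xi>. h (Suc n) \<xi> - h n \<xi>) \<le> D * q ^ n" for n
  proof (induction n)
    case 0
    then show ?case by (simp add: D_def)
  next
    case (Suc n)
    have "(\<lambda>\<xi>. h (Suc (Suc n)) \<xi> - h (Suc n) \<xi>) = (\<lambda>\<xi>. R (h (Suc n)) \<xi> - R (h n) \<xi>)" by (simp add:
        hS)
    then have "L2_norm (\<lambda>\<xi>. h (Suc (Suc n)) \<xi> - h (Suc n) \<xi>) \<le> q * L2_norm (\<lambda>\<xi>. h (Suc n) \<xi> - h n
        \<xi>)"
      using Rdiff[OF hK[of "Suc n"] hK[of n]] by (simp only:)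
    also have "\<dots> \<le> q * (D * q ^ n)" by (rule mult_left_mono[OF Suc q(1)])
    finally show ?case by (simp add: mult_ac)
  qed
  obtain p where p: "p \<in> circle_L2" "(\<lambda>n. L2_norm (\<lambda>\<xi>. h n \<xi> - p \<xi>)) \<longlonglongrightarrow> 0"
    using L2_complete[OF hL Cauchy_of_geometric[OF hL q step]] by blast
  have pK: "p \<in> K" by (rule L2_closed_subspace_limit[OF K hK p])
  show ?thesis
  proof (intro bexI[OF _ pK] ballI)
    fix k assume k: "k \<in> K"
    note kL = KL[OF k]
    have ck: "(\<lambda>\<xi>. \<sigma> \<xi> * cnj (k \<xi>)) \<in> circle_L2" by (intro \<sigma>L circle_L2_cnj kL)
    \<comment> \<open>Moving \<open>\<sigma>\<close> to the test function leaves \<open>h n\<close>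
      alone in the integral, so its norm convergence gives the limit.\<close>
    have eq: "L2_inner (h (Suc n)) k = L2_inner g k + (LINT \<xi>|circ. h n \<xi> * (\<sigma> \<xi> * cnj (k \<xi>)))"
        for n
    proof -
      have "L2_inner (h (Suc n)) k = L2_inner g k + L2_inner (R (h n)) k"
        unfolding hS by (rule L2_inner_add_left) (intro KL g RK hK k)+
      moreover have "L2_inner (R (h n)) k = (LINT \<xi>|circ. h n \<xi> * (\<sigma> \<xi> * cnj (k \<xi>)))"
        by (subst Ri[OF hK k]) (simp only: L2_inner_def mult_ac)
      ultimately show ?thesis by simp
    qed
    have l1: "(\<lambda>n. L2_inner (h (Suc n)) k) \<longlonglongrightarrow> L2_inner p k"
      unfolding L2_inner_def by (rule LIMSEQ_Suc[OF L2_integral_mult_tendsto[OF hL p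
          circle_L2_cnj[OF kL]]])
    have l2: "(\<lambda>n. L2_inner (h (Suc n)) k) \<longlonglongrightarrow> L2_inner g k + (LINT \<xi>|circ. p \<xi> * (\<sigma> \<xi> * cnj (k \<xi>)))"
      unfolding eq by (intro tendsto_intros L2_integral_mult_tendsto[OF hL p ck])
    have "L2_inner p k = L2_inner g k + L2_inner (\<lambda>\<xi>. \<sigma> \<xi> * p \<xi>) k"
      using LIMSEQ_unique[OF l1 l2] by (simp add: L2_inner_def mult_ac)
    moreover have "L2_inner (\<lambda>\<xi>. of_real (\<rho> \<xi>) * p \<xi>) k = L2_inner (\<lambda>\<xi>. p \<xi> - \<sigma> \<xi> * p \<xi>) k"
      by (simp add: \<sigma>_def algebra_simps)
    moreover have "L2_inner (\<lambda>\<xi>. p \<xi> - \<sigma> \<xi> * p \<xi>) k = L2_inner p k - L2_inner (\<lambda>\<xi>. \<sigma> \<xi> * p \<xi>) k"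
      by (rule L2_inner_diff_left[OF p(1) \<sigma>L[OF p(1)] kL])
    ultimately show "L2_inner (\<lambda>\<xi>. of_real (\<rho> \<xi>) * p \<xi>) k = L2_inner g k" by simp
  qed
qed

text \<open>\<open>k\<close> is the reproducing kernel of the model space at \<open>z\<close>. The
  weak lower bound for its norm comes from pairing \<open>k\<close> with a Cauchy kernel, and it
  suffices where \<open>norm (\<Theta> z)\<close> stays away from 1.\<close>

lemma model_space_kernel:
  assumes \<Theta>: "inner_function \<Theta>" and z: "norm z < 1"
  defines "k \<equiv> \<lambda>\<xi>. (1 - cnj (\<Theta> z) * radial_limit \<Theta> \<xi>) * (1 / (1 - cnj z * \<xi>))"
  shows "k \<in> model_space \<Theta>"
    and "(1 - (norm (\<Theta> z))\<^sup>2)\<^sup>2 \<le> (1 - (norm z)\<^sup>2) * (L2_norm k)\<^sup>2"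
proof -
  define T where "T = radial_limit \<Theta>"
  define c where "c = cnj (\<Theta> z)"
  define a where "a \<xi> = \<xi> ^ 0 - c * T \<xi>" for \<xi>
  have k_eq: "k = (\<lambda>\<xi>. a \<xi> * (1 / (1 - cnj z * \<xi>)))" by (simp add: k_def a_def c_def T_def)
  note TH = inner_radial_H2[OF \<Theta>, folded T_def] and Tn = inner_radial_norm[OF \<Theta>, folded T_def]
    and Tm = inner_radial_measurable[OF \<Theta>, folded T_def]
  have aH: "a \<in> hardy_H2" unfolding a_def[abs_def]
    by (intro L2_closed_subspace_diff[OF hardy_H2_closed_subspace] L2_closed_subspace_cmult[OF
        hardy_H2_closed_subspace] TH hardy_H2_power)
  note aL = hardy_H2_L2[OF aH]
  have kL: "k \<in> circle_L2" unfolding k_eq by (rule integrable_mult_kernel(2)[OF aL z])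
  have kH: "k \<in> hardy_H2"
  proof -
    have "(LINT \<xi>|circ. k \<xi> * \<xi> ^ n) = 0" if "n \<ge> 1" for n
      using hardy_H2_kernel_integral_zero[OF aH z that] by (simp add: k_eq mult_ac)
    then show ?thesis using kL by (simp add: hardy_H2_def)
  qed
  \<comment> \<open>By \<open>inner_mult_Cauchy\<close> the conjugated inner product is a difference
    of two integrals that both equal \<open>\<Theta> z * hardy_ext g z\<close>.\<close>
  have orth: "L2_inner k (\<lambda>\<xi>. T \<xi> * g \<xi>) = 0" if g: "g \<in> hardy_H2" for g
  proof -
    note gL = hardy_H2_L2[OF g]
    note kg = integrable_mult_kernel(1)[OF gL z]
    have i1: "integrable circ (\<lambda>\<xi>. g \<xi> * (1 / (1 - z * cnj \<xi>)) * T \<xi>)"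
      by (rule circle_L2_integrable_mult[OF kg hardy_H2_L2[OF TH]])
    have i2: "integrable circ (\<lambda>\<xi>. \<Theta> z * (g \<xi> * (1 / (1 - z * cnj \<xi>))))"
      by (intro integrable_mult_right circle_L2_imp_integrable kg)
    have "cnj (L2_inner k (\<lambda>\<xi>. T \<xi> * g \<xi>)) = (LINT \<xi>|circ. cnj (k \<xi>) * (T \<xi> * g \<xi>))"
      unfolding L2_inner_def Bochner_Integration.integral_cnj[symmetric] by simp
    also have "\<dots> = (LINT \<xi>|circ. g \<xi> * (1 / (1 - z * cnj \<xi>)) * T \<xi> - \<Theta> z * (g \<xi> * (1 / (1 - z *
        cnj \<xi>))))"
    proof (rule integral_cong_AE)
      show "AE \<xi> in circ. cnj (k \<xi>) * (T \<xi> * g \<xi>) = g \<xi> * (1 / (1 - z * cnj \<xi>)) * T \<xi> - \<Theta> z * (g \<xi>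
          * (1 / (1 - z * cnj \<xi>)))"
        using Tn
      proof eventually_elim
        case (elim \<xi>)
        have 1: "T \<xi> * cnj (T \<xi>) = 1" unfolding mult_cnj_norm elim by simp
        have "cnj (k \<xi>) * (T \<xi> * g \<xi>) = (T \<xi> - \<Theta> z * (T \<xi> * cnj (T \<xi>))) * (g \<xi> * (1 / (1 - z * cnj
            \<xi>)))"
        proof -
          define E where "E = 1 / (1 - z * cnj \<xi>)"
          have k: "cnj (k \<xi>) = (1 - \<Theta> z * cnj (T \<xi>)) * E" by (simp add: k_eq a_def c_def E_def)
          show ?thesis unfolding E_def[symmetric] k by (simp add: algebra_simps)
        qed
        then show ?case unfolding 1 by (simp add: algebra_simps diff_divide_distrib)
      qed
      show "(\<lambda>\<xi>. cnj (k \<xi>) * (T \<xi> * g \<xi>)) \<in> borel_measurable circ" using kL Tm gL by measurable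
      show "(\<lambda>\<xi>. g \<xi> * (1 / (1 - z * cnj \<xi>)) * T \<xi> - \<Theta> z * (g \<xi> * (1 / (1 - z * cnj \<xi>)))) \<in>
          borel_measurable circ"
        using Bochner_Integration.integrable_diff[OF i1 i2] by (rule borel_measurable_integrable)
    qed
    also have "\<dots> = (LINT \<xi>|circ. g \<xi> * (1 / (1 - z * cnj \<xi>)) * T \<xi>) - \<Theta> z * (LINT \<xi>|circ. g \<xi> * (1
        / (1 - z * cnj \<xi>)))"
      unfolding integral_mult_right_zero[symmetric] by (rule Bochner_Integration.integral_diff[OF
          i1 i2])
    also have "\<dots> = 0"
      unfolding T_def inner_mult_Cauchy[OF \<Theta> g z] hardy_ext_eq_Cauchy[OF gL z, symmetric] by simp
    finally show ?thesis by simp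
  qed
  show "k \<in> model_space \<Theta>" using kH orth by (simp add: model_space_def T_def)
  \<comment> \<open>On the circle \<open>e\<close> is the conjugate of the Cauchy factor of
    \<open>k\<close>, so \<open>k * e\<close> is \<open>a\<close> times the Poisson kernel divided
    by \<open>s\<close>; its integral is the Poisson extension of \<open>a\<close> at
    \<open>z\<close>, up to the same factor.\<close>
  define e where "e \<xi> = 1 / (1 - z * cnj \<xi>)" for \<xi>
  have eL: "e \<in> circle_L2" using integrable_mult_kernel(1)[OF circle_L2_const[of 1] z] by (simp
      add: e_def[abs_def])
  define s where "s = 1 - (norm z)\<^sup>2"
  have s: "s > 0" using z by (simp add: s_def abs_square_less_1)
  have P: "(1 / (1 - cnj z * \<xi>)) * e \<xi> = of_real (poisson_kernel z \<xi> / s)" for \<xi>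
  proof -
    have "(1 - cnj z * \<xi>) * (1 - z * cnj \<xi>) = of_real ((norm (1 - \<xi> * cnj z))\<^sup>2)"
      unfolding mult_cnj_norm[symmetric] by (simp add: algebra_simps)
    then have "(1 / (1 - cnj z * \<xi>)) * e \<xi> = 1 / of_real ((norm (1 - \<xi> * cnj z))\<^sup>2)" by (simp add:
        e_def)
    also have "\<dots> = of_real (poisson_kernel z \<xi> / s)" using s by (simp add: poisson_kernel_def
        s_def[symmetric])
    finally show ?thesis .
  qed
  have en: "(L2_norm e)\<^sup>2 = 1 / s"
  proof -
    have "(norm (e \<xi>))\<^sup>2 = poisson_kernel z \<xi> / s" for \<xi>
    proof -
      have "norm (1 - z * cnj \<xi>) = norm (1 - \<xi> * cnj z)"
        using complex_mod_cnj[of "1 - \<xi> * cnj z"] by (simp add: mult.commute)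
      then show ?thesis using s by (simp add: e_def norm_divide power_divide poisson_kernel_def
          s_def[symmetric])
    qed
    then show ?thesis unfolding L2_norm_power2 using poisson_kernel_integral(2)[OF z] by simp
  qed
  have "(LINT \<xi>|circ. k \<xi> * e \<xi>) = (LINT \<xi>|circ. a \<xi> * of_real (poisson_kernel z \<xi>) * of_real (1 /
      s))"
  proof (rule Bochner_Integration.integral_cong[OF refl])
    fix \<xi>
    have "k \<xi> * e \<xi> = a \<xi> * ((1 / (1 - cnj z * \<xi>)) * e \<xi>)" by (simp add: k_eq)
    then show "k \<xi> * e \<xi> = a \<xi> * of_real (poisson_kernel z \<xi>) * of_real (1 / s)" unfolding P by simp
  qed
  also have "\<dots> = (LINT \<xi>|circ. a \<xi> * of_real (poisson_kernel z \<xi>)) * of_real (1 / s)" by (rule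
      integral_mult_left_zero)
  also have "(LINT \<xi>|circ. a \<xi> * of_real (poisson_kernel z \<xi>)) = 1 - c * \<Theta> z"
  proof -
    note i1 = hardy_ext_Poisson(1)[OF hardy_H2_power[of 0] z] and i2 = integrable_mult_right[OF
        hardy_ext_Poisson(1)[OF TH z], of c]
    have "(LINT \<xi>|circ. a \<xi> * of_real (poisson_kernel z \<xi>)) = (LINT \<xi>|circ. \<xi> ^ 0 * of_real
        (poisson_kernel z \<xi>) - c * (T \<xi> * of_real (poisson_kernel z \<xi>)))"
      by (simp add: a_def algebra_simps)
    also have "\<dots> = (LINT \<xi>|circ. \<xi> ^ 0 * of_real (poisson_kernel z \<xi>)) - c * (LINT \<xi>|circ. T \<xi> *
        of_real (poisson_kernel z \<xi>))"
      unfolding integral_mult_right_zero[symmetric] by (rule Bochner_Integration.integral_diff[OF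
          i1 i2])
    also have "(LINT \<xi>|circ. T \<xi> * of_real (poisson_kernel z \<xi>)) = \<Theta> z"
      using hardy_ext_Poisson(2)[OF TH z] hardy_ext_inner[OF \<Theta> z] by (simp add: T_def)
    also have "(LINT \<xi>|circ. \<xi> ^ 0 * of_real (poisson_kernel z \<xi>)) = 1"
      using poisson_kernel_integral[OF z] by simp
    finally show ?thesis .
  qed
  also have "1 - c * \<Theta> z = of_real (1 - (norm (\<Theta> z))\<^sup>2)"
    unfolding c_def mult.commute[of "cnj _"] mult_cnj_norm by simp
  finally have ke: "(LINT \<xi>|circ. k \<xi> * e \<xi>) = of_real ((1 - (norm (\<Theta> z))\<^sup>2) / s)"
    by (simp only: of_real_mult[symmetric] times_divide_eq_right mult_1_right)
  have "norm (LINT \<xi>|circ. k \<xi> * e \<xi>) = (1 - (norm (\<Theta> z))\<^sup>2) / s"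
    unfolding ke norm_of_real using s inner_norm_le_1[OF \<Theta> z] by (simp add: power_le_one)
  with L2_Cauchy_Schwarz_mult[OF kL eL] have "(1 - (norm (\<Theta> z))\<^sup>2) / s \<le> L2_norm k * L2_norm e" by
      simp
  then have "((1 - (norm (\<Theta> z))\<^sup>2) / s)\<^sup>2 \<le> (L2_norm k * L2_norm e)\<^sup>2"
    by (rule power_mono) (use s inner_norm_le_1[OF \<Theta> z] in \<open>simp add: power_le_one\<close>)
  then have "(1 - (norm (\<Theta> z))\<^sup>2)\<^sup>2 / s\<^sup>2 \<le> (L2_norm k)\<^sup>2 / s"
    unfolding power_mult_distrib en power_divide by simp
  from mult_left_mono[OF this, of "s\<^sup>2"]
  show "(1 - (norm (\<Theta> z))\<^sup>2)\<^sup>2 \<le> (1 - (norm z)\<^sup>2) * (L2_norm k)\<^sup>2"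
    unfolding s_def[symmetric] using s by (simp add: power2_eq_square[of s])
qed

section \<open>Necessity and sufficiency of the lower bound\<close>

lemma poisson_transform_nonneg:
  "norm z < 1 \<Longrightarrow> 0 \<le> poisson_transform (\<lambda>\<xi>. norm (\<phi> \<xi>)) z"
  unfolding poisson_transform_def poisson_kernel_def[symmetric]
  by (rule integral_nonneg_AE) (simp add: poisson_kernel_nonneg)

text \<open>Of the two factors in \<open>(norm (\<phi> \<xi>))\<^sup>2\<close> one is estimated by
  the essential bound \<open>C\<close>, the other is kept to form the Poisson transform. The
  numerator of the reproducing kernel has modulus at most 2, which gives the factor 4.\<close>

lemma bounded_below_imp_lower_bound:
  assumes \<phi>: "\<phi> \<in> circle_Linf" and \<Theta>: "inner_function \<Theta>"
    and bb: "bounded_below_on (model_space \<Theta>) (truncated_toeplitz \<Theta> \<phi>)"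
  shows "\<exists>\<delta>>0. \<forall>z\<in>ball 0 1. poisson_transform (\<lambda>\<xi>. norm (\<phi> \<xi>)) z + norm (\<Theta> z) \<ge> \<delta>"
proof -
  obtain c where c: "c > 0" "\<And>f. f \<in> model_space \<Theta> \<Longrightarrow> c * L2_norm f \<le> L2_norm (truncated_toeplitz \<Theta>
      \<phi> f)"
    using bb unfolding bounded_below_on_def by blast
  obtain C where C: "C \<ge> 1" "AE \<xi> in circ. norm (\<phi> \<xi>) \<le> C" by (rule circle_Linf_bound[OF \<phi>])
  have \<phi>m: "\<phi> \<in> borel_measurable circ" using \<phi> by (simp add: circle_Linf_def)
  have main: "c\<^sup>2 * (1 - (norm (\<Theta> z))\<^sup>2)\<^sup>2 \<le> 4 * C * poisson_transform (\<lambda>\<xi>. norm (\<phi> \<xi>)) z" if z: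
      "norm z < 1" for z
  proof -
    define k where "k \<xi> = (1 - cnj (\<Theta> z) * radial_limit \<Theta> \<xi>) * (1 / (1 - cnj z * \<xi>))" for \<xi>
    have kK: "k \<in> model_space \<Theta>" and kn: "(1 - (norm (\<Theta> z))\<^sup>2)\<^sup>2 \<le> (1 - (norm z)\<^sup>2) * (L2_norm k)\<^sup>2"
      using model_space_kernel[OF \<Theta> z] unfolding k_def[abs_def] by auto
    have kL: "k \<in> circle_L2" by (rule L2_closed_subspace_L2[OF model_space_closed_subspace[OF \<Theta>]
        kK])
    define s where "s = 1 - (norm z)\<^sup>2"
    have s: "s > 0" using z by (simp add: s_def abs_square_less_1)
    have "c * L2_norm k \<le> L2_norm (\<lambda>\<xi>. \<phi> \<xi> * k \<xi>)"
      using c(2)[OF kK] truncated_toeplitz_norm_le[OF \<Theta> \<phi> kK] by linarith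
    then have "(c * L2_norm k)\<^sup>2 \<le> (L2_norm (\<lambda>\<xi>. \<phi> \<xi> * k \<xi>))\<^sup>2" by (rule power_mono) (use c(1) in
        simp)
    also have "\<dots> = (LINT \<xi>|circ. (norm (\<phi> \<xi> * k \<xi>))\<^sup>2)" by (rule L2_norm_power2)
    also have "\<dots> \<le> (LINT \<xi>|circ. (4 * C / s) * (poisson_kernel z \<xi> * norm (\<phi> \<xi>)))"
    proof (rule integral_mono_AE)
      show "integrable circ (\<lambda>\<xi>. (norm (\<phi> \<xi> * k \<xi>))\<^sup>2)"
        by (rule circle_L2_integrable[OF circle_Linf_mult_L2[OF \<phi> kL]])
      have "integrable circ (\<lambda>\<xi>. C * poisson_kernel z \<xi>)" using poisson_kernel_integral[OF z] by
          simp
      then have "integrable circ (\<lambda>\<xi>. poisson_kernel z \<xi> * norm (\<phi> \<xi>))"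
      proof (rule Bochner_Integration.integrable_bound)
        show "(\<lambda>\<xi>. poisson_kernel z \<xi> * norm (\<phi> \<xi>)) \<in> borel_measurable circ"
          using \<phi>m borel_measurable_circle_kernel(3)[OF z] by measurable
        show "AE x in circ. norm (poisson_kernel z x * norm (\<phi> x)) \<le> norm (C * poisson_kernel z x)"
          using C(2) by eventually_elim (use C(1) in \<open>simp add: abs_mult mult.commute
              mult_right_mono\<close>)
      qed
      then show "integrable circ (\<lambda>\<xi>. (4 * C / s) * (poisson_kernel z \<xi> * norm (\<phi> \<xi>)))" by (rule
          integrable_mult_right)
      show "AE \<xi> in circ. (norm (\<phi> \<xi> * k \<xi>))\<^sup>2 \<le> (4 * C / s) * (poisson_kernel z \<xi> * norm (\<phi> \<xi>))"
        using C(2) inner_radial_norm[OF \<Theta>]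
      proof eventually_elim
        case (elim \<xi>)
        have "norm (1 - cnj (\<Theta> z) * radial_limit \<Theta> \<xi>) \<le> 1 + norm (\<Theta> z) * 1"
          using norm_triangle_ineq4[of 1 "cnj (\<Theta> z) * radial_limit \<Theta> \<xi>"] elim(2) by (simp add:
              norm_mult)
        then have "norm (1 - cnj (\<Theta> z) * radial_limit \<Theta> \<xi>) \<le> 2" using inner_norm_le_1[OF \<Theta> z] by
            simp
        then have a: "(norm (1 - cnj (\<Theta> z) * radial_limit \<Theta> \<xi>))\<^sup>2 \<le> 2\<^sup>2" by (rule power_mono) simp
        have p: "(norm (1 / (1 - cnj z * \<xi>)))\<^sup>2 = poisson_kernel z \<xi> / s"
          using s by (simp add: norm_divide power_divide poisson_kernel_def s_def[symmetric]
              mult.commute)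
        have "(norm (\<phi> \<xi> * k \<xi>))\<^sup>2 = (norm (\<phi> \<xi>) * norm (\<phi> \<xi>)) * ((norm (1 - cnj (\<Theta> z) *
            radial_limit \<Theta> \<xi>))\<^sup>2 * (poisson_kernel z \<xi> / s))"
          unfolding k_def norm_mult power_mult_distrib p by (simp add: power2_eq_square)
        also have "\<dots> \<le> (C * norm (\<phi> \<xi>)) * (2\<^sup>2 * (poisson_kernel z \<xi> / s))"
          by (intro mult_mono elim(1) a mult_nonneg_nonneg divide_nonneg_pos) (use C(1) s
              poisson_kernel_nonneg[OF z] in auto)
        finally show ?case by (simp add: mult_ac)
      qed
    qed
    also have "\<dots> = (4 * C / s) * poisson_transform (\<lambda>\<xi>. norm (\<phi> \<xi>)) z"
      unfolding poisson_transform_def poisson_kernel_def real_scaleR_def by (rule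
          integral_mult_right_zero)
    finally have "s * (c\<^sup>2 * (L2_norm k)\<^sup>2) \<le> 4 * C * poisson_transform (\<lambda>\<xi>. norm (\<phi> \<xi>)) z"
      using s by (simp add: field_simps power_mult_distrib)
    moreover have "c\<^sup>2 * (1 - (norm (\<Theta> z))\<^sup>2)\<^sup>2 \<le> c\<^sup>2 * (s * (L2_norm k)\<^sup>2)"
      by (rule mult_left_mono) (use kn in \<open>simp_all add: s_def\<close>)
    ultimately show ?thesis by (simp add: mult_ac)
  qed
  \<comment> \<open>Either \<open>norm (\<Theta> z) \<ge> 1/2\<close>, or \<open>(1 - (norm
    (\<Theta> z))\<^sup>2)\<^sup>2 \<ge> 9/16 \<ge> 1/2\<close> and the main estimate bounds
    \<open>c\<^sup>2 / 2\<close> by \<open>4 * C\<close> times the Poisson transform.\<close>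
  define \<delta> where "\<delta> = min (1/2) (c\<^sup>2 / (8 * C))"
  have "\<delta> \<le> poisson_transform (\<lambda>\<xi>. norm (\<phi> \<xi>)) z + norm (\<Theta> z)" if z: "norm z < 1" for z
  proof (cases "norm (\<Theta> z) \<ge> 1/2")
    case True
    then show ?thesis using poisson_transform_nonneg[OF z, of \<phi>] by (simp add: \<delta>_def)
  next
    case False
    then have "(norm (\<Theta> z))\<^sup>2 \<le> (1/2)\<^sup>2" by (intro power_mono) auto
    then have "(3/4)\<^sup>2 \<le> (1 - (norm (\<Theta> z))\<^sup>2)\<^sup>2" by (intro power_mono) (auto simp: power2_eq_square)
    then have "1/2 \<le> (1 - (norm (\<Theta> z))\<^sup>2)\<^sup>2" by (simp add: power2_eq_square)
    from mult_left_mono[OF this, of "c\<^sup>2"] main[OF z] have "c\<^sup>2 / 2 \<le> 4 * C * poisson_transform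
        (\<lambda>\<xi>. norm (\<phi> \<xi>)) z" by simp
    then have "c\<^sup>2 / (8 * C) \<le> poisson_transform (\<lambda>\<xi>. norm (\<phi> \<xi>)) z" using C(1) by (simp add:
        field_simps)
    moreover have "\<delta> \<le> c\<^sup>2 / (8 * C)" by (simp only: \<delta>_def min.cobounded2)
    ultimately show ?thesis using norm_ge_zero[of "\<Theta> z"] by linarith
  qed
  moreover have "\<delta> > 0" using c(1) C(1) by (simp add: \<delta>_def)
  ultimately show ?thesis by (intro exI[of _ \<delta>]) auto
qed

text \<open>Coercivity of the quadratic form with weight \<open>\<rho>\<close> yields the lower
  bound by Cauchy-Schwarz and surjectivity by \<open>weighted_equation_solvable\<close>. The
  constant \<open>M\<close> brings the symbol into the unit interval and is restored through
  \<open>Ti\<close>.\<close>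

lemma lower_bound_imp_invertible:
  assumes \<phi>: "\<phi> \<in> circle_Linf" and \<Theta>: "inner_function \<Theta>"
    and pos: "AE \<xi> in circ. \<phi> \<xi> \<in> \<real>\<^sub>\<ge>\<^sub>0" and \<delta>: "\<delta> > 0"
    and low: "\<And>z. norm z < 1 \<Longrightarrow> poisson_transform (\<lambda>\<xi>. norm (\<phi> \<xi>)) z + norm (\<Theta> z) \<ge> \<delta>"
  shows "invertible_on (model_space \<Theta>) (truncated_toeplitz \<Theta> \<phi>)"
proof -
  let ?K = "model_space \<Theta>" and ?T = "truncated_toeplitz \<Theta> \<phi>"
  note K = model_space_closed_subspace[OF \<Theta>]
  note KL = L2_closed_subspace_L2[OF K]
  obtain M where M: "M \<ge> 1" "AE \<xi> in circ. norm (\<phi> \<xi>) \<le> M" by (rule circle_Linf_bound[OF \<phi>])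
  have \<phi>m: "\<phi> \<in> borel_measurable circ" using \<phi> by (simp add: circle_Linf_def)
  define \<rho> where "\<rho> \<xi> = norm (\<phi> \<xi>) / M" for \<xi>
  have \<rho>m: "\<rho> \<in> borel_measurable circ" unfolding \<rho>_def[abs_def] using \<phi>m by measurable
  have \<rho>b: "AE \<xi> in circ. 0 \<le> \<rho> \<xi> \<and> \<rho> \<xi> \<le> 1"
    using M(2) by eventually_elim (use M(1) in \<open>auto simp: \<rho>_def\<close>)
  have \<phi>\<rho>: "AE \<xi> in circ. \<phi> \<xi> = of_real M * of_real (\<rho> \<xi>)"
    using pos
  proof eventually_elim
    case (elim \<xi>)
    then obtain r where r: "r \<ge> 0" "\<phi> \<xi> = of_real r" by (rule nonneg_Reals_cases)
    then show ?case using M(1) by (simp add: \<rho>_def)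
  qed
  \<comment> \<open>Scaling divides the Poisson transform by \<open>M\<close> and leaves
    \<open>\<Theta>\<close> as it is; since \<open>M \<ge> 1\<close>, the sum drops at most by the
    factor \<open>M\<close>.\<close>
  have low': "poisson_transform \<rho> z + norm (\<Theta> z) \<ge> \<delta> / M" if z: "norm z < 1" for z
  proof -
    have "poisson_transform \<rho> z = poisson_transform (\<lambda>\<xi>. norm (\<phi> \<xi>)) z / M"
    proof -
      have "poisson_transform \<rho> z = (LINT \<xi>|circ. (((1 - (norm z)\<^sup>2) / (norm (1 - \<xi> * cnj z))\<^sup>2)
          *\<^sub>R norm (\<phi> \<xi>)) / M)"
        by (simp add: poisson_transform_def \<rho>_def)
      then show ?thesis unfolding integral_divide_zero poisson_transform_def .
    qed
    moreover have "norm (\<Theta> z) / M \<le> norm (\<Theta> z)" using M(1) by (simp add: divide_le_eq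
        mult_left_le_one_le mult_le_cancel_left1)
    moreover have "\<delta> / M \<le> (poisson_transform (\<lambda>\<xi>. norm (\<phi> \<xi>)) z + norm (\<Theta> z)) / M"
      by (rule divide_right_mono[OF low[OF z]]) (use M(1) in simp)
    ultimately show ?thesis by (simp add: add_divide_distrib)
  qed
  have "\<delta> / M > 0" using \<delta> M(1) by simp
  then obtain c where c: "c > 0" and coer: "\<And>f. f \<in> ?K \<Longrightarrow> c * (L2_norm f)\<^sup>2 \<le> (LINT \<xi>|circ. \<rho> \<xi> *
      (norm (f \<xi>))\<^sup>2)"
    using model_space_coercive[OF \<Theta> \<rho>m \<rho>b _ low'] by blast
  have \<rho>L: "(\<lambda>\<xi>. of_real (\<rho> \<xi>) * f \<xi>) \<in> circle_L2" if f: "f \<in> circle_L2" for f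
  proof (rule circle_L2_mult_bounded[where C=1, OF _ _ f])
    show "(\<lambda>\<xi>. complex_of_real (\<rho> \<xi>)) \<in> borel_measurable circ" using \<rho>m by measurable
    show "AE \<xi> in circ. norm (complex_of_real (\<rho> \<xi>)) \<le> 1" using \<rho>b by eventually_elim simp
  qed
  have Ti: "L2_inner (?T f) k = of_real M * L2_inner (\<lambda>\<xi>. of_real (\<rho> \<xi>) * f \<xi>) k" if f: "f \<in> ?K"
      and k: "k \<in> ?K" for f k
  proof -
    have "L2_inner (?T f) k = L2_inner (\<lambda>\<xi>. \<phi> \<xi> * f \<xi>) k" by (rule truncated_toeplitz_inner[OF \<Theta> \<phi>
        f k])
    also have "\<dots> = L2_inner (\<lambda>\<xi>. of_real M * (of_real (\<rho> \<xi>) * f \<xi>)) k"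
      unfolding L2_inner_def
    proof (rule integral_cong_AE)
      show "AE \<xi> in circ. \<phi> \<xi> * f \<xi> * cnj (k \<xi>) = of_real M * (of_real (\<rho> \<xi>) * f \<xi>) * cnj (k \<xi>)"
        using \<phi>\<rho> by eventually_elim simp
    qed (use \<phi>m \<rho>m KL[OF f] KL[OF k] in measurable)
    also have "\<dots> = of_real M * L2_inner (\<lambda>\<xi>. of_real (\<rho> \<xi>) * f \<xi>) k" by (rule L2_inner_cmult_left)
    finally show ?thesis .
  qed
  have bb: "bounded_below_on ?K ?T"
    unfolding bounded_below_on_def
  proof (intro exI[of _ "M * c"] conjI ballI)
    show "M * c > 0" using M(1) c by simp
    fix f assume f: "f \<in> ?K"
    have "L2_inner (\<lambda>\<xi>. of_real (\<rho> \<xi>) * f \<xi>) f = of_real (LINT \<xi>|circ. \<rho> \<xi> * (norm (f \<xi>))\<^sup>2)"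
      unfolding L2_inner_def mult.assoc mult_cnj_norm of_real_mult[symmetric] by (rule
          integral_complex_of_real)
    then have "L2_inner (?T f) f = of_real (M * (LINT \<xi>|circ. \<rho> \<xi> * (norm (f \<xi>))\<^sup>2))"
      unfolding Ti[OF f f] by (simp only: of_real_mult)
    then have "\<bar>M * (LINT \<xi>|circ. \<rho> \<xi> * (norm (f \<xi>))\<^sup>2)\<bar> = norm (L2_inner (?T f) f)" by (simp
        only: norm_of_real)
    also have "\<dots> \<le> L2_norm (?T f) * L2_norm f"
      by (rule L2_Cauchy_Schwarz[OF KL[OF truncated_toeplitz_in[OF \<Theta> \<phi> f]] KL[OF f]])
    finally have "M * (c * (L2_norm f)\<^sup>2) \<le> L2_norm (?T f) * L2_norm f"
      using mult_left_mono[OF coer[OF f], of M] M(1) by linarith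
    then have "(M * c * L2_norm f) * L2_norm f \<le> L2_norm (?T f) * L2_norm f" by (simp add:
        power2_eq_square mult_ac)
    then show "M * c * L2_norm f \<le> L2_norm (?T f)"
      by (cases "L2_norm f = 0") (simp_all add: mult_le_cancel_right order_less_le)
  qed
  show ?thesis
  proof (rule invertible_onI[OF K truncated_toeplitz_bounded_operator[OF \<Theta> \<phi>] bb])
    fix g assume g: "g \<in> ?K"
    have gM: "(\<lambda>\<xi>. of_real (1 / M) * g \<xi>) \<in> ?K" by (rule L2_closed_subspace_cmult[OF K g])
    obtain h where h: "h \<in> ?K" and hk: "\<And>k. k \<in> ?K \<Longrightarrow> L2_inner (\<lambda>\<xi>. of_real (\<rho> \<xi>) * h \<xi>) k =
        L2_inner (\<lambda>\<xi>. of_real (1 / M) * g \<xi>) k"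
      using weighted_equation_solvable[OF K \<rho>m \<rho>b c coer gM] by blast
    have "AE \<xi> in circ. ?T h \<xi> = g \<xi>"
    proof (rule AE_eq_of_inner[OF K truncated_toeplitz_in[OF \<Theta> \<phi> h] g])
      fix k assume k: "k \<in> ?K"
      show "L2_inner (?T h) k = L2_inner g k"
        unfolding Ti[OF h k] hk[OF k] L2_inner_cmult_left using M(1) by simp
    qed
    then show "\<exists>h\<in>?K. AE \<xi> in circ. ?T h \<xi> = g \<xi>" using h by blast
  qed
qed

theorem theorem8p4:
  fixes \<phi> \<Theta> :: "complex \<Rightarrow> complex"
  assumes "\<phi> \<in> circle_Linf"
    and "inner_function \<Theta>"
  shows "(bounded_below_on (model_space \<Theta>) (truncated_toeplitz \<Theta> \<phi>) \<longrightarrow>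
           (\<exists>\<delta>>0. \<forall>z\<in>ball 0 1.
              poisson_transform (\<lambda>\<xi>. norm (\<phi> \<xi>)) z + norm (\<Theta> z) \<ge> \<delta>)) \<and>
         ((AE \<xi> in circle_measure. \<phi> \<xi> \<in> \<real>\<^sub>\<ge>\<^sub>0) \<longrightarrow>
           (invertible_on (model_space \<Theta>) (truncated_toeplitz \<Theta> \<phi>) \<longleftrightarrow>
             (\<exists>\<delta>>0. \<forall>z\<in>ball 0 1.
                poisson_transform (\<lambda>\<xi>. norm (\<phi> \<xi>)) z + norm (\<Theta> z) \<ge> \<delta>)))"
proof (intro conjI impI iffI)
  show "\<exists>\<delta>>0. \<forall>z\<in>ball 0 1. poisson_transform (\<lambda>\<xi>. norm (\<phi> \<xi>)) z + norm (\<Theta> z) \<ge> \<delta>"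
    if "bounded_below_on (model_space \<Theta>) (truncated_toeplitz \<Theta> \<phi>)"
    by (rule bounded_below_imp_lower_bound[OF assms that])
  show "\<exists>\<delta>>0. \<forall>z\<in>ball 0 1. poisson_transform (\<lambda>\<xi>. norm (\<phi> \<xi>)) z + norm (\<Theta> z) \<ge> \<delta>"
    if "invertible_on (model_space \<Theta>) (truncated_toeplitz \<Theta> \<phi>)"
    by (rule bounded_below_imp_lower_bound[OF assms
          invertible_imp_bounded_below[OF model_space_closed_subspace[OF assms(2)] that]])
  show "invertible_on (model_space \<Theta>) (truncated_toeplitz \<Theta> \<phi>)"
    if "AE \<xi> in circle_measure. \<phi> \<xi> \<in> \<real>\<^sub>\<ge>\<^sub>0"
      "\<exists>\<delta>>0. \<forall>z\<in>ball 0 1. poisson_transform (\<lambda>\<xi>. norm (\<phi> \<xi>)) z + norm (\<Theta> z) \<ge> \<delta>"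
    using lower_bound_imp_invertible[OF assms that(1)] that(2) by auto
qed

end
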